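(* Let $n\ge2$ be an integer, let $p$ be a place of $\mathbb Q$ (either a prime number or $p=\infty$), and let $\psi:[0,\infty)\to[0,\infty)$ be decreasing. If $$\sum_{q=1}^{\infty} q^{n-1}\psi(q)^{n-1}=\infty,$$ then $\mu_p(\mathcal W_p(\psi))=1$.
   Context: Places of $\mathbb Q$: primes $v$ and $v=\infty$, with $\mathbb Q_\infty=\mathbb R$. $|\cdot|_v$ is the standard $v$-adic absolute value ($|v|_v=v^{-1}$) for a prime $v$ and the usual absolute value for $v=\infty$. For $\mathbf x\in\mathbb Q_v^m$ put $|\mathbf x|_v=\max_i|x_i|_v$ if $v$ is a prime and $|\mathbf x|_\infty=(\sum_i x_i^2)^{1/2}$. For $\mathbf x,\mathbf y\in\mathbb Q_v^n$, $\mathbf x\wedge\mathbf y$ is the vector with coordinates $x_iy_j-x_jy_i$ ($1\le i<j\le n$), and for nonzero $\mathbf x,\mathbf y$, $\delta_v(\mathbf x,\mathbf y)=|\mathbf x\wedge\mathbf y|_v/(|\mathbf x|_v|\mathbf y|_v)$, a metric on $\mathbb P^{n-1}(\mathbb Q_v)$. Let $\phi:\mathbb Q_p^n\setminus\{\mathbf 0\}\to\mathbb P^{n-1}(\mathbb Q_p)$ be the quotient map. The height of $\mathbf y\in\mathbb P^{n-1}(\mathbb Q)$ is $H(\mathbf y)=\prod_v|\mathbf y|_v$ over all places $v$, for any representative $\mathbf y\in\mathbb Q^n\setminus\{0\}$ (for a representative in $\mathbb Z^n$ with coprime coordinates this is its Euclidean norm). Let $\beta_p^n$ be Lebesgue measure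 on $\mathbb R^n$ if $p=\infty$, and Haar measure on $\mathbb Q_p^n$ normalized by $\beta_p^n(\mathbb Z_p^n)=1$ if $p$ is prime. For $M\subseteq\mathbb P^{n-1}(\mathbb Q_p)$ with $\phi^{-1}(M)$ Borel, $\mu_p(M)=\beta_p^n(\phi^{-1}(M)\cap B(\mathbf 0,1))/\beta_p^n(B(\mathbf 0,1))$, where $B(\mathbf 0,1)=\{\mathbf x\in\mathbb Q_p^n:|\mathbf x|_p\le1\}$. For $\psi:[0,\infty)\to[0,\infty)$, $\mathcal W_p(\psi)$ is the set of $\mathbf x\in\mathbb P^{n-1}(\mathbb Q_p)$ for which there are infinitely many $\mathbf y\in\mathbb P^{n-1}(\mathbb Q)$ with $\delta_p(\mathbf x,\mathbf y)\le\psi(H(\mathbf y))$. *)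

theory Defs
  imports
    "HOL-Analysis.Analysis"
    "HOL-Library.Extended_Nat"
    "HOL-Library.Groups_Big_Fun"
    "HOL-Computational_Algebra.Squarefree"
    "Berlekamp_Zassenhaus.Finite_Field"
begin

section \<open>Places of the rationals and absolute values\<close>

definition is_place :: "enat \<Rightarrow> bool" where
  "is_place v \<longleftrightarrow> v = \<infinity> \<or> (\<exists>p. prime p \<and> v = enat p)"

definition padic_abs :: "nat \<Rightarrow> rat \<Rightarrow> real" where
  "padic_abs p x = (if x = 0 then 0 else
     real p powi (int (multiplicity (int p) (snd (quotient_of x)))
                  - int (multiplicity (int p) (fst (quotient_of x)))))"

definition rat_abs :: "enat \<Rightarrow> rat \<Rightarrow> real" where
  "rat_abs v x = (case v of enat p \<Rightarrow> padic_abs p x | \<infinity> \<Rightarrow> \<bar>of_rat x\<bar>)"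

text \<open>
  The norm at the place \<open>v\<close> of a finite family whose entries have absolute values \<open>f i\<close>
  (\<open>0\<close> is inserted only so that the maximum makes sense for an empty family).
\<close>

definition place_norm :: "enat \<Rightarrow> ('i \<Rightarrow> real) \<Rightarrow> 'i set \<Rightarrow> real" where
  "place_norm v f I = (if v = \<infinity> then L2_set f I else Max (insert 0 (f ` I)))"

lemma place_norm_scale:
  assumes "finite I" "c \<ge> 0" "\<And>i. i \<in> I \<Longrightarrow> g i = c * f i"
  shows "place_norm v g I = c * place_norm v f I"
proof -
  have "L2_set g I = c * L2_set f I"
    using assms by (simp add: L2_set_right_distrib cong: L2_set_cong)
  moreover have "Max (insert 0 (g ` I)) = c * Max (insert 0 (f ` I))"
  proof -
    have "insert 0 (g ` I) = (\<lambda>x. c * x) ` insert 0 (f ` I)"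
      using assms(3) by (auto simp: image_image cong: image_cong)
    moreover have "mono (\<lambda>x. c * x)"
      using assms(2) by (intro monoI mult_left_mono)
    ultimately show ?thesis
      using mono_Max_commute[of "\<lambda>x. c * x" "insert 0 (f ` I)"] assms(1) by simp
  qed
  ultimately show ?thesis by (simp add: place_norm_def)
qed

lemma place_norm_nonneg:
  "finite I \<Longrightarrow> place_norm v f I \<ge> 0"
  by (simp add: place_norm_def)


lemma padic_abs_0 [simp]: "padic_abs p 0 = 0"
  by (simp add: padic_abs_def)

lemma padic_abs_fraction:
  assumes p: "prime p" and "a \<noteq> 0" "b \<noteq> 0"
  shows "padic_abs p (of_int a / of_int b) =
           real p powi (int (multiplicity (int p) b) - int (multiplicity (int p) a))"
proof -
  define x :: rat where "x = of_int a / of_int b"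
  obtain c d where cd: "quotient_of x = (c, d)" by fastforce
  have d: "d > 0" using cd by (rule quotient_of_denom_pos)
  have x: "x = of_int c / of_int d" using cd by (rule quotient_of_div)
  have "x \<noteq> 0" using assms by (simp add: x_def)
  then have c: "c \<noteq> 0" using x by auto
  have "of_int (a * d) = (of_int (c * b) :: rat)"
    using x d assms by (simp add: x_def field_simps)
  then have "a * d = c * b" by (simp only: of_int_eq_iff)
  then have "multiplicity (int p) (a * d) = multiplicity (int p) (c * b)" by simp
  then have "multiplicity (int p) a + multiplicity (int p) d
             = multiplicity (int p) c + multiplicity (int p) b"
    using p c d assms by (simp add: prime_elem_multiplicity_mult_distrib)
  then have "int (multiplicity (int p) d) - int (multiplicity (int p) c)
      = int (multiplicity (int p) b) - int (multiplicity (int p) a)" by linarith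
  then show ?thesis
    using \<open>x \<noteq> 0\<close> by (simp add: padic_abs_def cd flip: x_def)
qed

lemma rat_common_denom:
  fixes x y :: rat
  obtains a b d :: int where "x = of_int a / of_int d" "y = of_int b / of_int d" "d > 0"
proof -
  obtain a c where ac: "quotient_of x = (a, c)" by fastforce
  obtain b e where be: "quotient_of y = (b, e)" by fastforce
  have "c > 0" "e > 0" using ac be by (auto intro: quotient_of_denom_pos)
  then show ?thesis
    using that[of "a * e" "c * e" "b * c"] quotient_of_div[OF ac] quotient_of_div[OF be]
    by (simp add: field_simps)
qed

lemma padic_abs_pos: "prime p \<Longrightarrow> x \<noteq> 0 \<Longrightarrow> padic_abs p x > 0"
  by (auto simp: padic_abs_def intro!: zero_less_power_int dest: prime_gt_0_nat)

lemma padic_abs_nonneg [simp]: "padic_abs p x \<ge> 0"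
  by (simp add: padic_abs_def)

lemma padic_abs_eq_0_iff: "prime p \<Longrightarrow> padic_abs p x = 0 \<longleftrightarrow> x = 0"
  using padic_abs_pos[of p x] by (cases "x = 0") auto

lemma padic_abs_1 [simp]: "padic_abs p 1 = 1"
  by (simp add: padic_abs_def)

lemma padic_abs_minus [simp]: "padic_abs p (- x) = padic_abs p x"
  by (cases "quotient_of x") (simp add: padic_abs_def rat_uminus_code multiplicity_uminus_right)

lemma padic_abs_diff_commute: "padic_abs p (x - y) = padic_abs p (y - x)"
  using padic_abs_minus[of p "x - y"] by simp

lemma padic_abs_mult:
  assumes p: "prime p"
  shows "padic_abs p (x * y) = padic_abs p x * padic_abs p y"
proof (cases "x = 0 \<or> y = 0")
  case False
  obtain a b d where abd: "x = of_int a / of_int d" "y = of_int b / of_int d" "d > 0"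
    by (rule rat_common_denom)
  then have ab: "a \<noteq> 0" "b \<noteq> 0" using False by auto
  have "x * y = of_int (a * b) / of_int (d * d)" by (simp add: abd)
  then have "padic_abs p (x * y) = real p powi (int (multiplicity (int p) (d * d))
      - int (multiplicity (int p) (a * b)))"
    using padic_abs_fraction[OF p, of "a * b" "d * d"] ab abd by simp
  also have "\<dots> = real p powi ((int (multiplicity (int p) d) - int (multiplicity (int p) a))
      + (int (multiplicity (int p) d) - int (multiplicity (int p) b)))"
    using ab abd p by (simp add: prime_elem_multiplicity_mult_distrib algebra_simps)
  also have "\<dots> = padic_abs p x * padic_abs p y"
    using p ab abd by (subst power_int_add) (auto simp: padic_abs_fraction)
  finally show ?thesis .
qed auto

lemma padic_abs_inverse: "prime p \<Longrightarrow> padic_abs p (inverse x) = inverse (padic_abs p x)"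
proof (cases "x = 0")
  case False
  assume p: "prime p"
  then have "padic_abs p x * padic_abs p (inverse x) = 1"
    using False padic_abs_mult[OF p, of x "inverse x"] by simp
  then show ?thesis by (metis inverse_unique)
qed auto

lemma padic_abs_ultrametric:
  assumes p: "prime p"
  shows "padic_abs p (x + y) \<le> max (padic_abs p x) (padic_abs p y)"
proof (cases "x = 0 \<or> y = 0 \<or> x + y = 0")
  case False
  obtain a b d where abd: "x = of_int a / of_int d" "y = of_int b / of_int d" "d > 0"
    by (rule rat_common_denom)
  have xy: "x + y = of_int (a + b) / of_int d" by (simp add: abd add_divide_distrib)
  have nz: "a \<noteq> 0" "b \<noteq> 0" "a + b \<noteq> 0"
    using False abd xy by auto
  define m where "m = min (multiplicity (int p) a) (multiplicity (int p) b)"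
  have "int p ^ m dvd a + b"
    by (intro dvd_add multiplicity_dvd') (auto simp: m_def)
  then have "m \<le> multiplicity (int p) (a + b)"
    using nz p by (intro multiplicity_geI) (auto simp: prime_nat_iff)
  then have "int (multiplicity (int p) (a + b)) \<ge> int (multiplicity (int p) a) \<or>
             int (multiplicity (int p) (a + b)) \<ge> int (multiplicity (int p) b)"
    by (auto simp: m_def min_def split: if_splits)
  then have "padic_abs p (x + y) \<le> padic_abs p x \<or> padic_abs p (x + y) \<le> padic_abs p y"
    unfolding xy unfolding abd using p nz \<open>d > 0\<close> prime_ge_1_nat[OF p]
    by (subst (1 2 3 4) padic_abs_fraction) (auto intro!: power_int_increasing)
  then show ?thesis by auto
qed (auto simp: le_max_iff_disj)

lemma padic_abs_triangle: "prime p \<Longrightarrow> padic_abs p (x + y) \<le> padic_abs p x + padic_abs p y"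
  using padic_abs_ultrametric[of p x y] padic_abs_nonneg[of p x] padic_abs_nonneg[of p y] by linarith

lemma padic_abs_diff_bound:
  assumes p: "prime p"
  shows "\<bar>padic_abs p x - padic_abs p y\<bar> \<le> padic_abs p (x - y)"
  using padic_abs_triangle[OF p, of "x - y" y] padic_abs_triangle[OF p, of "y - x" x]
    padic_abs_diff_commute[of p x y] by simp


lemma rat_abs_mult: "is_place v \<Longrightarrow> rat_abs v (x * y) = rat_abs v x * rat_abs v y"
  by (auto simp: is_place_def rat_abs_def padic_abs_mult of_rat_mult abs_mult)

lemma rat_abs_nonneg: "rat_abs v x \<ge> 0"
  by (simp add: rat_abs_def split: enat.split)

lemma rat_abs_0 [simp]: "rat_abs v 0 = 0"
  by (simp add: rat_abs_def split: enat.split)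

lemma rat_abs_1 [simp]: "rat_abs v 1 = 1"
  by (simp add: rat_abs_def split: enat.split)

lemma rat_abs_eq_0_iff: "is_place v \<Longrightarrow> rat_abs v x = 0 \<longleftrightarrow> x = 0"
  by (auto simp: is_place_def rat_abs_def padic_abs_eq_0_iff)

lemma product_formula:
  assumes "c \<noteq> 0"
  shows "finite {v. is_place v \<and> rat_abs v c \<noteq> 1}"
    and "Prod_any (\<lambda>v. if is_place v then rat_abs v c else 1) = 1"
proof -
  define F where "F c v = (if is_place v then rat_abs v c else 1)" for c v
  define P where "P c \<longleftrightarrow> c \<noteq> 0 \<and> finite {v. F c v \<noteq> 1} \<and> Prod_any (F c) = 1" for c
  have F_mult: "F (a * b) = (\<lambda>v. F a v * F b v)" for a b
    by (auto simp: F_def rat_abs_mult)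
  have P_mult: "P (a * b)" if "P a" "P b" for a b
  proof -
    have "finite {v. F (a * b) v \<noteq> 1}"
      by (rule finite_subset[of _ "{v. F a v \<noteq> 1} \<union> {v. F b v \<noteq> 1}"])
        (use that in \<open>auto simp: P_def F_mult\<close>)
    moreover have "Prod_any (F (a * b)) = 1"
      using that by (simp add: F_mult P_def Prod_any.distrib)
    ultimately show ?thesis using that by (auto simp: P_def)
  qed
  have "F 1 = (\<lambda>_. 1)" by (auto simp: F_def)
  then have P_1: "P 1" by (simp add: P_def)
  have P_inverse: "P (inverse a)" if "P a" for a
  proof -
    have "F a v * F (inverse a) v = 1" for v
      using that fun_cong[OF F_mult[of a "inverse a"], of v] \<open>F 1 = _\<close> by (simp add: P_def)
    then have eq: "F (inverse a) v = inverse (F a v)" for v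
      by (metis inverse_unique)
    then have fin: "finite {v. F (inverse a) v \<noteq> 1}"
      using that by (simp add: P_def)
    have "Prod_any (F a) * Prod_any (F (inverse a)) = Prod_any (\<lambda>v. F a v * F (inverse a) v)"
      using that fin by (intro Prod_any.distrib[symmetric]) (auto simp: P_def)
    then show ?thesis
      using that fin \<open>\<And>v. F a v * F (inverse a) v = 1\<close> by (simp add: P_def)
  qed
  have P_prime: "P (of_nat q)" if q: "prime q" for q
  proof -
    have abs: "padic_abs p (of_nat q) = (if p = q then inverse (real q) else 1)" if "prime p" for p
      using padic_abs_fraction[OF that, of "int q" 1] q that prime_gt_0_nat[OF q]
      by (auto simp: prime_multiplicity_other power_int_minus)
    have sub: "{v. F (of_nat q) v \<noteq> 1} \<subseteq> {\<infinity>, enat q}"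
      by (auto simp: F_def is_place_def rat_abs_def abs split: if_splits)
    then have fin: "finite {v. F (of_nat q) v \<noteq> 1}" by (rule finite_subset) simp
    have "Prod_any (F (of_nat q)) = prod (F (of_nat q)) {\<infinity>, enat q}"
      using sub by (intro Prod_any.expand_superset) auto
    also have "\<dots> = 1"
      using q abs[OF q] prime_gt_0_nat[OF q] by (auto simp: F_def is_place_def rat_abs_def)
    finally show ?thesis using fin prime_gt_0_nat[OF q] by (simp add: P_def)
  qed
  have P_nat: "P (of_nat n)" if "n \<noteq> 0" for n
    using that
  proof (induction n rule: prime_divisors_induct)
    case (factor p x)
    then show ?case by (auto simp: P_prime intro: P_mult)
  qed (auto simp: P_1)
  have P_minus: "P (- a)" if "P a" for a
  proof -
    have "F (- a) = F a"
      by (auto simp: F_def rat_abs_def of_rat_minus split: enat.split)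
    then show ?thesis using that by (simp add: P_def)
  qed
  have P_int: "P (of_int a)" if "a \<noteq> 0" for a
  proof (cases "a \<ge> 0")
    case True
    then show ?thesis using P_nat[of "nat a"] that by simp
  next
    case False
    then show ?thesis using P_minus[OF P_nat[of "nat (- a)"]] by simp
  qed
  obtain a b where ab: "quotient_of c = (a, b)" by fastforce
  then have "c = of_int a * inverse (of_int b)" "b > 0"
    using quotient_of_div quotient_of_denom_pos by (auto simp: divide_inverse)
  moreover have "a \<noteq> 0" using calculation assms by auto
  ultimately have "P c" by (auto intro!: P_mult P_inverse P_int)
  then show "Prod_any (\<lambda>v. if is_place v then rat_abs v c else 1) = 1"
    by (simp add: P_def F_def)
  have "{v. is_place v \<and> rat_abs v c \<noteq> 1} = {v. F c v \<noteq> 1}"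
    by (auto simp: F_def)
  then show "finite {v. is_place v \<and> rat_abs v c \<noteq> 1}"
    using \<open>P c\<close> by (simp add: P_def)
qed


section \<open>Completions of the rationals\<close>

text \<open>
  A type of this class is the completion of the rationals at the place \<open>place_of\<close>;
  \<open>vabs\<close> is the absolute value.  The instances are \<^typ>\<open>real\<close> and the \<open>p\<close>-adic numbers.
\<close>

class rat_completion = field_char_0 + complete_space +
  fixes place_of :: "'a itself \<Rightarrow> enat"
    and vabs :: "'a \<Rightarrow> real"
  assumes is_place_place_of: "is_place (place_of TYPE('a))"
    and dist_vabs: "dist x y = vabs (x - y)"
    and vabs_mult: "vabs (x * y) = vabs x * vabs y"
    and vabs_of_rat: "vabs (of_rat r) = rat_abs (place_of TYPE('a)) r"
    and rat_dense: "e > 0 \<Longrightarrow> \<exists>r. dist (of_rat r) x < e"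

lemma vabs_nonneg [simp]: "vabs (x :: 'a :: rat_completion) \<ge> 0"
  using dist_vabs[of x 0] zero_le_dist[of x 0] by simp

lemma vabs_eq_0_iff [simp]: "vabs (x :: 'a :: rat_completion) = 0 \<longleftrightarrow> x = 0"
  using dist_vabs[of x 0] dist_eq_0_iff[of x 0] by simp

instantiation real :: rat_completion
begin

definition place_of_real :: "real itself \<Rightarrow> enat" where
  "place_of_real _ = \<infinity>"

definition vabs_real :: "real \<Rightarrow> real" where
  "vabs_real x = \<bar>x\<bar>"

instance
proof
  fix x e :: real
  assume "e > 0"
  then obtain r where "x < of_rat r" "of_rat r < x + e"
    using of_rat_dense[of x "x + e"] by auto
  then have "dist (of_rat r) x < e" by (simp add: dist_real_def)
  then show "\<exists>r. dist (of_rat r) x < e" ..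
qed (auto simp: is_place_def place_of_real_def vabs_real_def dist_real_def abs_mult rat_abs_def)

end


section \<open>The field of p-adic numbers\<close>

definition padic_cauchy :: "nat \<Rightarrow> (nat \<Rightarrow> rat) \<Rightarrow> bool" where
  "padic_cauchy p X \<longleftrightarrow> (\<forall>e>0. \<exists>k. \<forall>m\<ge>k. \<forall>n\<ge>k. padic_abs p (X m - X n) < e)"

definition padic_null :: "nat \<Rightarrow> (nat \<Rightarrow> rat) \<Rightarrow> bool" where
  "padic_null p X \<longleftrightarrow> (\<lambda>n. padic_abs p (X n)) \<longlonglongrightarrow> 0"

definition padic_rel :: "nat \<Rightarrow> (nat \<Rightarrow> rat) \<Rightarrow> (nat \<Rightarrow> rat) \<Rightarrow> bool" where
  "padic_rel p X Y \<longleftrightarrow> padic_cauchy p X \<and> padic_cauchy p Y \<and> padic_null p (\<lambda>n. X n - Y n)"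

lemma padic_cauchyD:
  "padic_cauchy p X \<Longrightarrow> e > 0 \<Longrightarrow> \<exists>k. \<forall>m\<ge>k. \<forall>n\<ge>k. padic_abs p (X m - X n) < e"
  by (simp add: padic_cauchy_def)

lemma padic_cauchy_const [simp]: "padic_cauchy p (\<lambda>n. c)"
  by (simp add: padic_cauchy_def)

lemma padic_null_zero [simp]: "padic_null p (\<lambda>n. 0)"
  by (simp add: padic_null_def)

lemma padic_null_minus: "padic_null p X \<Longrightarrow> padic_null p (\<lambda>n. - X n)"
  by (simp add: padic_null_def)

lemma padic_cauchy_minus [simp]: "padic_cauchy p X \<Longrightarrow> padic_cauchy p (\<lambda>n. - X n)"
  unfolding padic_cauchy_def minus_diff_minus padic_abs_minus .

context
  fixes p :: nat
  assumes p: "prime p"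
begin

lemma padic_null_add:
  assumes "padic_null p X" "padic_null p Y"
  shows "padic_null p (\<lambda>n. X n + Y n)"
  unfolding padic_null_def
proof (rule tendsto_sandwich[OF _ _ tendsto_const])
  show "(\<lambda>n. padic_abs p (X n) + padic_abs p (Y n)) \<longlonglongrightarrow> 0"
    using assms tendsto_add unfolding padic_null_def by fastforce
qed (auto simp: padic_abs_triangle[OF p])

lemma padic_null_diff:
  "padic_null p X \<Longrightarrow> padic_null p Y \<Longrightarrow> padic_null p (\<lambda>n. X n - Y n)"
  using padic_null_add[of X "\<lambda>n. - Y n"] padic_null_minus[of p Y] by simp

lemma padic_cauchy_abs_convergent:
  assumes "padic_cauchy p X"
  shows "convergent (\<lambda>n. padic_abs p (X n))"
proof -
  have "Cauchy (\<lambda>n. padic_abs p (X n))"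
    unfolding Cauchy_def dist_real_def
    using assms padic_abs_diff_bound[OF p] unfolding padic_cauchy_def by (meson le_less_trans)
  then show ?thesis by (simp add: Cauchy_convergent_iff)
qed

lemma padic_cauchy_bounded:
  assumes "padic_cauchy p X"
  obtains b where "b > 0" "\<And>n. padic_abs p (X n) < b"
proof -
  have "Bseq (\<lambda>n. padic_abs p (X n))"
    using padic_cauchy_abs_convergent[OF assms] by (rule convergent_imp_Bseq)
  then obtain b where "b > 0" "\<And>n. padic_abs p (X n) \<le> b"
    by (auto elim!: BseqE)
  then show ?thesis using that[of "b + 1"] by (force intro: le_less_trans)
qed

lemma padic_null_mult:
  assumes "padic_cauchy p X" "padic_null p Y"
  shows "padic_null p (\<lambda>n. X n * Y n)"
proof -
  obtain L where "(\<lambda>n. padic_abs p (X n)) \<longlonglongrightarrow> L"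
    using padic_cauchy_abs_convergent[OF assms(1)] by (auto simp: convergent_def)
  from tendsto_mult[OF this assms(2)[unfolded padic_null_def]] show ?thesis
    by (simp add: padic_null_def padic_abs_mult[OF p])
qed

lemma padic_cauchy_add [simp]:
  assumes "padic_cauchy p X" "padic_cauchy p Y"
  shows "padic_cauchy p (\<lambda>n. X n + Y n)"
  unfolding padic_cauchy_def
proof (intro allI impI)
  fix e :: real
  assume "e > 0"
  then obtain i j where
    i: "\<And>m n. m \<ge> i \<Longrightarrow> n \<ge> i \<Longrightarrow> padic_abs p (X m - X n) < e" and
    j: "\<And>m n. m \<ge> j \<Longrightarrow> n \<ge> j \<Longrightarrow> padic_abs p (Y m - Y n) < e"
    using assms[THEN padic_cauchyD] by metis
  have "padic_abs p (X m + Y m - (X n + Y n)) < e" if "m \<ge> max i j" "n \<ge> max i j" for m n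
    using padic_abs_ultrametric[OF p, of "X m - X n" "Y m - Y n"] i[of m n] j[of m n] that
    by (auto simp: algebra_simps)
  then show "\<exists>k. \<forall>m\<ge>k. \<forall>n\<ge>k. padic_abs p (X m + Y m - (X n + Y n)) < e" by blast
qed

lemma padic_cauchy_diff [simp]:
  "padic_cauchy p X \<Longrightarrow> padic_cauchy p Y \<Longrightarrow> padic_cauchy p (\<lambda>n. X n - Y n)"
  using padic_cauchy_add[of X "\<lambda>n. - Y n"] by simp

lemma padic_cauchy_mult [simp]:
  assumes X: "padic_cauchy p X" and Y: "padic_cauchy p Y"
  shows "padic_cauchy p (\<lambda>n. X n * Y n)"
  unfolding padic_cauchy_def
proof (intro allI impI)
  fix e :: real
  assume e: "e > 0"
  obtain a where a: "a > 0" "\<And>n. padic_abs p (X n) < a"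
    using padic_cauchy_bounded[OF X] by blast
  obtain b where b: "b > 0" "\<And>n. padic_abs p (Y n) < b"
    using padic_cauchy_bounded[OF Y] by blast
  obtain i where i: "\<And>m n. m \<ge> i \<Longrightarrow> n \<ge> i \<Longrightarrow> padic_abs p (X m - X n) < e / b"
    using padic_cauchyD[OF X, of "e / b"] e b by auto
  obtain j where j: "\<And>m n. m \<ge> j \<Longrightarrow> n \<ge> j \<Longrightarrow> padic_abs p (Y m - Y n) < e / a"
    using padic_cauchyD[OF Y, of "e / a"] e a by auto
  have "padic_abs p (X m * Y m - X n * Y n) < e" if "m \<ge> max i j" "n \<ge> max i j" for m n
  proof -
    have "padic_abs p (X m) * padic_abs p (Y m - Y n) < a * (e / a)"
      using a j that by (intro mult_strict_mono') auto
    moreover have "padic_abs p (X m - X n) * padic_abs p (Y n) < (e / b) * b"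
      using b i that by (intro mult_strict_mono') auto
    moreover have "padic_abs p (X m * Y m - X n * Y n) \<le>
        max (padic_abs p (X m * (Y m - Y n))) (padic_abs p ((X m - X n) * Y n))"
      using padic_abs_ultrametric[OF p] by (subst mult_diff_mult)
    ultimately show ?thesis using a b by (auto simp: padic_abs_mult[OF p])
  qed
  then show "\<exists>k. \<forall>m\<ge>k. \<forall>n\<ge>k. padic_abs p (X m * Y m - X n * Y n) < e" by blast
qed

lemma padic_cauchy_bounded_below:
  assumes X: "padic_cauchy p X" "\<not> padic_null p X"
  obtains b k where "b > 0" "\<And>n. n \<ge> k \<Longrightarrow> padic_abs p (X n) > b"
proof -
  obtain L where L: "(\<lambda>n. padic_abs p (X n)) \<longlonglongrightarrow> L"
    using padic_cauchy_abs_convergent[OF X(1)] by (auto simp: convergent_def)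
  then have "L \<ge> 0" by (rule LIMSEQ_le_const) auto
  moreover have "L \<noteq> 0" using L X(2) by (auto simp: padic_null_def)
  ultimately have "L > 0" by simp
  then have "eventually (\<lambda>n. padic_abs p (X n) > L / 2) sequentially"
    using order_tendstoD(1)[OF L, of "L / 2"] by simp
  then show ?thesis
    using that[of "L / 2"] \<open>L > 0\<close> by (auto simp: eventually_sequentially)
qed

lemma padic_abs_inverse_diff:
  assumes "x \<noteq> 0" "y \<noteq> 0"
  shows "padic_abs p (inverse x - inverse y) =
           inverse (padic_abs p x) * padic_abs p (x - y) * inverse (padic_abs p y)"
  using assms by (simp add: inverse_diff_inverse padic_abs_mult[OF p] padic_abs_inverse[OF p])

lemma padic_cauchy_inverse [simp]:
  assumes X: "padic_cauchy p X" "\<not> padic_null p X"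
  shows "padic_cauchy p (\<lambda>n. inverse (X n))"
  unfolding padic_cauchy_def
proof (intro allI impI)
  fix e :: real
  assume e: "e > 0"
  obtain b i where b: "b > 0" "\<And>n. n \<ge> i \<Longrightarrow> padic_abs p (X n) > b"
    using padic_cauchy_bounded_below[OF X] by blast
  obtain j where j: "\<And>m n. m \<ge> j \<Longrightarrow> n \<ge> j \<Longrightarrow> padic_abs p (X m - X n) < b * e * b"
    using padic_cauchyD[OF X(1), of "b * e * b"] e b(1) by (meson mult_pos_pos)
  have "padic_abs p (inverse (X m) - inverse (X n)) < e" if "m \<ge> max i j" "n \<ge> max i j" for m n
  proof -
    have mn: "padic_abs p (X m) > b" "padic_abs p (X n) > b" using b(2) that by auto
    then have "X m \<noteq> 0" "X n \<noteq> 0" using b(1) by auto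
    then have "padic_abs p (inverse (X m) - inverse (X n)) =
        inverse (padic_abs p (X m)) * padic_abs p (X m - X n) * inverse (padic_abs p (X n))"
      by (rule padic_abs_inverse_diff)
    also have "\<dots> < inverse b * (b * e * b) * inverse b"
      using mn b(1) j[of m n] that by (intro mult_strict_mono' less_imp_inverse_less) auto
    also have "\<dots> = e" using b(1) by simp
    finally show ?thesis .
  qed
  then show "\<exists>k. \<forall>m\<ge>k. \<forall>n\<ge>k. padic_abs p (inverse (X m) - inverse (X n)) < e" by blast
qed

lemma padic_null_cong:
  assumes "padic_null p (\<lambda>n. X n - Y n)"
  shows "padic_null p X \<longleftrightarrow> padic_null p Y"
  using padic_null_add[OF assms, of Y] padic_null_diff[of X, OF _ assms] by auto

lemma padic_null_inverse_diff:
  assumes X: "padic_cauchy p X" "\<not> padic_null p X"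
    and Y: "padic_cauchy p Y" "\<not> padic_null p Y"
    and XY: "padic_null p (\<lambda>n. X n - Y n)"
  shows "padic_null p (\<lambda>n. inverse (X n) - inverse (Y n))"
proof -
  obtain a i where a: "a > 0" "\<And>n. n \<ge> i \<Longrightarrow> padic_abs p (X n) > a"
    using padic_cauchy_bounded_below[OF X] by metis
  obtain b j where b: "b > 0" "\<And>n. n \<ge> j \<Longrightarrow> padic_abs p (Y n) > b"
    using padic_cauchy_bounded_below[OF Y] by metis
  have ev: "eventually (\<lambda>n. inverse (X n) * (- (X n - Y n) * inverse (Y n))
                       = inverse (X n) - inverse (Y n)) sequentially"
    unfolding eventually_sequentially
  proof (intro exI allI impI)
    fix n assume "n \<ge> max i j"
    then have "X n \<noteq> 0" "Y n \<noteq> 0" using a b by force+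
    then show "inverse (X n) * (- (X n - Y n) * inverse (Y n)) = inverse (X n) - inverse (Y n)"
      by (simp add: field_simps)
  qed
  have "padic_null p (\<lambda>n. inverse (Y n) * - (X n - Y n))"
    by (rule padic_null_mult[OF padic_cauchy_inverse[OF Y] padic_null_minus[OF XY]])
  then have "padic_null p (\<lambda>n. - (X n - Y n) * inverse (Y n))"
    by (simp only: mult.commute)
  then have "padic_null p (\<lambda>n. inverse (X n) * (- (X n - Y n) * inverse (Y n)))"
    by (rule padic_null_mult[OF padic_cauchy_inverse[OF X]])
  moreover have "eventually (\<lambda>n. padic_abs p (inverse (X n) * (- (X n - Y n) * inverse (Y n)))
                       = padic_abs p (inverse (X n) - inverse (Y n))) sequentially"
    using ev by eventually_elim simp
  ultimately show ?thesis
    unfolding padic_null_def by (rule Lim_transform_eventually)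
qed

lemma padic_null_inverse_mult:
  assumes X: "padic_cauchy p X" "\<not> padic_null p X"
  shows "padic_null p (\<lambda>n. inverse (X n) * X n - 1)"
proof -
  obtain b k where b: "b > 0" "\<And>n. n \<ge> k \<Longrightarrow> padic_abs p (X n) > b"
    using padic_cauchy_bounded_below[OF X] by metis
  have "eventually (\<lambda>n. padic_abs p (inverse (X n) * X n - 1) = 0) sequentially"
    unfolding eventually_sequentially
  proof (intro exI allI impI)
    fix n assume "n \<ge> k"
    then have "X n \<noteq> 0" using b by force
    then show "padic_abs p (inverse (X n) * X n - 1) = 0" by simp
  qed
  then show ?thesis unfolding padic_null_def by (rule tendsto_eventually)
qed

lemma part_equivp_padic_rel: "part_equivp (padic_rel p)"
proof (rule part_equivpI)
  show "\<exists>X. padic_rel p X X"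
    by (rule exI[of _ "\<lambda>n. 0"]) (simp add: padic_rel_def)
  show "symp (padic_rel p)"
    by (simp add: symp_def padic_rel_def padic_null_def padic_abs_diff_commute)
  show "transp (padic_rel p)"
    unfolding padic_rel_def by (rule transpI) (force dest: padic_null_add)
qed

lemma padic_rel_lim:
  assumes "padic_rel p X Y"
  shows "lim (\<lambda>n. padic_abs p (X n)) = lim (\<lambda>n. padic_abs p (Y n))"
proof -
  obtain L where L: "(\<lambda>n. padic_abs p (Y n)) \<longlonglongrightarrow> L"
    using assms padic_cauchy_abs_convergent by (auto simp: padic_rel_def convergent_def)
  have "(\<lambda>n. padic_abs p (X n) - padic_abs p (Y n)) \<longlonglongrightarrow> 0"
  proof (rule Lim_null_comparison)
    show "(\<lambda>n. padic_abs p (X n - Y n)) \<longlonglongrightarrow> 0"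
      using assms by (simp add: padic_rel_def padic_null_def)
  qed (auto simp: padic_abs_diff_bound[OF p])
  from tendsto_add[OF this L] show ?thesis
    using L by (simp add: limI)
qed

end

text \<open>
  The type variable plays the role of the prime: \<open>'p padic\<close> is the field of \<open>CARD('p)\<close>-adic
  numbers, the completion of the rationals with respect to \<^const>\<open>padic_abs\<close>.
\<close>

typedef 'p padic = "{S. \<exists>X. padic_rel CARD('p :: prime_card) X X \<and> S = Collect (padic_rel CARD('p) X)}"
  morphisms class_of_padic padic_of_class
  by (auto intro!: exI[of _ "\<lambda>n. 0"] simp: padic_rel_def)

definition Padic :: "(nat \<Rightarrow> rat) \<Rightarrow> 'p :: prime_card padic" where
  "Padic X = padic_of_class (Collect (padic_rel CARD('p) X))"

definition rep_padic :: "'p :: prime_card padic \<Rightarrow> nat \<Rightarrow> rat" where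
  "rep_padic x = (SOME X. X \<in> class_of_padic x)"

definition cr_padic :: "(nat \<Rightarrow> rat) \<Rightarrow> 'p :: prime_card padic \<Rightarrow> bool" where
  "cr_padic = (\<lambda>X x. padic_rel CARD('p) X X \<and> Padic X = x)"

lemma Quotient_padic:
  "Quotient (padic_rel CARD('p)) Padic (rep_padic :: 'p :: prime_card padic \<Rightarrow> _) cr_padic"
proof -
  interpret quot_type "padic_rel CARD('p)" padic_of_class "class_of_padic :: 'p padic \<Rightarrow> _"
    by (rule quot_type.intro[OF part_equivp_padic_rel[OF prime_card]])
      (use class_of_padic[where 'p = 'p] in
        \<open>simp_all add: class_of_padic_inverse padic_of_class_inverse class_of_padic_inject\<close>)
  have "abs = Padic" "rep = rep_padic"
    by (auto simp: abs_def Padic_def rep_def rep_padic_def)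
  then have "Quotient3 (padic_rel CARD('p)) Padic (rep_padic :: 'p padic \<Rightarrow> _)"
    using Quotient by simp
  then show ?thesis
    unfolding cr_padic_def by (rule Quotient3_to_Quotient) simp
qed

setup_lifting Quotient_padic

lemma padic_rel_refl: "padic_cauchy p X \<Longrightarrow> padic_rel p X X"
  by (simp add: padic_rel_def)

lemma Padic_induct [case_names Padic, induct type: padic]:
  fixes x :: "'p :: prime_card padic"
  assumes "\<And>X. padic_cauchy CARD('p) X \<Longrightarrow> P (Padic X)"
  shows "P x"
proof -
  have "Padic (rep_padic x) = x" "padic_rel CARD('p) (rep_padic x) (rep_padic x)"
    by (rule Quotient_abs_rep[OF Quotient_padic], rule Quotient_rep_reflp[OF Quotient_padic])
  then show ?thesis using assms[of "rep_padic x"] by (simp add: padic_rel_def)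
qed

instantiation padic :: (prime_card) field
begin

lift_definition zero_padic :: "'a padic" is "\<lambda>n. 0"
  by (simp add: padic_rel_refl)

lift_definition one_padic :: "'a padic" is "\<lambda>n. 1"
  by (simp add: padic_rel_refl)

lift_definition plus_padic :: "'a padic \<Rightarrow> 'a padic \<Rightarrow> 'a padic" is "\<lambda>X Y n. X n + Y n"
  unfolding padic_rel_def add_diff_add
  by (simp only: padic_cauchy_add padic_null_add prime_card simp_thms)

lift_definition uminus_padic :: "'a padic \<Rightarrow> 'a padic" is "\<lambda>X n. - X n"
  unfolding padic_rel_def minus_diff_minus
  by (simp only: padic_cauchy_minus padic_null_minus simp_thms)

lift_definition times_padic :: "'a padic \<Rightarrow> 'a padic \<Rightarrow> 'a padic" is "\<lambda>X Y n. X n * Y n"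
proof -
  fix X X' Y Y' :: "nat \<Rightarrow> rat"
  assume *: "padic_rel CARD('a) X X'" "padic_rel CARD('a) Y Y'"
  have "padic_null CARD('a) (\<lambda>n. X n * (Y n - Y' n) + Y' n * (X n - X' n))"
    using * by (intro padic_null_add padic_null_mult prime_card) (simp_all add: padic_rel_def)
  moreover have "X n * (Y n - Y' n) + Y' n * (X n - X' n) = X n * Y n - X' n * Y' n" for n
    by (simp add: algebra_simps)
  ultimately show "padic_rel CARD('a) (\<lambda>n. X n * Y n) (\<lambda>n. X' n * Y' n)"
    using * by (simp add: padic_rel_def padic_cauchy_mult[OF prime_card])
qed

lift_definition inverse_padic :: "'a padic \<Rightarrow> 'a padic"
  is "\<lambda>X. if padic_null CARD('a) X then (\<lambda>n. 0) else (\<lambda>n. inverse (X n))"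
proof -
  fix X Y :: "nat \<Rightarrow> rat"
  assume *: "padic_rel CARD('a) X Y"
  then have "padic_null CARD('a) X \<longleftrightarrow> padic_null CARD('a) Y"
    by (intro padic_null_cong prime_card) (simp add: padic_rel_def)
  with * show "?thesis X Y"
    by (simp add: padic_rel_def padic_cauchy_inverse[OF prime_card]
        padic_null_inverse_diff[OF prime_card])
qed

definition "x - y = x + - y" for x y :: "'a padic"

definition "x div y = x * inverse y" for x y :: "'a padic"

instance
proof
  note [simp] = padic_rel_def padic_cauchy_add[OF prime_card] padic_cauchy_mult[OF prime_card]
  fix a b c :: "'a padic"
  show "a + b = b + a"
    by transfer (simp add: ac_simps)
  show "(a + b) + c = a + (b + c)"
    by transfer (simp add: ac_simps)
  show "0 + a = a"
    by transfer simp
  show "- a + a = 0"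
    by transfer simp
  show "a - b = a + - b"
    by (rule minus_padic_def)
  show "(a * b) * c = a * (b * c)"
    by transfer (simp add: ac_simps)
  show "a * b = b * a"
    by transfer (simp add: ac_simps)
  show "1 * a = a"
    by transfer simp
  show "(a + b) * c = a * c + b * c"
    by transfer (simp add: distrib_right)
  show "(0 :: 'a padic) \<noteq> 1"
    by transfer (simp add: padic_null_def LIMSEQ_const_iff)
  show "a \<noteq> 0 \<Longrightarrow> inverse a * a = 1"
    by transfer (simp add: padic_null_inverse_mult[OF prime_card] padic_cauchy_inverse[OF prime_card])
  show "a div b = a * inverse b"
    by (rule divide_padic_def)
  show "inverse (0 :: 'a padic) = 0"
    by transfer simp
qed

end

lemma cr_padic_eq: "pcr_padic = (\<lambda>X x. padic_cauchy CARD('p) X \<and> Padic X = (x :: 'p :: prime_card padic))"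
  unfolding padic.pcr_cr_eq cr_padic_def padic_rel_def by auto

lemma padic_eq_iff:
  "padic_cauchy CARD('p) X \<Longrightarrow> padic_cauchy CARD('p) Y \<Longrightarrow>
    Padic X = (Padic Y :: 'p :: prime_card padic) \<longleftrightarrow> padic_null CARD('p) (\<lambda>n. X n - Y n)"
  using padic.rel_eq_transfer[where 'p = 'p]
  unfolding padic.pcr_cr_eq cr_padic_def rel_fun_def padic_rel_def by simp

lemma mult_Padic:
  "padic_cauchy CARD('p) X \<Longrightarrow> padic_cauchy CARD('p) Y \<Longrightarrow>
    Padic X * (Padic Y :: 'p :: prime_card padic) = Padic (\<lambda>n. X n * Y n)"
  using times_padic.transfer[where 'a = 'p] by (simp add: cr_padic_eq rel_fun_def)

lemma add_Padic:
  "padic_cauchy CARD('p) X \<Longrightarrow> padic_cauchy CARD('p) Y \<Longrightarrow>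
    Padic X + (Padic Y :: 'p :: prime_card padic) = Padic (\<lambda>n. X n + Y n)"
  using plus_padic.transfer[where 'a = 'p] by (simp add: cr_padic_eq rel_fun_def)

lemma minus_Padic:
  "padic_cauchy CARD('p) X \<Longrightarrow> - (Padic X :: 'p :: prime_card padic) = Padic (\<lambda>n. - X n)"
  using uminus_padic.transfer[where 'a = 'p] by (simp add: cr_padic_eq rel_fun_def)

lemma diff_Padic:
  "padic_cauchy CARD('p) X \<Longrightarrow> padic_cauchy CARD('p) Y \<Longrightarrow>
    Padic X - (Padic Y :: 'p :: prime_card padic) = Padic (\<lambda>n. X n - Y n)"
  by (simp add: minus_padic_def minus_Padic add_Padic)

lemma of_nat_Padic: "of_nat k = (Padic (\<lambda>n. of_nat k) :: 'p :: prime_card padic)"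
  by (induction k)
    (simp_all add: zero_padic.abs_eq one_padic.abs_eq add_Padic zero_padic_def one_padic_def)

lemma of_int_Padic: "of_int k = (Padic (\<lambda>n. of_int k) :: 'p :: prime_card padic)"
  by (cases k rule: int_diff_cases) (simp add: of_nat_Padic diff_Padic)

instance padic :: (prime_card) field_char_0
proof
  show "inj (of_nat :: nat \<Rightarrow> 'a padic)"
  proof (rule injI)
    fix i j :: nat
    assume "of_nat i = (of_nat j :: 'a padic)"
    then have "padic_null CARD('a) (\<lambda>n. of_nat i - of_nat j)"
      by (simp add: of_nat_Padic padic_eq_iff)
    then have "padic_abs CARD('a) (of_nat i - of_nat j) = 0"
      by (simp add: padic_null_def LIMSEQ_const_iff)
    then show "i = j" by (simp add: padic_abs_eq_0_iff[OF prime_card])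
  qed
qed

lemma of_rat_Padic: "of_rat r = (Padic (\<lambda>n. r) :: 'p :: prime_card padic)"
proof -
  obtain a b where ab: "quotient_of r = (a, b)" by fastforce
  then have r: "r = of_int a / of_int b" and b: "b > 0"
    using quotient_of_div quotient_of_denom_pos by auto
  have "of_rat r * of_int b = (of_int a :: 'p padic)"
    using b by (simp add: r of_rat_divide)
  also have "of_int a = Padic (\<lambda>n. r) * (of_int b :: 'p padic)"
    using b by (simp add: of_int_Padic mult_Padic r)
  finally show ?thesis using b by simp
qed

instantiation padic :: (prime_card) metric_space
begin

lift_definition padic_vabs :: "'a padic \<Rightarrow> real"
  is "\<lambda>X. lim (\<lambda>n. padic_abs CARD('a) (X n))"
  by (rule padic_rel_lim[OF prime_card])

definition dist_padic :: "'a padic \<Rightarrow> 'a padic \<Rightarrow> real" where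
  "dist_padic x y = padic_vabs (x - y)"

definition uniformity_padic :: "('a padic \<times> 'a padic) filter" where
  "uniformity_padic = (INF e\<in>{0<..}. principal {(x, y). dist x y < e})"

definition open_padic :: "'a padic set \<Rightarrow> bool" where
  "open_padic U \<longleftrightarrow> (\<forall>x\<in>U. eventually (\<lambda>(x', y). x' = x \<longrightarrow> y \<in> U) uniformity)"

lemma padic_vabs_lim:
  assumes "padic_cauchy CARD('a) X"
  shows "(\<lambda>n. padic_abs CARD('a) (X n)) \<longlonglongrightarrow> padic_vabs (Padic X :: 'a padic)"
proof -
  have "padic_vabs (Padic X :: 'a padic) = lim (\<lambda>n. padic_abs CARD('a) (X n))"
    using padic_vabs.abs_eq assms by (simp add: padic_rel_refl eq_onp_def)
  then show ?thesis
    using padic_cauchy_abs_convergent[OF prime_card assms] by (simp add: convergent_LIMSEQ_iff)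
qed

lemma dist_Padic_lim:
  assumes "padic_cauchy CARD('a) X" "padic_cauchy CARD('a) Y"
  shows "(\<lambda>n. padic_abs CARD('a) (X n - Y n)) \<longlonglongrightarrow> dist (Padic X) (Padic Y :: 'a padic)"
  using assms padic_vabs_lim[of "\<lambda>n. X n - Y n"]
  by (simp add: dist_padic_def diff_Padic padic_cauchy_diff[OF prime_card])

instance
proof
  fix x y z :: "'a padic"
  show "dist x y = 0 \<longleftrightarrow> x = y"
  proof (induct x; induct y)
    fix X Y :: "nat \<Rightarrow> rat"
    assume XY: "padic_cauchy CARD('a) X" "padic_cauchy CARD('a) Y"
    note lim = dist_Padic_lim[OF XY]
    have "dist (Padic X) (Padic Y :: 'a padic) = 0 \<longleftrightarrow> padic_null CARD('a) (\<lambda>n. X n - Y n)"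
      using lim LIMSEQ_unique[OF lim, of 0] unfolding padic_null_def by metis
    then show "dist (Padic X) (Padic Y :: 'a padic) = 0 \<longleftrightarrow> Padic X = (Padic Y :: 'a padic)"
      by (simp only: padic_eq_iff[OF XY])
  qed
  show "dist x y \<le> dist x z + dist y z"
  proof (induct x; induct y; induct z)
    fix X Y Z :: "nat \<Rightarrow> rat"
    assume XYZ: "padic_cauchy CARD('a) X" "padic_cauchy CARD('a) Y" "padic_cauchy CARD('a) Z"
    have le: "padic_abs CARD('a) (X n - Y n)
        \<le> padic_abs CARD('a) (X n - Z n) + padic_abs CARD('a) (Y n - Z n)" for n
      using padic_abs_triangle[OF prime_card[where 'a = 'a], of "X n - Z n" "Z n - Y n"]
        padic_abs_diff_commute[of "CARD('a)" "Z n" "Y n"] by simp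
    show "dist (Padic X) (Padic Y) \<le> dist (Padic X) (Padic Z) + dist (Padic Y) (Padic Z :: 'a padic)"
      by (rule LIMSEQ_le[OF dist_Padic_lim tendsto_add[OF dist_Padic_lim dist_Padic_lim]])
        (use XYZ le in auto)
  qed
qed (simp_all only: uniformity_padic_def open_padic_def)

end

lemma dist_of_rat_padic:
  "dist (of_rat r) (of_rat s :: 'p :: prime_card padic) = padic_abs CARD('p) (r - s)"
proof -
  have "(\<lambda>n::nat. padic_abs CARD('p) (r - s)) \<longlonglongrightarrow> dist (of_rat r) (of_rat s :: 'p padic)"
    using dist_Padic_lim[of "\<lambda>n. r" "\<lambda>n. s", where 'a = 'p] by (simp add: of_rat_Padic)
  then show ?thesis by (simp add: LIMSEQ_const_iff)
qed

lemma Padic_lim: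
  assumes X: "padic_cauchy CARD('p) X"
  shows "(\<lambda>n. of_rat (X n)) \<longlonglongrightarrow> (Padic X :: 'p :: prime_card padic)"
proof (rule metric_LIMSEQ_I)
  fix e :: real
  assume "e > 0"
  then obtain k where k: "\<And>m n. m \<ge> k \<Longrightarrow> n \<ge> k \<Longrightarrow> padic_abs CARD('p) (X m - X n) < e / 2"
    using padic_cauchyD[OF X, of "e / 2"] by auto
  have "dist (of_rat (X m)) (Padic X :: 'p padic) < e" if "m \<ge> k" for m
  proof -
    have "(\<lambda>n. padic_abs CARD('p) (X m - X n)) \<longlonglongrightarrow> dist (of_rat (X m)) (Padic X :: 'p padic)"
      using dist_Padic_lim[of "\<lambda>n. X m" X, where 'a = 'p] X by (simp add: of_rat_Padic)
    then have "dist (of_rat (X m)) (Padic X :: 'p padic) \<le> e / 2"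
      by (rule LIMSEQ_le_const2) (use k[OF that] in \<open>auto intro!: exI[of _ k] less_imp_le\<close>)
    then show ?thesis using \<open>e > 0\<close> by simp
  qed
  then show "\<exists>k. \<forall>n\<ge>k. dist (of_rat (X n)) (Padic X :: 'p padic) < e" by blast
qed

lemma padic_rat_dense:
  fixes x :: "'p :: prime_card padic"
  assumes "e > 0"
  shows "\<exists>r. dist (of_rat r) x < e"
proof (induct x)
  case (Padic X)
  then show ?case using metric_LIMSEQ_D[OF Padic_lim assms] by blast
qed

instantiation padic :: (prime_card) rat_completion
begin

definition place_of_padic :: "'a padic itself \<Rightarrow> enat" where
  "place_of_padic _ = enat CARD('a)"

definition vabs_padic :: "'a padic \<Rightarrow> real" where
  "vabs_padic = padic_vabs"

instance
proof
  fix S :: "nat \<Rightarrow> 'a padic"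
  assume S: "Cauchy S"
  have "\<exists>R. \<forall>n. dist (of_rat (R n)) (S n) < inverse (real (Suc n))"
    by (intro choice allI padic_rat_dense) simp
  then obtain R where R: "\<And>n. dist (of_rat (R n)) (S n) < inverse (real (Suc n))" by auto
  have lim0: "(\<lambda>n. dist (of_rat (R n)) (S n)) \<longlonglongrightarrow> 0"
    by (rule tendsto_sandwich[OF _ _ tendsto_const LIMSEQ_inverse_real_of_nat])
      (auto intro!: always_eventually less_imp_le R simp del: of_nat_Suc)
  have cauchy: "padic_cauchy CARD('a) R"
    unfolding padic_cauchy_def
  proof (intro allI impI)
    fix e :: real
    assume "e > 0"
    then obtain i where i: "\<And>m n. m \<ge> i \<Longrightarrow> n \<ge> i \<Longrightarrow> dist (S m) (S n) < e / 3"
      using metric_CauchyD[OF S, of "e / 3"] by auto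
    obtain j where j: "\<And>n. n \<ge> j \<Longrightarrow> dist (of_rat (R n)) (S n) < e / 3"
      using metric_LIMSEQ_D[OF lim0, of "e / 3"] \<open>e > 0\<close> by auto
    have "padic_abs CARD('a) (R m - R n) < e" if "m \<ge> max i j" "n \<ge> max i j" for m n
    proof -
      have "dist (of_rat (R m)) (of_rat (R n) :: 'a padic)
          \<le> dist (of_rat (R m)) (S m) + dist (S m) (S n) + dist (of_rat (R n)) (S n)"
        by metric
      also have "\<dots> < e" using i[of m n] j[of m] j[of n] that by auto
      finally show ?thesis by (simp add: dist_of_rat_padic)
    qed
    then show "\<exists>k. \<forall>m\<ge>k. \<forall>n\<ge>k. padic_abs CARD('a) (R m - R n) < e" by blast
  qed
  have "S \<longlonglongrightarrow> Padic R"
  proof (rule iffD2[OF tendsto_dist_iff], rule tendsto_sandwich[OF _ _ tendsto_const])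
    show "(\<lambda>n. dist (of_rat (R n)) (S n) + dist (of_rat (R n)) (Padic R :: 'a padic)) \<longlonglongrightarrow> 0"
      using tendsto_add[OF lim0 iffD1[OF tendsto_dist_iff Padic_lim[OF cauchy]]] by simp
  qed (auto intro!: always_eventually dist_triangle3)
  then show "convergent S" by (auto simp: convergent_def)
next
  show "is_place (place_of TYPE('a padic))"
    using prime_card by (auto simp: is_place_def place_of_padic_def)
next
  fix x y :: "'a padic"
  show "vabs (x * y) = vabs x * vabs y"
  proof (induct x; induct y)
    fix X Y :: "nat \<Rightarrow> rat"
    assume XY: "padic_cauchy CARD('a) X" "padic_cauchy CARD('a) Y"
    have "(\<lambda>n. padic_abs CARD('a) (X n * Y n)) \<longlonglongrightarrow> vabs (Padic X * Padic Y :: 'a padic)"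
      using padic_vabs_lim[of "\<lambda>n. X n * Y n", where 'a = 'a] XY
      by (simp add: mult_Padic padic_cauchy_mult[OF prime_card] vabs_padic_def)
    moreover have "(\<lambda>n. padic_abs CARD('a) (X n * Y n)) \<longlonglongrightarrow>
        vabs (Padic X :: 'a padic) * vabs (Padic Y :: 'a padic)"
      using tendsto_mult[OF padic_vabs_lim[OF XY(1)] padic_vabs_lim[OF XY(2)]]
      by (simp add: padic_abs_mult[OF prime_card] vabs_padic_def)
    ultimately show "vabs (Padic X * Padic Y) = vabs (Padic X) * vabs (Padic Y :: 'a padic)"
      by (rule LIMSEQ_unique)
  qed
next
  fix r :: rat
  have "vabs (of_rat r :: 'a padic) = dist (of_rat r) (of_rat 0 :: 'a padic)"
    by (simp add: dist_padic_def vabs_padic_def)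
  then show "vabs (of_rat r :: 'a padic) = rat_abs (place_of TYPE('a padic)) r"
    by (simp only: dist_of_rat_padic place_of_padic_def rat_abs_def) simp
qed (simp_all only: padic_rat_dense, simp_all add: dist_padic_def vabs_padic_def)

end


section \<open>Projective space\<close>

definition proj_rel :: "'k::field ^ 'n \<Rightarrow> 'k ^ 'n \<Rightarrow> bool" where
  "proj_rel x y \<longleftrightarrow> x \<noteq> 0 \<and> y \<noteq> 0 \<and> (\<exists>c. y = c *s x)"

lemma part_equivp_proj_rel: "part_equivp (proj_rel :: 'k::field ^ 'n \<Rightarrow> _)"
proof (rule part_equivpI)
  have "proj_rel (1 :: 'k ^ 'n) 1"
    by (auto simp: proj_rel_def intro!: exI[of _ 1])
  then show "\<exists>x :: 'k ^ 'n. proj_rel x x" ..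
  show "symp (proj_rel :: 'k ^ 'n \<Rightarrow> _)"
  proof (rule sympI)
    fix x y :: "'k ^ 'n"
    assume "proj_rel x y"
    then obtain c where c: "y = c *s x" "x \<noteq> 0" "y \<noteq> 0" by (auto simp: proj_rel_def)
    then have "c \<noteq> 0" by auto
    then have "x = inverse c *s y" using c by simp
    then show "proj_rel y x" using c unfolding proj_rel_def by blast
  qed
  show "transp (proj_rel :: 'k ^ 'n \<Rightarrow> _)"
  proof (rule transpI)
    fix x y z :: "'k ^ 'n"
    assume "proj_rel x y" "proj_rel y z"
    then obtain c d where "y = c *s x" "z = d *s y" "x \<noteq> 0" "z \<noteq> 0" by (auto simp: proj_rel_def)
    then have "z = (d * c) *s x" by (simp add: vector_smult_assoc)
    then show "proj_rel x z" using \<open>x \<noteq> 0\<close> \<open>z \<noteq> 0\<close> unfolding proj_rel_def by blast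
  qed
qed

text \<open>
  \<open>('k, 'n) proj\<close> is the projective space of \<open>'k ^ 'n\<close>, of dimension \<open>CARD('n) - 1\<close>.
  The abstraction function \<open>to_proj\<close> is the quotient map; it is meaningful only away from the origin.
\<close>

quotient_type (overloaded) ('k, 'n) proj = "'k::field ^ 'n::finite" / partial: proj_rel
  morphisms rep_proj to_proj
  by (rule part_equivp_proj_rel)

lift_definition proj_of_rat :: "(rat, 'n) proj \<Rightarrow> ('k::field_char_0, 'n::finite) proj"
  is "\<lambda>y. \<chi> i. of_rat (y $ i)"
  by (auto simp: proj_rel_def vec_eq_iff of_rat_mult)

definition vec_norm :: "'k::rat_completion ^ 'n \<Rightarrow> real" where
  "vec_norm x = place_norm (place_of TYPE('k)) (\<lambda>i. vabs (x $ i)) UNIV"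

definition wedge_norm :: "('k::rat_completion, 'n::{finite,linorder}) vec \<Rightarrow> ('k, 'n) vec \<Rightarrow> real" where
  "wedge_norm x y = place_norm (place_of TYPE('k))
     (\<lambda>(i, j). vabs (x $ i * y $ j - x $ j * y $ i)) {(i, j). i < j}"

lemma vec_norm_scale: "vec_norm (c *s x) = vabs c * vec_norm x"
  unfolding vec_norm_def by (rule place_norm_scale) (auto simp: vabs_mult)

lemma wedge_norm_scale: "wedge_norm (c *s x) (d *s y) = vabs c * vabs d * wedge_norm x y"
  unfolding wedge_norm_def
proof (rule place_norm_scale)
  fix ij :: "'b \<times> 'b"
  obtain i j where ij: "ij = (i, j)" by fastforce
  have "(c *s x) $ i * (d *s y) $ j - (c *s x) $ j * (d *s y) $ i
      = c * d * (x $ i * y $ j - x $ j * y $ i)" by (simp add: algebra_simps)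
  then show "(case ij of (i, j) \<Rightarrow> vabs ((c *s x) $ i * (d *s y) $ j - (c *s x) $ j * (d *s y) $ i))
      = vabs c * vabs d * (case ij of (i, j) \<Rightarrow> vabs (x $ i * y $ j - x $ j * y $ i))"
    by (simp only: ij prod.case vabs_mult)
qed auto

lift_definition proj_dist ::
  "('k::rat_completion, 'n::{finite,linorder}) proj \<Rightarrow> ('k, 'n) proj \<Rightarrow> real"
  is "\<lambda>x y. wedge_norm x y / (vec_norm x * vec_norm y)"
proof -
  fix x x' y y' :: "('k, 'n) vec"
  assume *: "proj_rel x x'" "proj_rel y y'"
  then obtain c d where cd: "x' = c *s x" "y' = d *s y" "c \<noteq> 0" "d \<noteq> 0"
    by (auto simp: proj_rel_def)
  then show "wedge_norm x y / (vec_norm x * vec_norm y) = wedge_norm x' y' / (vec_norm x' * vec_norm y')"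
    by (simp add: wedge_norm_scale vec_norm_scale)
qed

definition rat_vec_norm :: "enat \<Rightarrow> rat ^ 'n \<Rightarrow> real" where
  "rat_vec_norm v y = place_norm v (\<lambda>i. rat_abs v (y $ i)) UNIV"

lemma finite_rat_vec_norm:
  assumes "y \<noteq> 0"
  shows "finite {v. is_place v \<and> rat_vec_norm v y \<noteq> 1}"
proof (rule finite_subset)
  show "{v. is_place v \<and> rat_vec_norm v y \<noteq> 1} \<subseteq>
      insert \<infinity> (\<Union>i\<in>{i. y $ i \<noteq> 0}. {v. is_place v \<and> rat_abs v (y $ i) \<noteq> 1})" (is "?A \<subseteq> ?B")
  proof (rule subsetI, rule ccontr)
    fix v
    assume v: "v \<in> ?A" "v \<notin> ?B"
    obtain k where k: "y $ k \<noteq> 0" using assms by (auto simp: vec_eq_iff)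
    have "rat_abs v (y $ i) = (if y $ i = 0 then 0 else 1)" for i
      using v by auto
    then have "Max (insert 0 (range (\<lambda>i. rat_abs v (y $ i)))) = 1"
      using k by (intro Max_eqI) (auto simp: image_iff)
    then show False using v by (auto simp: rat_vec_norm_def place_norm_def)
  qed
qed (auto intro: product_formula)

text \<open>All but finitely many factors of the product are equal to \<open>1\<close>; see \<open>finite_rat_vec_norm\<close>.\<close>

lift_definition height :: "(rat, 'n::finite) proj \<Rightarrow> real"
  is "\<lambda>y. Prod_any (\<lambda>v. if is_place v then rat_vec_norm v y else 1)"
proof -
  fix y z :: "rat ^ 'n"
  assume "proj_rel y z"
  then obtain c where c: "z = c *s y" "c \<noteq> 0" "y \<noteq> 0" by (auto simp: proj_rel_def)
  have "rat_vec_norm v z = rat_abs v c * rat_vec_norm v y" if "is_place v" for v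
    unfolding rat_vec_norm_def using that
    by (intro place_norm_scale) (auto simp: c rat_abs_mult rat_abs_nonneg)
  then have "Prod_any (\<lambda>v. if is_place v then rat_vec_norm v z else 1) =
      Prod_any (\<lambda>v. (if is_place v then rat_abs v c else 1) * (if is_place v then rat_vec_norm v y else 1))"
    by (intro Prod_any.cong) auto
  moreover have "{v. (if is_place v then f v else 1) \<noteq> (1 :: real)} = {v. is_place v \<and> f v \<noteq> 1}" for f
    by auto
  ultimately have "Prod_any (\<lambda>v. if is_place v then rat_vec_norm v z else 1) =
      Prod_any (\<lambda>v. if is_place v then rat_abs v c else 1) *
      Prod_any (\<lambda>v. if is_place v then rat_vec_norm v y else 1)"
    using product_formula(1)[OF \<open>c \<noteq> 0\<close>] finite_rat_vec_norm[OF \<open>y \<noteq> 0\<close>]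
    by (simp only: Prod_any.distrib)
  then show "Prod_any (\<lambda>v. if is_place v then rat_vec_norm v y else 1) =
      Prod_any (\<lambda>v. if is_place v then rat_vec_norm v z else 1)"
    using product_formula(2)[OF \<open>c \<noteq> 0\<close>] by simp
qed


section \<open>Measures and approximable points\<close>

text \<open>
  Haar measure on \<open>\<rat>\<^sub>p\<^sup>n\<close> with total mass \<open>1\<close> on \<open>\<int>\<^sub>p\<^sup>n\<close>.  Since \<open>\<int>\<^sub>p\<^sup>n\<close> is a compact open subgroup
  of countable index, the normalization and translation invariance already determine the measure
  and make it finite on compact sets.
\<close>

definition padic_haar :: "('p::prime_card padic ^ 'n) measure" where
  "padic_haar = (THE M. sets M = sets borel \<and>
     (\<forall>a. distr M borel (\<lambda>x. a + x) = M) \<and>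
     emeasure M {x. \<forall>i. vabs (x $ i) \<le> 1} = 1)"

text \<open>
  The measure induced on projective space by a measure \<open>\<beta>\<close> on the vector space
  (which is to be \<^const>\<open>lborel\<close> or \<^const>\<open>padic_haar\<close>).
\<close>

definition proj_measure :: "('k::rat_completion ^ 'n) measure \<Rightarrow> ('k, 'n) proj set \<Rightarrow> real" where
  "proj_measure \<beta> M =
     measure \<beta> ({x. x \<noteq> 0 \<and> to_proj x \<in> M} \<inter> {x. vec_norm x \<le> 1}) / measure \<beta> {x. vec_norm x \<le> 1}"

definition approximable ::
  "(real \<Rightarrow> real) \<Rightarrow> ('k::rat_completion, 'n::{finite,linorder}) proj set" where
  "approximable \<psi> = {x. infinite {y :: (rat, 'n) proj. proj_dist x (proj_of_rat y) \<le> \<psi> (height y)}}"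

end

theory Submission
  imports
    Defs
    "HOL-Analysis.Kronecker_Approximation_Theorem"
    "HOL-Number_Theory.Cong"
    "HOL-Probability.Infinite_Product_Measure"
begin

text \<open>
  A point of projective space is approximated by the lines through integer points, and the cone of
  points close to such a line is called a tube.  The real and the \<open>p\<close>-adic case differ only in
  three inputs: two-sided bounds for the measure of balls, Dirichlet's theorem on the approximation
  of a point by an integer point of height at most \<open>b ^ (j * d)\<close> (with \<open>d = n - 1\<close>), and a bound
  for the number of integer points near a line.  They imply that at each scale \<open>j\<close> every small ball
  contains parts of so many disjoint tubes of radius about \<open>b ^ (- j * (d + 1))\<close> that these fill a
  positive proportion of it.  Shrinking the tubes to the radius \<open>\<psi> (b ^ (j * d))\<close> gives sets whose
  measures have a divergent sum, by Cauchy condensation, and which are independent on average, so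
  that by the Chung-Erdos inequality the union over all large \<open>j\<close> fills a fixed proportion of every
  small cell.  The complement of finitely many tubes is again a disjoint union of small cells, and
  so the uncovered part shrinks geometrically: almost every point lies in infinitely many of the sets.
\<close>

section \<open>Sup norms and tubes\<close>

text \<open>Dirichlet's theorem offers a point of height \<open>h\<close> with radius about
  \<open>1 / (b ^ j * h)\<close>. For \<open>h\<close> comparable to \<open>b ^ (j * d)\<close> this
  is the radius of scale \<open>j\<close>; there is room for about
  \<open>b ^ (j * d * (d + 1))\<close> disjoint tubes of that radius, each of measure about its
  \<open>d\<close>-th power, which just fill a ball. Lower points bring wider tubes, and the
  counting bound serves to show that these matter little. Constants are lost at every step and do no
  harm: a divergent series stays divergent when rescaled, and the final iteration needs a proportion
  that is independent of the cell, however small. Hence sup norms and minors can replace Euclidean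
  norms and projective distances. All cones meet at the origin, so estimates are made in balls away
  from it. Lying in infinitely many of the sets does not yet give infinitely many rational points,
  as one point could serve at many scales. But the radii tend to 0 and almost no \<open>x\<close>
  lies on a rational line, so no finite set of points suffices.\<close>

lemma vabs_one [simp]: "vabs (1 :: 'k::rat_completion) = 1"
proof -
  have "vabs (1::'k) = vabs (1::'k) * vabs (1::'k)" using vabs_mult[of "1::'k" 1] by simp
  moreover have "vabs (1::'k) \<noteq> 0" unfolding vabs_eq_0_iff by simp
  ultimately show ?thesis by simp
qed

lemma vabs_zero [simp]: "vabs (0 :: 'k::rat_completion) = 0"
  by simp

lemma vabs_minus [simp]: "vabs (- x :: 'k::rat_completion) = vabs x"
  using dist_vabs[of 0 x] dist_vabs[of x 0] by (simp add: dist_commute)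

lemma vabs_diff_commute: "vabs (x - y :: 'k::rat_completion) = vabs (y - x)"
  using vabs_minus[of "x - y"] by simp

lemma vabs_triangle: "vabs (x + y :: 'k::rat_completion) \<le> vabs x + vabs y"
  using dist_triangle[of x "- y" 0] by (simp add: dist_vabs)

lemma vabs_triangle_diff: "vabs (x - y :: 'k::rat_completion) \<le> vabs x + vabs y"
  using vabs_triangle[of x "- y"] by simp

lemma vabs_inverse: "vabs (inverse x :: 'k::rat_completion) = inverse (vabs x)"
proof (cases "x = 0")
  case False
  then have "vabs x * vabs (inverse x) = 1"
    by (simp flip: vabs_mult)
  then show ?thesis by (metis inverse_unique)
qed auto

lemma vabs_divide: "vabs (x / y :: 'k::rat_completion) = vabs x / vabs y"
  by (simp add: divide_inverse vabs_mult vabs_inverse)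

lemma vabs_power: "vabs (x ^ m :: 'k::rat_completion) = vabs x ^ m"
  by (induction m) (auto simp: vabs_mult)

definition sup_norm :: "'k::rat_completion ^ 'n \<Rightarrow> real" where
  "sup_norm x = Max (range (\<lambda>i. vabs (x $ i)))"

lemma sup_norm_ge: "vabs (x $ i) \<le> sup_norm x"
  unfolding sup_norm_def by (rule Max_ge) auto

lemma sup_norm_attained: obtains i where "sup_norm x = vabs (x $ i)"
proof -
  have "sup_norm x \<in> range (\<lambda>i. vabs (x $ i))"
    unfolding sup_norm_def by (rule Max_in) auto
  then show ?thesis using that by auto
qed

lemma sup_norm_le_iff: "sup_norm x \<le> r \<longleftrightarrow> (\<forall>i. vabs (x $ i) \<le> r)"
  unfolding sup_norm_def by (subst Max_le_iff) auto

lemma sup_norm_nonneg [simp]: "sup_norm x \<ge> 0"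
  using sup_norm_ge[of x undefined] vabs_nonneg[of "x $ undefined"] by linarith

lemma sup_norm_eq_0_iff [simp]: "sup_norm x = 0 \<longleftrightarrow> x = 0"
proof
  assume "sup_norm x = 0"
  then have "vabs (x $ i) = 0" for i
    using sup_norm_ge[of x i] vabs_nonneg[of "x $ i"] by linarith
  then show "x = 0" by (simp add: vec_eq_iff)
next
  assume "x = 0"
  then show "sup_norm x = 0" by (simp add: sup_norm_def)
qed

lemma sup_norm_pos_iff [simp]: "sup_norm x > 0 \<longleftrightarrow> x \<noteq> 0"
  using sup_norm_nonneg[of x] sup_norm_eq_0_iff[of x] by linarith

lemma sup_norm_minus [simp]: "sup_norm (- x) = sup_norm x"
  by (simp add: sup_norm_def)

lemma sup_norm_diff_commute: "sup_norm (x - y) = sup_norm (y - x)"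
  using sup_norm_minus[of "x - y"] by simp

lemma sup_norm_triangle: "sup_norm (x + y) \<le> sup_norm x + sup_norm y"
  unfolding sup_norm_le_iff
proof
  fix i
  show "vabs ((x + y) $ i) \<le> sup_norm x + sup_norm y"
    using vabs_triangle[of "x $ i" "y $ i"] sup_norm_ge[of x i] sup_norm_ge[of y i] by simp
qed

lemma sup_norm_triangle_diff: "sup_norm (x - y) \<le> sup_norm x + sup_norm y"
  using sup_norm_triangle[of x "- y"] by simp

lemma sup_norm_triangle_sub: "sup_norm x \<le> sup_norm y + sup_norm (x - y)"
  using sup_norm_triangle[of y "x - y"] by simp

lemma sup_norm_scale: "sup_norm (c *s x) = vabs c * sup_norm x"
proof (rule antisym)
  show "sup_norm (c *s x) \<le> vabs c * sup_norm x"
    unfolding sup_norm_le_iff by (auto simp: vabs_mult intro!: mult_left_mono sup_norm_ge)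
  obtain i where "sup_norm x = vabs (x $ i)" by (rule sup_norm_attained)
  then show "vabs c * sup_norm x \<le> sup_norm (c *s x)"
    using sup_norm_ge[of "c *s x" i] by (simp add: vabs_mult)
qed

lemma sup_norm_le_dist: "sup_norm (x - y) \<le> dist x y"
  unfolding sup_norm_le_iff
  using dist_vec_nth_le[of x _ y] by (simp add: dist_vabs)

lemma dist_le_sup_norm: "dist (x :: 'k::rat_completion ^ 'n) y \<le> real CARD('n) * sup_norm (x - y)"
proof -
  have "dist x y \<le> (\<Sum>i\<in>UNIV. dist (x $ i) (y $ i))"
    unfolding dist_vec_def by (rule L2_set_le_sum) simp
  also have "\<dots> \<le> (\<Sum>i\<in>(UNIV::'n set). sup_norm (x - y))"
    using sup_norm_ge[of "x - y"] by (intro sum_mono) (simp add: dist_vabs)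
  finally show ?thesis by simp
qed

definition sup_ball :: "'k::rat_completion ^ 'n \<Rightarrow> real \<Rightarrow> ('k ^ 'n) set" where
  "sup_ball z r = {x. sup_norm (x - z) \<le> r}"

lemma mem_sup_ball: "x \<in> sup_ball z r \<longleftrightarrow> sup_norm (x - z) \<le> r"
  by (simp add: sup_ball_def)

lemma sup_ball_subset:
  assumes "sup_norm (x - z) + r \<le> s"
  shows "sup_ball x r \<subseteq> sup_ball z s"
proof
  fix u assume "u \<in> sup_ball x r"
  then have "sup_norm (u - z) \<le> s"
    using assms sup_norm_triangle[of "u - x" "x - z"] by (simp add: mem_sup_ball)
  then show "u \<in> sup_ball z s" by (simp add: mem_sup_ball)
qed

text \<open>
  The tube \<open>{x. near \<rho> x e}\<close> is, up to constant factors in \<open>\<rho>\<close>, the cone of all \<open>x\<close> whose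
  projective distance to \<open>e\<close> is at most \<open>\<rho>\<close>.
\<close>

definition near :: "real \<Rightarrow> 'k::rat_completion ^ 'n \<Rightarrow> 'k ^ 'n \<Rightarrow> bool" where
  "near \<rho> x e \<longleftrightarrow> (\<forall>i j. vabs (x $ i * e $ j - x $ j * e $ i) \<le> \<rho> * sup_norm x * sup_norm e)"

lemma near_mono:
  assumes "near \<rho> x e" "\<rho> \<le> \<sigma>"
  shows "near \<sigma> x e"
proof -
  have "\<rho> * sup_norm x * sup_norm e \<le> \<sigma> * sup_norm x * sup_norm e"
    using assms(2) by (intro mult_right_mono) auto
  then show ?thesis using assms(1) order_trans unfolding near_def by blast
qed

text \<open>The coordinate \<open>i\<close> is one where \<open>e\<close> is largest, so that division by it loses nothing.\<close>

lemma near_imp_close_to_line: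
  assumes "near \<rho> x e" "e \<noteq> 0" and i: "sup_norm e = vabs (e $ i)"
  shows "sup_norm (x - (x $ i / e $ i) *s e) \<le> \<rho> * sup_norm x"
  unfolding sup_norm_le_iff
proof
  fix j
  have "vabs (e $ i) > 0" using assms(2) unfolding i[symmetric] by simp
  then have e: "vabs (e $ i) > 0" "e $ i \<noteq> 0" by auto
  have "(x - (x $ i / e $ i) *s e) $ j = (x $ j * e $ i - x $ i * e $ j) / e $ i"
    using e by (simp add: field_simps)
  then have "vabs ((x - (x $ i / e $ i) *s e) $ j) = vabs (x $ j * e $ i - x $ i * e $ j) / vabs (e $ i)"
    by (simp add: vabs_divide)
  also have "\<dots> \<le> \<rho> * sup_norm x * sup_norm e / vabs (e $ i)"
    using assms(1) e by (intro divide_right_mono) (auto simp: near_def)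
  finally show "vabs ((x - (x $ i / e $ i) *s e) $ j) \<le> \<rho> * sup_norm x"
    using e i by simp
qed

lemma near_imp_line:
  assumes "near \<rho> x e" "e \<noteq> 0"
  obtains t where "sup_norm (x - t *s e) \<le> \<rho> * sup_norm x"
proof -
  obtain i where "sup_norm e = vabs (e $ i)" by (rule sup_norm_attained)
  from that[OF near_imp_close_to_line[OF assms this]] show ?thesis .
qed

lemma minor_le:
  "vabs (x $ i * e $ j - x $ j * e $ i) \<le> 2 * sup_norm x * sup_norm (e :: 'k::rat_completion ^ 'n)"
proof -
  have "vabs (x $ i * e $ j - x $ j * e $ i) \<le> vabs (x $ i) * vabs (e $ j) + vabs (x $ j) * vabs (e $ i)"
    using vabs_triangle_diff by (metis vabs_mult)
  also have "\<dots> \<le> sup_norm x * sup_norm e + sup_norm x * sup_norm e"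
    by (intro add_mono mult_mono sup_norm_ge) auto
  finally show ?thesis by (simp add: mult_ac)
qed

lemma close_to_line_imp_near:
  assumes "sup_norm (x - t *s e) \<le> \<rho> * sup_norm x"
  shows "near (2 * \<rho>) x e"
  unfolding near_def
proof (intro allI)
  fix i j
  have eq: "x $ i * e $ j - x $ j * e $ i = (x - t *s e) $ i * e $ j - (x - t *s e) $ j * e $ i"
    by (simp add: algebra_simps)
  have "vabs (x $ i * e $ j - x $ j * e $ i) \<le> 2 * sup_norm (x - t *s e) * sup_norm e"
    unfolding eq by (rule minor_le)
  also have "\<dots> \<le> 2 * (\<rho> * sup_norm x) * sup_norm e"
    using assms by (intro mult_right_mono mult_left_mono) auto
  finally show "vabs (x $ i * e $ j - x $ j * e $ i) \<le> 2 * \<rho> * sup_norm x * sup_norm e"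
    by (simp add: mult_ac)
qed

text \<open>The point \<open>x\<close> ties the two lines together: \<open>u\<close> is close to a
  multiple of \<open>e'\<close>, hence to a multiple of \<open>x\<close>, hence to a multiple of
  \<open>e\<close>. The condition \<open>\<sigma> \<le> 1/2\<close> keeps the multiple
  \<open>t'\<close> of \<open>e'\<close> near \<open>x\<close> away from 0, and
  \<open>\<tau> \<le> 1\<close> bounds the multiple of \<open>e'\<close> near \<open>u\<close> by
  twice the norm of \<open>u\<close>.\<close>

lemma near_trans:
  assumes x: "near \<rho> x e" "near \<sigma> x e'" "x \<noteq> 0" and u: "near \<tau> u e'"
    and e: "e \<noteq> 0" "e' \<noteq> 0" and small: "\<sigma> \<le> 1/2" "\<tau> \<le> 1" "\<rho> \<ge> 0" "\<sigma> \<ge> 0" "\<tau> \<ge> 0"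
  shows "near (8 * (\<rho> + \<sigma> + \<tau>)) u e"
proof -
  obtain t where t: "sup_norm (x - t *s e) \<le> \<rho> * sup_norm x"
    using near_imp_line x e by blast
  obtain t' where t': "sup_norm (x - t' *s e') \<le> \<sigma> * sup_norm x"
    using near_imp_line x e by blast
  obtain s where s: "sup_norm (u - s *s e') \<le> \<tau> * sup_norm u"
    using near_imp_line u e by blast
  have "sup_norm x \<le> vabs t' * sup_norm e' + \<sigma> * sup_norm x"
    using sup_norm_triangle_sub[of x "t' *s e'"] t' by (simp add: sup_norm_scale)
  moreover have "\<sigma> * sup_norm x \<le> sup_norm x / 2"
    using mult_right_mono[OF small(1), of "sup_norm x"] by simp
  ultimately have t'_big: "sup_norm x \<le> 2 * (vabs t' * sup_norm e')" by linarith
  then have t'0: "t' \<noteq> 0" using \<open>x \<noteq> 0\<close> sup_norm_pos_iff[of x] by fastforce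
  have "sup_norm (s *s e') \<le> sup_norm u + \<tau> * sup_norm u"
    using sup_norm_triangle_sub[of "s *s e'" u] s by (simp add: sup_norm_diff_commute)
  also have "\<dots> \<le> 2 * sup_norm u"
    using mult_right_mono[OF small(2), of "sup_norm u"] by simp
  finally have s_le: "vabs s * sup_norm e' \<le> 2 * sup_norm u" by (simp only: sup_norm_scale)
  \<comment> \<open>The factor that rescales \<open>x\<close> to the size of \<open>u\<close>: as
    \<open>t' *s e'\<close> is near \<open>x\<close>, its multiple \<open>s *s e'\<close> is near
    \<open>q *s x\<close>.\<close>
  define q where "q = s / t'"
  have e'q: "s *s e' = q *s (t' *s e')"
    using t'0 by (simp add: q_def vector_smult_assoc)
  have "vabs q * sup_norm x \<le> vabs q * (2 * (vabs t' * sup_norm e'))"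
    using t'_big by (intro mult_left_mono) auto
  also have "\<dots> = 2 * (vabs s * sup_norm e')"
    using t'0 by (simp add: q_def vabs_divide)
  also have "\<dots> \<le> 4 * sup_norm u" using s_le by linarith
  finally have q: "vabs q * sup_norm x \<le> 4 * sup_norm u" .
  have "u - (q * t) *s e = (u - s *s e') + (q *s (x - t *s e) - q *s (x - t' *s e'))"
    unfolding e'q by (simp add: vec_eq_iff right_diff_distrib)
  also have "sup_norm \<dots> \<le> \<tau> * sup_norm u + (vabs q * (\<rho> * sup_norm x) + vabs q * (\<sigma> * sup_norm x))"
  proof -
    have "sup_norm (q *s (x - t *s e)) \<le> vabs q * (\<rho> * sup_norm x)"
      "sup_norm (q *s (x - t' *s e')) \<le> vabs q * (\<sigma> * sup_norm x)"
      unfolding sup_norm_scale using t t' by (intro mult_left_mono; simp)+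
    then show ?thesis
      using s sup_norm_triangle_diff[of "q *s (x - t *s e)" "q *s (x - t' *s e')"]
        sup_norm_triangle[of "u - s *s e'" "q *s (x - t *s e) - q *s (x - t' *s e')"] by linarith
  qed
  also have "\<dots> = \<tau> * sup_norm u + (\<rho> + \<sigma>) * (vabs q * sup_norm x)"
    by (simp add: algebra_simps)
  also have "\<dots> \<le> \<tau> * sup_norm u + (\<rho> + \<sigma>) * (4 * sup_norm u)"
    using q small by (intro add_left_mono mult_left_mono) auto
  also have "\<dots> \<le> (4 * (\<rho> + \<sigma> + \<tau>)) * sup_norm u"
    using small by (simp add: algebra_simps)
  finally have "near (2 * (4 * (\<rho> + \<sigma> + \<tau>))) u e"
    by (rule close_to_line_imp_near)
  then show ?thesis by simp
qed

section \<open>Continuity of norms and minors; tubes and balls are closed\<close>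

lemma Lipschitz_imp_continuous:
  fixes f :: "'a::metric_space \<Rightarrow> real"
  assumes "\<And>x y. f x \<le> f y + C * dist x y"
  shows "continuous_on A f"
proof -
  have le: "\<bar>f x - f y\<bar> \<le> \<bar>C\<bar> * dist x y" for x y
  proof -
    have "C * dist x y \<le> \<bar>C\<bar> * dist x y" by (intro mult_right_mono) auto
    then show ?thesis
      using assms[of x y] assms[of y x] by (auto simp: dist_commute)
  qed
  then have "\<bar>C\<bar>-lipschitz_on A f"
    by (intro lipschitz_onI) (auto simp: dist_real_def)
  then show ?thesis by (rule lipschitz_on_continuous_on)
qed

lemma continuous_on_sup_norm: "continuous_on A (sup_norm :: 'k::rat_completion ^ 'n \<Rightarrow> real)"
proof (rule Lipschitz_imp_continuous)
  fix x y :: "'k ^ 'n"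
  show "sup_norm x \<le> sup_norm y + 1 * dist x y"
    using sup_norm_triangle_sub[of x y] sup_norm_le_dist[of x y] by simp
qed

lemma continuous_on_vabs_component: "continuous_on A (\<lambda>x :: 'k::rat_completion ^ 'n. vabs (x $ i))"
proof (rule Lipschitz_imp_continuous)
  fix x y :: "'k ^ 'n"
  show "vabs (x $ i) \<le> vabs (y $ i) + 1 * dist x y"
    using vabs_triangle[of "y $ i" "x $ i - y $ i"] dist_vec_nth_le[of x i y] by (simp add: dist_vabs)
qed

lemma continuous_on_minor:
  "continuous_on A (\<lambda>x :: 'k::rat_completion ^ 'n. vabs (x $ i * e $ j - x $ j * e $ i))"
proof (rule Lipschitz_imp_continuous)
  fix x y :: "'k ^ 'n"
  have "vabs (x $ i * e $ j - x $ j * e $ i) \<le> vabs (y $ i * e $ j - y $ j * e $ i)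
     + vabs ((x - y) $ i * e $ j - (x - y) $ j * e $ i)"
    using vabs_triangle[of "y $ i * e $ j - y $ j * e $ i" "(x - y) $ i * e $ j - (x - y) $ j * e $ i"]
    by (simp add: algebra_simps)
  also have "vabs ((x - y) $ i * e $ j - (x - y) $ j * e $ i) \<le> 2 * sup_norm (x - y) * sup_norm e"
    by (rule minor_le)
  also have "\<dots> \<le> 2 * dist x y * sup_norm e"
    by (intro mult_mono sup_norm_le_dist) auto
  finally show "vabs (x $ i * e $ j - x $ j * e $ i) \<le> vabs (y $ i * e $ j - y $ j * e $ i)
      + (2 * sup_norm e) * dist x y"
    by (simp add: mult_ac)
qed

lemma closed_near: "closed {x. near \<rho> x e}"
proof -
  have "closed {x. vabs (x $ i * e $ j - x $ j * e $ i) \<le> \<rho> * sup_norm x * sup_norm e}" for i j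
    by (rule closed_Collect_le[OF continuous_on_minor])
      (rule continuous_on_mult[OF continuous_on_mult[OF continuous_on_const continuous_on_sup_norm]
        continuous_on_const])
  then show ?thesis
    unfolding near_def by (intro closed_Collect_all)
qed

lemma closed_sup_ball: "closed (sup_ball z r)"
  unfolding sup_ball_def
proof (rule closed_Collect_le[OF _ continuous_on_const], rule Lipschitz_imp_continuous)
  fix x y
  show "sup_norm (x - z) \<le> sup_norm (y - z) + 1 * dist x y"
    using sup_norm_triangle_sub[of "x - z" "y - z"] sup_norm_le_dist[of x y] by simp
qed

section \<open>Nested partitions and limsup sets\<close>

text \<open>Models dyadic cubes over the reals and balls of radius \<open>1 / p ^ k\<close> over the
  \<open>p\<close>-adic numbers. By \<open>cell_eq\<close> the cells of one level form a partition,
  and by \<open>cell_Suc\<close> these partitions are refined with growing \<open>k\<close>, so any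
  two cells are nested or disjoint.\<close>

locale nested_cells =
  fixes M :: "'a measure" and cell :: "nat \<Rightarrow> 'a \<Rightarrow> 'a set"
  assumes cell_self: "x \<in> cell k x"
    and cell_eq: "y \<in> cell k x \<Longrightarrow> cell k y = cell k x"
    and cell_Suc: "cell (Suc k) x \<subseteq> cell k x"
    and countable_cells: "countable (range (cell k))"
    and sets_cell: "cell k x \<in> sets M"
begin

lemma cell_antimono: "k \<le> l \<Longrightarrow> cell l x \<subseteq> cell k x"
  using lift_Suc_antimono_le[of "\<lambda>k. cell k x"] cell_Suc by blast

text \<open>Half-open cubes are not topologically open, yet after removal of finitely many closed
  sets from a cell the rest has to be partitioned into cells. This notion covers both the cells
  themselves and the complements of closed sets, provided that cells shrink.\<close>

definition cell_open :: "'a set \<Rightarrow> bool" where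
  "cell_open U \<longleftrightarrow> (\<forall>x\<in>U. \<exists>k0. \<forall>k\<ge>k0. cell k x \<subseteq> U)"

lemma cell_open_cell: "cell_open (cell k x)"
  unfolding cell_open_def
proof
  fix y assume "y \<in> cell k x"
  then show "\<exists>k0. \<forall>l\<ge>k0. cell l y \<subseteq> cell k x"
    using cell_antimono[of k _ y] cell_eq[of y k x] by (intro exI[of _ k]) auto
qed

lemma cell_open_Int:
  assumes "cell_open U" "cell_open V"
  shows "cell_open (U \<inter> V)"
  unfolding cell_open_def
proof
  fix x assume "x \<in> U \<inter> V"
  then obtain k l where "\<forall>i\<ge>k. cell i x \<subseteq> U" "\<forall>i\<ge>l. cell i x \<subseteq> V"
    using assms unfolding cell_open_def by blast
  then show "\<exists>k0. \<forall>k\<ge>k0. cell k x \<subseteq> U \<inter> V"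
    by (intro exI[of _ "max k l"]) auto
qed

lemma cell_open_Diff_UN:
  assumes "finite J" "cell_open U" "\<And>j. j \<in> J \<Longrightarrow> cell_open (- E j)"
  shows "cell_open (U - (\<Union>j\<in>J. E j))"
  using assms
proof (induction J rule: finite_induct)
  case (insert j J)
  then have "cell_open ((U - (\<Union>j\<in>J. E j)) \<inter> - E j)"
    by (intro cell_open_Int) auto
  then show ?case by (simp add: Diff_eq Int_ac)
qed auto

text \<open>Take the largest good cells contained in the given set.\<close>

lemma cell_open_partition:
  assumes U: "cell_open U"
    and good: "\<And>x. x \<in> U \<Longrightarrow> \<exists>k0. \<forall>k\<ge>k0. good k x"
    and good_cong: "\<And>k x y. y \<in> cell k x \<Longrightarrow> good k y = good k x"
  obtains \<D> where "countable \<D>" "disjoint \<D>" "\<Union>\<D> = U"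
    "\<And>D. D \<in> \<D> \<Longrightarrow> \<exists>k x. D = cell k x \<and> good k x"
proof -
  define P where "P x k \<longleftrightarrow> good k x \<and> cell k x \<subseteq> U" for x k
  define K where "K x = (LEAST k. P x k)" for x
  define \<D> where "\<D> = (\<lambda>x. cell (K x) x) ` U"
  have PK: "P x (K x)" if x: "x \<in> U" for x
  proof -
    obtain k l where "\<forall>i\<ge>k. good i x" "\<forall>i\<ge>l. cell i x \<subseteq> U"
      using U good x unfolding cell_open_def by blast
    then have "P x (max k l)" by (simp add: P_def)
    then show ?thesis unfolding K_def by (rule LeastI)
  qed
  have P_cong: "P y k = P x k" if "y \<in> cell k x" for x y k
    using good_cong[OF that] cell_eq[OF that] by (simp add: P_def)
  have eq: "cell (K x) x = cell (K y) y"
    if "x \<in> U" "y \<in> U" and u: "u \<in> cell (K x) x" "u \<in> cell (K y) y" and le: "K x \<le> K y" for x y u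
  proof -
    have "y \<in> cell (K y) u" using cell_eq[OF u(2)] cell_self by blast
    then have y: "y \<in> cell (K x) u" using cell_antimono[OF le] by blast
    then have y': "y \<in> cell (K x) x" using cell_eq[OF u(1)] by simp
    then have "P y (K x)" using P_cong PK \<open>x \<in> U\<close> by blast
    then have "K y \<le> K x" unfolding K_def[of y] by (rule Least_le)
    then have "K y = K x" using le by simp
    then show ?thesis using cell_eq[OF y'] by simp
  qed
  show ?thesis
  proof (rule that[of \<D>])
    have "\<D> \<subseteq> (\<Union>k. range (cell k))" unfolding \<D>_def by blast
    then show "countable \<D>" by (rule countable_subset) (simp add: countable_cells)
    show "disjoint \<D>"
    proof (rule disjointI)
      fix A B assume AB: "A \<in> \<D>" "B \<in> \<D>" "A \<noteq> B"
      then obtain x y where xy: "x \<in> U" "A = cell (K x) x" "y \<in> U" "B = cell (K y) y"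
        by (auto simp: \<D>_def)
      show "A \<inter> B = {}"
      proof (rule ccontr)
        assume "A \<inter> B \<noteq> {}"
        then obtain u where "u \<in> A" "u \<in> B" by blast
        then have "A = B"
          using eq[of x y u] eq[of y x u] xy by (cases "K x \<le> K y") auto
        then show False using AB by simp
      qed
    qed
    show "\<Union>\<D> = U"
      using PK cell_self unfolding \<D>_def P_def by blast
    show "\<exists>k x. D = cell k x \<and> good k x" if "D \<in> \<D>" for D
      using that PK unfolding \<D>_def P_def by blast
  qed
qed

text \<open>
  This replaces the Lebesgue density theorem.  A point avoiding all \<open>E j\<close> with \<open>j \<ge> K\<close> avoids
  a finite number of them, and what remains of the cell after removing these is again a disjoint
  union of good cells; iterating, the measure decreases geometrically.
\<close>

lemma limsup_full_in_good_cell: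
  assumes good: "\<And>x. x \<in> X \<Longrightarrow> \<exists>k0. \<forall>k\<ge>k0. good k x"
    and good_cong: "\<And>k x y. y \<in> cell k x \<Longrightarrow> good k y = good k x"
    and good_subset: "\<And>k x. good k x \<Longrightarrow> cell k x \<subseteq> X"
    and fin: "\<And>k x. good k x \<Longrightarrow> emeasure M (cell k x) < \<infinity>"
    and E: "\<And>j::nat. cell_open (- E j)" "\<And>j. E j \<in> sets M"
    and c: "0 < c" "c \<le> 1"
    and lower: "\<And>k x K. good k x \<Longrightarrow>
      c * measure M (cell k x) \<le> measure M (cell k x \<inter> (\<Union>j\<in>{K..}. E j))"
    and Q: "good k x"
  shows "emeasure M (cell k x - (\<Union>j\<in>{K..}. E j)) = 0"
proof -
  \<comment> \<open>Stated for all cells and all \<open>K\<close>, because the induction step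
    restarts in smaller cells with a later first index.\<close>
  have step: "emeasure M (cell k x - (\<Union>j\<in>{K..}. E j)) \<le> ennreal ((1 - c/2) ^ m) * emeasure M (cell k x)"
    if "good k x" for k x K m
    using that
  proof (induction m arbitrary: k x K)
    case 0
    then show ?case by (auto intro!: emeasure_mono sets_cell)
  next
    case (Suc m)
    define Q where "Q = cell k x"
    have Qs: "Q \<in> sets M" and Qfin: "emeasure M Q < \<infinity>"
      using sets_cell fin Suc.prems by (auto simp: Q_def)
    define B where "B i = Q \<inter> (\<Union>j\<in>{K..<K+i}. E j)" for i
    have Bs: "B i \<in> sets M" for i
      unfolding B_def using E(2) Qs by auto
    have UB: "(\<Union>i. B i) = Q \<inter> (\<Union>j\<in>{K..}. E j)"
    proof
      show "Q \<inter> (\<Union>j\<in>{K..}. E j) \<subseteq> (\<Union>i. B i)"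
      proof
        fix y assume "y \<in> Q \<inter> (\<Union>j\<in>{K..}. E j)"
        then obtain j where "j \<ge> K" "y \<in> E j" "y \<in> Q" by auto
        then have "y \<in> B (Suc j - K)" by (auto simp: B_def)
        then show "y \<in> (\<Union>i. B i)" by blast
      qed
    qed (auto simp: B_def)
    have inc: "incseq B" unfolding B_def incseq_def by fastforce
    have "Q \<inter> (\<Union>j\<in>{K..}. E j) \<in> sets M" using Bs unfolding UB[symmetric] by auto
    have "emeasure M (\<Union>i. B i) \<noteq> \<infinity>"
      using Qfin emeasure_mono[of "\<Union>i. B i" Q M] Qs UB by (auto simp: top_unique)
    then have lim: "(\<lambda>i. measure M (B i)) \<longlonglongrightarrow> measure M (Q \<inter> (\<Union>j\<in>{K..}. E j))"
      using Lim_measure_incseq[of B M] Bs inc UB by auto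
    \<comment> \<open>Half of the proportion \<open>c\<close> is given up so that finitely many sets
      suffice; only then is the remainder \<open>W\<close> cell-open and can be partitioned
      again.\<close>
    have "\<exists>i. measure M (B i) \<ge> c/2 * measure M Q"
    proof (cases "measure M Q = 0")
      case False
      then have "measure M Q > 0" by (simp add: zero_less_measure_iff)
      then have "c/2 * measure M Q < c * measure M Q" using c by simp
      also have "\<dots> \<le> measure M (Q \<inter> (\<Union>j\<in>{K..}. E j))"
        using lower[OF Suc.prems] by (simp add: Q_def)
      finally have "eventually (\<lambda>i. measure M (B i) > c/2 * measure M Q) sequentially"
        using lim order_tendstoD(1) by blast
      then have "\<exists>i. measure M (B i) > c/2 * measure M Q" by (auto simp: eventually_sequentially)
      then show ?thesis by (auto intro: less_imp_le)
    qed auto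
    then obtain i where i: "measure M (B i) \<ge> c/2 * measure M Q" by blast
    define W where "W = Q - (\<Union>j\<in>{K..<K+i}. E j)"
    have W: "W = Q - B i" by (auto simp: W_def B_def)
    have W_open: "cell_open W"
      unfolding W_def Q_def by (intro cell_open_Diff_UN cell_open_cell E) auto
    have WX: "W \<subseteq> X" using good_subset[OF Suc.prems] by (auto simp: W_def Q_def)
    obtain \<D> where \<D>: "countable \<D>" "disjoint \<D>" "\<Union>\<D> = W"
      "\<And>D. D \<in> \<D> \<Longrightarrow> \<exists>k x. D = cell k x \<and> good k x"
    proof (rule cell_open_partition[OF W_open, of good])
      show "\<exists>k0. \<forall>k\<ge>k0. good k y" if "y \<in> W" for y
        using that WX by (intro good) auto
    qed (use good_cong in auto)
    have \<D>s: "D \<in> sets M" if "D \<in> \<D>" for D using \<D>(4)[OF that] sets_cell by auto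
    have disj: "disjoint_family_on (\<lambda>D. D) \<D>"
      using \<D>(2) by (auto simp: disjoint_family_on_def disjoint_def)
    define V where "V = (\<Union>j\<in>{K+i..}. E j)"
    have Vs: "V \<in> sets M" unfolding V_def using E(2) by auto
    have "Q - (\<Union>j\<in>{K..}. E j) \<subseteq> (\<Union>D\<in>\<D>. D - V)"
    proof
      fix y assume y: "y \<in> Q - (\<Union>j\<in>{K..}. E j)"
      then have "y \<in> W" by (auto simp: W_def)
      moreover have "y \<notin> V" using y by (auto simp: V_def)
      ultimately show "y \<in> (\<Union>D\<in>\<D>. D - V)" using \<D>(3) by auto
    qed
    then have "emeasure M (Q - (\<Union>j\<in>{K..}. E j)) \<le> emeasure M (\<Union>D\<in>\<D>. D - V)"
      using \<D>s Vs \<D>(1) by (intro emeasure_mono) auto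
    also have "\<dots> = (\<integral>\<^sup>+D. emeasure M (D - V) \<partial>count_space \<D>)"
    proof (rule emeasure_UN_countable)
      show "disjoint_family_on (\<lambda>D. D - V) \<D>"
        using disj unfolding disjoint_family_on_def by blast
    qed (use \<D>s Vs \<D>(1) in auto)
    also have "\<dots> \<le> (\<integral>\<^sup>+D. ennreal ((1 - c/2) ^ m) * emeasure M D \<partial>count_space \<D>)"
    proof (rule nn_integral_mono)
      fix D assume "D \<in> space (count_space \<D>)"
      then have "D \<in> \<D>" by simp
      from \<D>(4)[OF this] obtain k x where "D = cell k x" "good k x" by blast
      then show "emeasure M (D - V) \<le> ennreal ((1 - c/2) ^ m) * emeasure M D"
        unfolding V_def using Suc.IH by simp
    qed
    also have "\<dots> = ennreal ((1 - c/2) ^ m) * (\<integral>\<^sup>+D. emeasure M D \<partial>count_space \<D>)"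
      by (rule nn_integral_cmult) auto
    also have "(\<integral>\<^sup>+D. emeasure M D \<partial>count_space \<D>) = emeasure M W"
      using emeasure_UN_countable[of \<D> "\<lambda>D. D" M] \<D> \<D>s disj by simp
    also have "emeasure M W \<le> ennreal (1 - c/2) * emeasure M Q"
    proof -
      have Wfin: "emeasure M W \<noteq> \<infinity>" "emeasure M (B i) \<noteq> \<infinity>"
        using Qfin emeasure_mono[of W Q M] emeasure_mono[of "B i" Q M] Qs
        by (auto simp: W B_def top_unique)
      have "measure M W = measure M Q - measure M (B i)"
        unfolding W using Bs Qs Qfin by (intro measure_Diff) (auto simp: B_def)
      also have "\<dots> \<le> (1 - c/2) * measure M Q" using i by (simp add: algebra_simps)
      finally have "ennreal (measure M W) \<le> ennreal ((1 - c/2) * measure M Q)"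
        by (rule ennreal_leI)
      also have "\<dots> = ennreal (1 - c/2) * ennreal (measure M Q)"
        using c by (intro ennreal_mult) auto
      finally show ?thesis
        using Wfin Qfin by (simp add: emeasure_eq_ennreal_measure)
    qed
    finally have "emeasure M (Q - (\<Union>j\<in>{K..}. E j))
        \<le> ennreal ((1 - c/2) ^ m) * (ennreal (1 - c/2) * emeasure M Q)"
      by (simp add: mult_left_mono)
    also have "\<dots> = ennreal ((1 - c/2) ^ Suc m) * emeasure M Q"
      using c by (simp add: ennreal_mult mult_ac)
    finally show ?case by (simp add: Q_def)
  qed
  have Qfin: "emeasure M (cell k x) < \<infinity>" using fin Q by auto
  have "(\<lambda>m. (1 - c/2) ^ m) \<longlonglongrightarrow> 0" using c by (intro LIMSEQ_power_zero) auto
  then have "(\<lambda>m. ennreal ((1 - c/2) ^ m * measure M (cell k x))) \<longlonglongrightarrow> ennreal 0"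
    by (intro tendsto_ennrealI tendsto_mult_left_zero)
  moreover have "ennreal ((1 - c/2) ^ m * measure M (cell k x))
      = ennreal ((1 - c/2) ^ m) * emeasure M (cell k x)" for m
    using c Qfin by (simp add: ennreal_mult emeasure_eq_ennreal_measure)
  ultimately have "emeasure M (cell k x - (\<Union>j\<in>{K..}. E j)) \<le> ennreal 0"
    using step[OF Q, of K] by (intro LIMSEQ_le_const) auto
  then show ?thesis by simp
qed

end

text \<open>Cauchy-Schwarz for the counting function \<open>f\<close> of the sets and the indicator
  of their union, which is 1 wherever \<open>f\<close> is nonzero. It is derived from the fact that
  the square of \<open>f - t * indicator U\<close> has a nonnegative integral for every
  \<open>t\<close>.\<close>

lemma Chung_Erdos:
  fixes A :: "'i \<Rightarrow> 'a set"
  assumes J: "finite J" and A: "\<And>j. j \<in> J \<Longrightarrow> A j \<in> sets M" "\<And>j. j \<in> J \<Longrightarrow> emeasure M (A j) < \<infinity>"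
  shows "(\<Sum>j\<in>J. measure M (A j))\<^sup>2
    \<le> measure M (\<Union>j\<in>J. A j) * (\<Sum>j\<in>J. \<Sum>l\<in>J. measure M (A j \<inter> A l))"
proof -
  define U where "U = (\<Union>j\<in>J. A j)"
  have Us: "U \<in> sets M" unfolding U_def using A J by auto
  have Ufin: "emeasure M U < \<infinity>"
  proof -
    have "emeasure M U \<le> (\<Sum>j\<in>J. emeasure M (A j))"
      unfolding U_def using A J by (intro emeasure_subadditive_finite) auto
    also have "\<dots> < \<infinity>" using A J by simp
    finally show ?thesis .
  qed
  define S where "S = (\<Sum>j\<in>J. measure M (A j))"
  define T where "T = (\<Sum>j\<in>J. \<Sum>l\<in>J. measure M (A j \<inter> A l))"
  define u where "u = measure M U"
  have fin2: "emeasure M (A j \<inter> A l) < \<infinity>" if "j \<in> J" "l \<in> J" for j l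
    using A[OF that(1)] A[OF that(2)] emeasure_mono[of "A j \<inter> A l" "A j" M]
    by (auto intro: le_less_trans)
  define f :: "'a \<Rightarrow> real" where "f x = (\<Sum>j\<in>J. indicator (A j) x)" for x
  have fU: "f x * indicator U x = f x" for x
    unfolding f_def sum_distrib_right by (intro sum.cong) (auto simp: U_def indicator_def)
  have ff: "f x * f x = (\<Sum>j\<in>J. \<Sum>l\<in>J. indicator (A j \<inter> A l) x)" for x
    unfolding f_def sum_product by (simp add: indicator_inter_arith)
  have int1: "integrable M (indicator (A j) :: 'a \<Rightarrow> real)" if "j \<in> J" for j
    using A[OF that] by (simp add: integrable_indicator_iff)
  have int2: "integrable M (indicator (A j \<inter> A l) :: 'a \<Rightarrow> real)" if "j \<in> J" "l \<in> J" for j l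
    using A[OF that(1)] A[OF that(2)] fin2[OF that] by (intro integrable_real_indicator) auto
  have intU: "integrable M (indicator U :: 'a \<Rightarrow> real)"
    using Us Ufin by (intro integrable_real_indicator) auto
  have If: "integrable M f" "integral\<^sup>L M f = S"
  proof -
    show "integrable M f" unfolding f_def using int1 by auto
    have "integral\<^sup>L M f = (\<Sum>j\<in>J. integral\<^sup>L M (indicator (A j)))"
      unfolding f_def using int1 by (intro Bochner_Integration.integral_sum) auto
    also have "\<dots> = S"
      unfolding S_def using A by (intro sum.cong) (auto simp: sets.sets_into_space Int_absorb2)
    finally show "integral\<^sup>L M f = S" .
  qed
  have Iff: "integrable M (\<lambda>x. f x * f x)" "integral\<^sup>L M (\<lambda>x. f x * f x) = T"
  proof -
    show "integrable M (\<lambda>x. f x * f x)" unfolding ff using int2 by auto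
    have "integral\<^sup>L M (\<lambda>x. f x * f x) = (\<Sum>j\<in>J. \<Sum>l\<in>J. integral\<^sup>L M (indicator (A j \<inter> A l)))"
      unfolding ff using int2 by (simp add: Bochner_Integration.integral_sum)
    also have "\<dots> = T"
      unfolding T_def using A by (intro sum.cong refl) (simp add: sets.sets_into_space Int_absorb2 le_infI1)
    finally show "integral\<^sup>L M (\<lambda>x. f x * f x) = T" .
  qed
  have IU: "integral\<^sup>L M (indicator U) = u"
    using Us by (simp add: u_def sets.sets_into_space Int_absorb2)
  have ge: "0 \<le> T - 2 * t * S + t * t * u" for t
  proof -
    have "(f x - t * indicator U x)\<^sup>2 = f x * f x - 2 * t * f x + t * t * indicator U x" for x
    proof -
      have "indicator U x * indicator U x = (indicator U x :: real)" by (simp add: indicator_def)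
      then have "(f x - t * indicator U x)\<^sup>2
          = f x * f x - 2 * t * (f x * indicator U x) + t * t * indicator U x"
        by (simp add: power2_eq_square algebra_simps)
      then show ?thesis by (simp add: fU)
    qed
    then have "integral\<^sup>L M (\<lambda>x. (f x - t * indicator U x)\<^sup>2)
      = integral\<^sup>L M (\<lambda>x. f x * f x - 2 * t * f x + t * t * indicator U x)" by simp
    also have "\<dots> = T - 2 * t * S + t * t * u"
      using If Iff IU intU by (simp add: Bochner_Integration.integral_add Bochner_Integration.integral_diff)
    finally show ?thesis
      by (metis (no_types, lifting) Bochner_Integration.integral_nonneg zero_le_power2)
  qed
  have "S\<^sup>2 \<le> u * T"
  proof (cases "u = 0")
    case True
    have "measure M (A j) = 0" if "j \<in> J" for j
    proof -
      have "measure M (A j) \<le> u" unfolding u_def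
        using Us Ufin that J A by (intro measure_mono_fmeasurable) (auto simp: U_def fmeasurable_def)
      then show ?thesis using True by (simp add: measure_le_0_iff)
    qed
    then show ?thesis using True by (simp add: S_def)
  next
    case False
    then have u: "u > 0" by (simp add: u_def zero_less_measure_iff)
    \<comment> \<open>The value \<open>t = S / u\<close> minimizes the quadratic polynomial in
      \<open>t\<close>.\<close>
    have "0 \<le> T - 2 * (S/u) * S + (S/u) * (S/u) * u" by (rule ge)
    then show ?thesis using u by (simp add: field_simps power2_eq_square)
  qed
  then show ?thesis by (simp add: S_def T_def u_def U_def)
qed

section \<open>Rational points and their tubes\<close>

definition int_vec :: "int ^ 'n \<Rightarrow> 'k::rat_completion ^ 'n" where
  "int_vec z = (\<chi> i. of_int (z $ i))"

text \<open>The real sup norm, used at every place. Up to the factor \<open>CARD('n)\<close> it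
  bounds the projective height from above, also when the coordinates have common factors; see
  \<open>height_rat_vec_le\<close>.\<close>

definition int_height :: "int ^ 'n \<Rightarrow> real" where
  "int_height z = Max (range (\<lambda>i. real_of_int \<bar>z $ i\<bar>))"

lemma int_vec_eq_0_iff [simp]: "int_vec z = 0 \<longleftrightarrow> z = 0"
  by (simp add: int_vec_def vec_eq_iff)

lemma int_height_le_iff: "int_height z \<le> h \<longleftrightarrow> (\<forall>i. real_of_int \<bar>z $ i\<bar> \<le> h)"
  unfolding int_height_def by (subst Max_le_iff) auto

lemma int_height_ge: "real_of_int \<bar>z $ i\<bar> \<le> int_height z"
  using int_height_le_iff by blast

lemma int_height_ge_1: assumes "z \<noteq> 0" shows "int_height z \<ge> 1"
proof -
  obtain i where "z $ i \<noteq> 0" using assms by (auto simp: vec_eq_iff)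
  then show ?thesis using int_height_ge[of z i] by linarith
qed

lemma finite_vec_Collect:
  assumes "\<And>i. finite (A i)"
  shows "finite {z :: 'a ^ 'n. \<forall>i. z $ i \<in> A i}" "card {z :: 'a ^ 'n. \<forall>i. z $ i \<in> A i} = (\<Prod>i\<in>UNIV. card (A i))"
proof -
  have bij: "bij_betw vec_nth {z :: 'a ^ 'n. \<forall>i. z $ i \<in> A i} (PiE UNIV A)"
  proof (rule bij_betwI)
    show "vec_nth \<in> {z :: 'a ^ 'n. \<forall>i. z $ i \<in> A i} \<rightarrow> PiE UNIV A" by auto
    show "vec_lambda \<in> PiE UNIV A \<rightarrow> {z :: 'a ^ 'n. \<forall>i. z $ i \<in> A i}" by (auto simp: PiE_iff)
  qed auto
  have fin: "finite (PiE UNIV A)" using assms by (intro finite_PiE) auto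
  show "finite {z :: 'a ^ 'n. \<forall>i. z $ i \<in> A i}"
    using bij_betw_finite[OF bij] fin by simp
  show "card {z :: 'a ^ 'n. \<forall>i. z $ i \<in> A i} = (\<Prod>i\<in>UNIV. card (A i))"
    using bij_betw_same_card[OF bij] by (simp add: card_PiE)
qed

lemma finite_int_height_le: "finite {z :: int ^ 'n. int_height z \<le> h}"
proof (rule finite_subset)
  show "{z :: int ^ 'n. int_height z \<le> h} \<subseteq> {z. \<forall>i. z $ i \<in> {- \<lfloor>h\<rfloor>..\<lfloor>h\<rfloor>}}"
  proof
    fix z :: "int ^ 'n" assume "z \<in> {z. int_height z \<le> h}"
    then have "\<bar>z $ i\<bar> \<le> \<lfloor>h\<rfloor>" for i by (simp add: int_height_le_iff le_floor_iff)
    then show "z \<in> {z. \<forall>i. z $ i \<in> {- \<lfloor>h\<rfloor>..\<lfloor>h\<rfloor>}}" by (auto simp: abs_le_iff) (metis minus_le_iff)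
  qed
qed (rule finite_vec_Collect, simp)

lemma power_add_le_real:
  fixes x y :: real
  assumes "x \<ge> 0" "y \<ge> 0"
  shows "(x + y) ^ d \<le> 2 ^ d * (x ^ d + y ^ d)"
proof -
  have "(x + y) ^ d \<le> (2 * max x y) ^ d"
    using assms by (intro power_mono) auto
  also have "\<dots> = 2 ^ d * max x y ^ d" by (simp add: power_mult_distrib)
  also have "max x y ^ d \<le> x ^ d + y ^ d"
    using assms by (auto simp: max_def)
  finally show ?thesis by simp
qed

text \<open>Here \<open>d\<close> is the projective dimension and \<open>b\<close> the ratio of
  consecutive scales, which is 2 or the prime. The set \<open>P\<close> of integer representatives
  is left open because over the \<open>p\<close>-adic numbers they must be normalized. The
  assumptions \<open>separated\<close> and \<open>covering\<close> concern the one-dimensional axis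
  of a tube. In \<open>Dirichlet\<close> the radius contains the height of the point itself and not
  the bound for it, so that higher points come with thinner tubes. The bound in
  \<open>counting\<close> has the shape expected for one free coordinate with about \<open>h\<close>
  values and \<open>d\<close> further coordinates with about \<open>1 + h * r\<close> values
  each.\<close>

locale projective_khinchin = nested_cells \<beta> cell
  for \<beta> :: "('k::rat_completion ^ 'n::finite) measure" and cell :: "nat \<Rightarrow> 'k ^ 'n \<Rightarrow> ('k ^ 'n) set" +
  fixes d b CD :: nat and P :: "(int ^ 'n) set" and cM CM cS CC KC :: real
  assumes card_n: "CARD('n) = Suc d" and d_pos: "d > 0" and b_ge_2: "b \<ge> 2"
    and consts_pos: "cM > 0" "CM > 0" "cS > 0" "CC > 0" "KC > 0" "CD > 0"
    and sets_eq: "sets \<beta> = sets borel"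
    and emeasure_ball: "emeasure \<beta> (sup_ball x r) < \<infinity>"
    and ball_lb: "r > 0 \<Longrightarrow> cM * r ^ Suc d \<le> measure \<beta> (sup_ball x r)"
    and ball_ub: "r > 0 \<Longrightarrow> measure \<beta> (sup_ball x r) \<le> CM * r ^ Suc d"
    and separated: "0 < \<eta> \<Longrightarrow> \<eta> \<le> s \<Longrightarrow> \<exists>F. finite F \<and> (\<forall>f\<in>F. vabs f \<le> s) \<and>
          (\<forall>f\<in>F. \<forall>g\<in>F. f \<noteq> g \<longrightarrow> \<eta> < vabs (f - g :: 'k)) \<and> cS * s / \<eta> \<le> real (card F)"
    and covering: "0 < \<eta> \<Longrightarrow> \<eta> \<le> s \<Longrightarrow> \<exists>F. finite F \<and> real (card F) \<le> CC * s / \<eta> \<and>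
          (\<forall>t. vabs (t - a :: 'k) \<le> s \<longrightarrow> (\<exists>f\<in>F. vabs (t - f) \<le> \<eta>))"
    and cell_ball: "\<exists>z. sup_ball z (1 / b ^ k / 2) \<subseteq> cell k x \<and> cell k x \<subseteq> sup_ball z (1 / b ^ k)"
    and P_nonzero: "z \<in> P \<Longrightarrow> z \<noteq> 0"
    and Dirichlet: "x \<noteq> 0 \<Longrightarrow> \<exists>z\<in>P. int_height z \<le> CD * b ^ (j * d) \<and>
          near (CD / (b ^ j * int_height z)) x (int_vec z)"
    and counting: "x \<noteq> 0 \<Longrightarrow> h \<ge> 1 \<Longrightarrow> 0 < r \<Longrightarrow> r \<le> 1 \<Longrightarrow>
          real (card {z \<in> P. int_height z \<le> h \<and> near r x (int_vec z)}) \<le> KC * h * (1 + h * r) ^ d"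
begin

section \<open>Measure of the part of a tube in a ball\<close>

definition tube :: "real \<Rightarrow> 'k ^ 'n \<Rightarrow> ('k ^ 'n) set" where
  "tube \<rho> e = {x. near \<rho> x e}"

lemma mem_tube: "x \<in> tube \<rho> e \<longleftrightarrow> near \<rho> x e"
  by (simp add: tube_def)

lemma sets_closed: "closed A \<Longrightarrow> A \<in> sets \<beta>"
  by (simp add: sets_eq)

lemma sets_sup_ball [simp, intro]: "sup_ball z r \<in> sets \<beta>"
  by (rule sets_closed[OF closed_sup_ball])

lemma closed_tube: "closed (tube \<rho> e)"
  unfolding tube_def by (rule closed_near)

lemma sets_tube [simp, intro]: "tube \<rho> e \<in> sets \<beta>"
  by (rule sets_closed[OF closed_tube])

lemma sup_ball_fmeasurable [simp, intro]: "sup_ball z r \<in> fmeasurable \<beta>"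
  using emeasure_ball by (auto simp: fmeasurable_def)

lemma sup_ball_Int_fmeasurable [simp, intro]:
  "A \<in> sets \<beta> \<Longrightarrow> sup_ball z r \<inter> A \<in> fmeasurable \<beta>"
  by (rule fmeasurable_Int_fmeasurable) auto

lemma tube_Int_fmeasurable [simp, intro]: "tube \<rho> e \<inter> sup_ball z r \<in> fmeasurable \<beta>"
  using sup_ball_Int_fmeasurable[of "tube \<rho> e"] by (simp add: Int_commute)

lemma measure_le_fm: "A \<subseteq> B \<Longrightarrow> A \<in> sets \<beta> \<Longrightarrow> B \<in> fmeasurable \<beta> \<Longrightarrow> measure \<beta> A \<le> measure \<beta> B"
  by (rule measure_mono_fmeasurable)

text \<open>A tube of width \<open>\<eta> = 2 * \<rho> * R\<close> is covered by at most
  \<open>CC * s / \<eta>\<close> balls of radius \<open>2 * \<eta>\<close>, each of measure at most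
  \<open>CM * (2 * \<eta>) ^ Suc d\<close>; the last factor \<open>2 ^ d\<close> comes from
  \<open>\<eta> ^ d\<close>. The summand 1 pays for tubes wider than the ball.\<close>

definition CU :: real where "CU = (CC * 2 ^ Suc d + 1) * CM * 2 ^ d"

lemma CU_pos: "CU > 0"
  unfolding CU_def using consts_pos by (intro mult_pos_pos add_pos_pos) auto

text \<open>The part of a tube in a ball is covered by balls whose centres lie on the axis of the tube.\<close>

lemma tube_ub:
  assumes e: "e \<noteq> 0" and s: "0 < s" "s \<le> sup_norm z" and \<rho>: "0 < \<rho>"
  shows "measure \<beta> (tube \<rho> e \<inter> sup_ball z s) \<le> CU * s * (\<rho> * sup_norm z) ^ d"
proof -
  define R where "R = sup_norm z"
  \<comment> \<open>Points of the ball have norm at most \<open>2 * R\<close>, so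
    \<open>\<eta>\<close> bounds their distance from the axis if they lie in the tube.\<close>
  define \<eta> where "\<eta> = 2 * \<rho> * R"
  have R: "R > 0" using s unfolding R_def by linarith
  have \<eta>: "\<eta> > 0" using R \<rho> by (simp add: \<eta>_def)
  have \<eta>d: "\<eta> ^ d = 2 ^ d * (\<rho> * R) ^ d" by (simp add: \<eta>_def power_mult_distrib)
  show ?thesis
  proof (cases "\<eta> \<le> s")
    \<comment> \<open>The tube is wider than the ball, and the measure of the ball is already small
      enough.\<close>
    case False
    have "measure \<beta> (tube \<rho> e \<inter> sup_ball z s) \<le> measure \<beta> (sup_ball z s)"
      by (rule measure_le_fm) auto
    also have "\<dots> \<le> CM * (s * s ^ d)" using ball_ub[of s z] s by simp
    also have "\<dots> \<le> CM * (s * \<eta> ^ d)"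
      using False s consts_pos by (intro mult_left_mono power_mono) auto
    also have "\<dots> = 1 * (CM * 2 ^ d * s * (\<rho> * R) ^ d)" by (simp add: \<eta>d)
    also have "\<dots> \<le> (CC * 2 ^ Suc d + 1) * (CM * 2 ^ d * s * (\<rho> * R) ^ d)"
      using consts_pos s R \<rho> by (intro mult_right_mono) auto
    finally show ?thesis by (simp add: CU_def R_def mult_ac)
  next
    case True
    obtain i where i: "sup_norm e = vabs (e $ i)" by (rule sup_norm_attained)
    \<comment> \<open>With the coordinate \<open>i\<close> scaled to 1, the nearby point of the axis
      is given by the coordinate \<open>x $ i\<close> alone, so a covering of the possible values of
      \<open>x $ i\<close> yields the centres.\<close>
    define e' where "e' = (1 / e $ i) *s e"
    have "vabs (e $ i) > 0" using e unfolding i[symmetric] by simp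
    then have ei: "e $ i \<noteq> 0" by auto
    have e': "sup_norm e' = 1" using ei by (simp add: e'_def sup_norm_scale vabs_divide i)
    obtain F where F: "finite F" "real (card F) \<le> CC * s / \<eta>"
      and cov: "\<And>t. vabs (t - z $ i) \<le> s \<Longrightarrow> \<exists>f\<in>F. vabs (t - f) \<le> \<eta>"
      using covering[OF \<eta> True, of "z $ i"] by auto
    have sub: "tube \<rho> e \<inter> sup_ball z s \<subseteq> (\<Union>f\<in>F. sup_ball (f *s e') (2 * \<eta>))"
    proof
      fix x assume "x \<in> tube \<rho> e \<inter> sup_ball z s"
      then have x: "near \<rho> x e" "sup_norm (x - z) \<le> s" by (auto simp: mem_tube mem_sup_ball)
      have xR: "sup_norm x \<le> 2 * R"
        using sup_norm_triangle_sub[of x z] x s by (simp add: R_def)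
      have "vabs (x $ i - z $ i) \<le> s" using sup_norm_ge[of "x - z" i] x by simp
      then obtain f where f: "f \<in> F" "vabs (x $ i - f) \<le> \<eta>" using cov by blast
      have "x - f *s e' = (x - (x $ i / e $ i) *s e) + (x $ i - f) *s e'"
        by (simp add: e'_def vec_eq_iff left_diff_distrib diff_divide_distrib)
      also have "sup_norm \<dots> \<le> \<rho> * sup_norm x + vabs (x $ i - f) * 1"
        by (rule order_trans[OF sup_norm_triangle], rule add_mono[OF near_imp_close_to_line[OF x(1) e i]])
          (simp only: sup_norm_scale e' order_refl)
      also have "\<dots> \<le> \<rho> * (2 * R) + \<eta>"
        using f xR \<rho> by (intro add_mono mult_left_mono) auto
      also have "\<dots> = 2 * \<eta>" by (simp add: \<eta>_def)
      finally show "x \<in> (\<Union>f\<in>F. sup_ball (f *s e') (2 * \<eta>))" using f by (auto simp: mem_sup_ball)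
    qed
    have "measure \<beta> (tube \<rho> e \<inter> sup_ball z s) \<le> measure \<beta> (\<Union>f\<in>F. sup_ball (f *s e') (2 * \<eta>))"
      using F by (intro measure_le_fm sub fmeasurable.finite_UN) auto
    also have "\<dots> \<le> (\<Sum>f\<in>F. measure \<beta> (sup_ball (f *s e') (2 * \<eta>)))"
      using F by (intro measure_UNION_le) auto
    also have "\<dots> \<le> (\<Sum>f\<in>F. CM * (2 * \<eta>) ^ Suc d)"
      using \<eta> by (intro sum_mono ball_ub) auto
    also have "\<dots> = real (card F) * (CM * (2 * \<eta>) ^ Suc d)" by simp
    also have "\<dots> \<le> (CC * s / \<eta>) * (CM * (2 * \<eta>) ^ Suc d)"
      using F \<eta> consts_pos by (intro mult_right_mono) auto
    also have "\<dots> = CC * 2 ^ Suc d * (CM * s * \<eta> ^ d)"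
      using \<eta> by (simp add: power_mult_distrib)
    also have "\<dots> = CC * 2 ^ Suc d * (CM * 2 ^ d * s * (\<rho> * R) ^ d)"
      by (simp add: \<eta>d)
    also have "\<dots> \<le> (CC * 2 ^ Suc d + 1) * (CM * 2 ^ d * s * (\<rho> * R) ^ d)"
      using consts_pos s R \<rho> by (intro mult_right_mono) auto
    finally show ?thesis by (simp add: CU_def R_def mult_ac)
  qed
qed

text \<open>At least \<open>cS * (s / 8) / \<eta>\<close> disjoint balls of radius
  \<open>\<eta> / 2\<close> with \<open>\<eta> = \<rho> * R / 2\<close>, each of measure at least
  \<open>cM * (\<eta> / 2) ^ Suc d\<close>.\<close>

definition cL :: real where "cL = cS * cM / (8 * 2 ^ Suc d * 2 ^ d)"

lemma cL_pos: "cL > 0"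
  unfolding cL_def using consts_pos by auto

text \<open>Counterpart of \<open>tube_ub\<close>: disjoint balls with separated centres on the axis
  are packed into the tube. A tube could miss the ball altogether; the point \<open>x\<close>, which
  lies in a possibly wider tube about the same axis, ensures that the axis passes close to
  \<open>z\<close>.\<close>

lemma tube_lb:
  assumes e: "e \<noteq> 0" and s: "0 < s" "4 * s \<le> sup_norm z"
    and x: "x \<in> sup_ball z (s/8)" "near \<sigma> x e" and \<sigma>: "0 < \<sigma>" "\<sigma> * sup_norm z \<le> s / 16"
    and \<rho>: "0 < \<rho>" "\<rho> * sup_norm z \<le> s / 4"
  shows "cL * s * (\<rho> * sup_norm z) ^ d \<le> measure \<beta> (tube \<rho> e \<inter> sup_ball z (s/2))"
proof -
  define R where "R = sup_norm z"
  \<comment> \<open>Points of the ball have norm at least \<open>R / 2\<close>, so a distance of at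
    most \<open>\<eta> / 2\<close> from the axis is at most \<open>\<rho> / 2\<close> times the
    norm; \<open>close_to_line_imp_near\<close> doubles this to \<open>\<rho>\<close>.\<close>
  define \<eta> where "\<eta> = \<rho> * R / 2"
  have R: "R > 0" using s unfolding R_def by linarith
  have \<eta>: "\<eta> > 0" "\<eta> \<le> s / 8" using R \<rho> by (auto simp: \<eta>_def R_def)
  obtain i where i: "sup_norm e = vabs (e $ i)" by (rule sup_norm_attained)
  define e' where "e' = (1 / e $ i) *s e"
  have "vabs (e $ i) > 0" using e unfolding i[symmetric] by simp
  then have ei: "e $ i \<noteq> 0" by auto
  have e': "sup_norm e' = 1" using ei by (simp add: e'_def sup_norm_scale vabs_divide i)
  have e'i: "e' $ i = 1" using ei by (simp add: e'_def)
  have xz: "sup_norm (x - z) \<le> s / 8" using x by (simp add: mem_sup_ball)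
  have "sup_norm x \<le> 2 * R" using sup_norm_triangle_sub[of x z] xz s R by (simp add: R_def)
  then have "\<sigma> * sup_norm x \<le> \<sigma> * (2 * R)" using \<sigma> by (intro mult_left_mono) auto
  then have \<sigma>x: "\<sigma> * sup_norm x \<le> s / 8" using \<sigma>(2) unfolding R_def[symmetric] by linarith
  have "x - x $ i *s e' = x - (x $ i / e $ i) *s e"
    by (simp add: e'_def vec_eq_iff)
  then have "sup_norm (x - x $ i *s e') \<le> s / 8"
    using near_imp_close_to_line[OF x(2) e i] \<sigma>x by simp
  \<comment> \<open>The axis passes within \<open>s / 4\<close> of \<open>z\<close>. Moving along it
    by at most \<open>s / 8\<close> and off it by at most \<open>\<eta> / 2 \<le> s / 16\<close>
    does not leave the ball of radius \<open>s / 2\<close>.\<close>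
  then have t0: "sup_norm (x $ i *s e' - z) \<le> s / 4"
    using sup_norm_triangle[of "x $ i *s e' - x" "x - z"] xz
    by (simp add: sup_norm_diff_commute)
  from separated[OF \<eta>] obtain F :: "'k set" where F0: "finite F \<and> (\<forall>f\<in>F. vabs f \<le> s / 8) \<and>
      (\<forall>f\<in>F. \<forall>g\<in>F. f \<noteq> g \<longrightarrow> \<eta> < vabs (f - g)) \<and> cS * (s / 8) / \<eta> \<le> real (card F)" ..
  then have F: "finite F" "\<And>f. f \<in> F \<Longrightarrow> vabs f \<le> s / 8"
      "\<And>f g. f \<in> F \<Longrightarrow> g \<in> F \<Longrightarrow> f \<noteq> g \<Longrightarrow> \<eta> < vabs (f - g)"
      "cS * (s / 8) / \<eta> \<le> real (card F)"
    by simp_all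
  define B where "B f = sup_ball ((x $ i + f) *s e') (\<eta> / 2)" for f
  have sub: "B f \<subseteq> tube \<rho> e \<inter> sup_ball z (s/2)" if f: "f \<in> F" for f
  proof
    fix u assume "u \<in> B f"
    then have u: "sup_norm (u - (x $ i + f) *s e') \<le> \<eta> / 2" by (simp add: B_def mem_sup_ball)
    have "u - z = (u - (x $ i + f) *s e') + (f *s e' + (x $ i *s e' - z))"
      by (simp add: vec_eq_iff algebra_simps)
    also have "sup_norm \<dots> \<le> \<eta> / 2 + (s / 8 + s / 4)"
      using u t0 F(2)[OF f]
      by (intro order_trans[OF sup_norm_triangle] add_mono order_trans[OF sup_norm_triangle[of "f *s e'"]])
        (auto simp: sup_norm_scale e')
    also have "\<dots> \<le> s / 2" using \<eta> s by simp
    finally have uz: "sup_norm (u - z) \<le> s / 2" .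
    then have "R / 2 \<le> sup_norm u"
      using sup_norm_triangle_sub[of z u] s by (simp add: R_def sup_norm_diff_commute)
    then have "\<rho> * (R / 2) \<le> \<rho> * sup_norm u" using \<rho> by (intro mult_left_mono) auto
    then have "\<eta> / 2 \<le> (\<rho> / 2) * sup_norm u" by (simp add: \<eta>_def mult.commute)
    moreover have "(x $ i + f) *s e' = ((x $ i + f) / e $ i) *s e"
      by (simp add: e'_def vec_eq_iff)
    ultimately have "sup_norm (u - ((x $ i + f) / e $ i) *s e) \<le> (\<rho> / 2) * sup_norm u"
      using u by simp
    from close_to_line_imp_near[OF this] uz
    show "u \<in> tube \<rho> e \<inter> sup_ball z (s/2)" by (simp add: mem_tube mem_sup_ball)
  qed
  have disj: "pairwise (\<lambda>f g. disjnt (B f) (B g)) F"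
  proof (rule pairwiseI, rule ccontr)
    fix f g assume fg: "f \<in> F" "g \<in> F" "f \<noteq> g" "\<not> disjnt (B f) (B g)"
    then obtain u where u: "sup_norm (u - (x $ i + f) *s e') \<le> \<eta> / 2"
        "sup_norm (u - (x $ i + g) *s e') \<le> \<eta> / 2"
      by (auto simp: B_def mem_sup_ball disjnt_def)
    have "(f - g) *s e' = (u - (x $ i + g) *s e') - (u - (x $ i + f) *s e')"
      by (simp add: vec_eq_iff algebra_simps)
    then have "sup_norm ((f - g) *s e') \<le> \<eta>"
      using u sup_norm_triangle_diff[of "u - (x $ i + g) *s e'" "u - (x $ i + f) *s e'"] by simp
    then have "vabs (f - g) \<le> \<eta>" unfolding sup_norm_scale e' by simp
    then show False using F(3)[OF fg(1-3)] by simp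
  qed
  have "(4::real) ^ d = 2 ^ d * 2 ^ d" by (simp flip: power_mult_distrib)
  then have "cL * s * (\<rho> * R) ^ d = (cS * (s / 8) / \<eta>) * (cM * (\<eta> / 2) ^ Suc d)"
    using \<eta> R \<rho> by (simp add: cL_def \<eta>_def power_divide power_mult_distrib divide_simps)
  also have "\<dots> \<le> real (card F) * (cM * (\<eta> / 2) ^ Suc d)"
    using F(4) \<eta> consts_pos by (intro mult_right_mono) auto
  also have "\<dots> = (\<Sum>f\<in>F. cM * (\<eta> / 2) ^ Suc d)" by simp
  also have "\<dots> \<le> (\<Sum>f\<in>F. measure \<beta> (B f))"
    unfolding B_def using \<eta> by (intro sum_mono ball_lb) auto
  also have "\<dots> = measure \<beta> (\<Union>f\<in>F. B f)"
    using F(1) disj by (intro measure_UNION'[symmetric]) (simp_all add: B_def)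
  also have "\<dots> \<le> measure \<beta> (tube \<rho> e \<inter> sup_ball z (s/2))"
    using sub F(1) by (intro measure_le_fm) (auto simp: B_def)
  finally show ?thesis by (simp add: R_def)
qed

end

section \<open>Ubiquity: many well separated rational points at every scale\<close>

lemma finite_maximal_pairwise:
  assumes "finite Y"
  obtains S where "S \<subseteq> Y" "\<And>p q. p \<in> S \<Longrightarrow> q \<in> S \<Longrightarrow> p \<noteq> q \<Longrightarrow> \<not> R p q"
    "\<And>p. p \<in> Y \<Longrightarrow> p \<in> S \<or> (\<exists>q\<in>S. R p q \<or> R q p)"
proof -
  define I where "I = {S. S \<subseteq> Y \<and> (\<forall>p\<in>S. \<forall>q\<in>S. p \<noteq> q \<longrightarrow> \<not> R p q)}"
  have "finite I" unfolding I_def using assms by simp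
  moreover have "{} \<in> I" by (simp add: I_def)
  ultimately obtain S where S: "S \<in> I" "\<And>T. T \<in> I \<Longrightarrow> S \<subseteq> T \<Longrightarrow> T = S"
    using finite_has_maximal[of I] by (metis empty_iff)
  have max: "p \<in> S \<or> (\<exists>q\<in>S. R p q \<or> R q p)" if "p \<in> Y" for p
  proof (rule ccontr)
    assume p: "\<not> ?thesis"
    then have "insert p S \<in> I" using S(1) that unfolding I_def by auto
    then have "insert p S = S" using S(2) by blast
    then show False using p by blast
  qed
  show ?thesis
    by (rule that[of S]) (use S(1) max in \<open>auto simp: I_def\<close>)
qed

lemma power_beyond:
  fixes b :: nat and h :: real
  assumes "b \<ge> 2" "h \<ge> 1"
  obtains i where "h \<le> b ^ i" "b ^ i \<le> b * h"
proof -
  have "\<exists>i. h \<le> real b ^ i"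
    using real_arch_pow[of "real b" h] assms by (auto intro: less_imp_le)
  define i where "i = (LEAST i. h \<le> real b ^ i)"
  have i: "h \<le> real b ^ i" unfolding i_def using \<open>\<exists>i. h \<le> real b ^ i\<close> by (rule LeastI_ex)
  have "real b ^ i \<le> b * h"
  proof (cases i)
    case 0
    then show ?thesis using mult_mono[of 1 "real b" 1 h] assms by simp
  next
    case (Suc k)
    have "\<not> h \<le> real b ^ k" using not_less_Least[of k "\<lambda>i. h \<le> real b ^ i"] Suc by (simp add: i_def)
    then show ?thesis using Suc assms by simp
  qed
  then show ?thesis using that[of i] i by simp
qed

context projective_khinchin
begin

text \<open>The points that Dirichlet's theorem may serve by a rational point lying a factor
  \<open>b ^ m\<close> or more below the height \<open>b ^ (j * d)\<close>; the tube of such a point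
  is too wide for scale \<open>j\<close>. The cut-off \<open>m\<close> will be a fixed number,
  chosen to make this set small.\<close>

definition bad :: "nat \<Rightarrow> nat \<Rightarrow> ('k ^ 'n) set" where
  "bad j m = (\<Union>p\<in>{p \<in> P. int_height p \<le> b ^ (j * d - m)}. tube (CD / (b ^ j * int_height p)) (int_vec p))"

lemma finite_P_height: "finite {p \<in> P. int_height p \<le> h}"
  by (rule finite_subset[OF _ finite_int_height_le[of h]]) auto

lemma sets_bad [simp, intro]: "bad j m \<in> sets \<beta>"
  unfolding bad_def by (rule sets.finite_UN[OF finite_P_height]) auto

lemma sum_powers_le: "(\<Sum>i\<le>N. real b ^ i) \<le> 2 * real b ^ N"
proof (induction N)
  case (Suc N)
  have "2 * real b ^ N \<le> real b * real b ^ N"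
    using b_ge_2 by (intro mult_right_mono) auto
  then show ?case using Suc by simp
qed simp

text \<open>
  The points whose Dirichlet approximation has unusually small height: the rational points are
  sorted by height into the ranges between consecutive powers of \<open>b\<close>.
\<close>

lemma bad_measure:
  obtains A where "A > 0"
    "\<And>z s j m. 0 < s \<Longrightarrow> 4 * s \<le> sup_norm z \<Longrightarrow> m \<le> j * d \<Longrightarrow> CD / b ^ j * (2 * sup_norm z) \<le> s / 4 \<Longrightarrow>
       measure \<beta> (bad j m \<inter> sup_ball z (s/8))
         \<le> A * s * (sup_norm z ^ d * (real (j * d) + 1) / b ^ (j * d) + s ^ d / b ^ m)"
proof
  define K0 where "K0 = KC * CU * (CD * real b) ^ d"
  have b0: "real b > 0" and b1: "real b \<ge> 1" using b_ge_2 by auto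
  have K0: "K0 > 0" unfolding K0_def using consts_pos CU_pos b0 by simp
  then show "K0 * 2 ^ d * 2 > 0" by simp
  fix z :: "'k ^ 'n" and s :: real and j m :: nat
  assume s: "0 < s" "4 * s \<le> sup_norm z" and m: "m \<le> j * d"
    and jbig: "CD / b ^ j * (2 * sup_norm z) \<le> s / 4"
  define R where "R = sup_norm z"
  have R: "R > 0" using s unfolding R_def by linarith
  then have z0: "z \<noteq> 0" unfolding R_def by simp
  define N where "N = j * d - m"
  \<comment> \<open>If the tube of \<open>p\<close> meets the small ball, then \<open>z\<close>
    itself is near the axis, with a radius of order \<open>s / R\<close>. This brings the relevant
    points within reach of \<open>counting\<close>.\<close>
  define Z where "Z i = {p \<in> P. int_height p \<le> b ^ i \<and> near (s / R) z (int_vec p)}" for i :: nat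
  \<comment> \<open>Heights are rounded up to powers of \<open>b\<close>, which costs the factor
    \<open>b\<close>.\<close>
  define \<rho> where "\<rho> i = CD * real b / (b ^ j * b ^ i)" for i :: nat
  have \<rho>: "\<rho> i > 0" for i unfolding \<rho>_def using consts_pos b0 by simp
  have finZ: "finite (Z i)" for i
    by (rule finite_subset[OF _ finite_int_height_le[of "b ^ i"]]) (auto simp: Z_def)
  have sub: "bad j m \<inter> sup_ball z (s/8) \<subseteq> (\<Union>i\<in>{..N}. \<Union>p\<in>Z i. tube (\<rho> i) (int_vec p) \<inter> sup_ball z s)"
  proof
    fix x assume "x \<in> bad j m \<inter> sup_ball z (s/8)"
    then obtain p where p: "p \<in> P" "int_height p \<le> b ^ N" "near (CD / (b ^ j * int_height p)) x (int_vec p)"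
      and x: "sup_norm (x - z) \<le> s / 8"
      by (auto simp: bad_def N_def mem_tube mem_sup_ball)
    have h1: "int_height p \<ge> 1" using P_nonzero p by (intro int_height_ge_1) auto
    obtain i where i: "int_height p \<le> b ^ i" "b ^ i \<le> b * int_height p"
      using power_beyond[OF b_ge_2 h1] .
    have "\<exists>i\<le>N. int_height p \<le> b ^ i \<and> b ^ i \<le> b * int_height p"
    proof (cases "i \<le> N")
      case False
      then have "real b ^ N \<le> real b ^ i" using b1 by (intro power_increasing) auto
      then show ?thesis using p(2) i by (intro exI[of _ N]) auto
    qed (use i in auto)
    then obtain i where i: "i \<le> N" "int_height p \<le> b ^ i" "b ^ i \<le> b * int_height p" by blast
    have "CD / (b ^ j * int_height p) = CD * real b / (b ^ j * (b * int_height p))"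
      using b0 h1 by simp
    also have "\<dots> \<le> \<rho> i"
      unfolding \<rho>_def using i b0 h1 by (intro divide_left_mono mult_left_mono mult_pos_pos) auto
    finally have near_x: "near (\<rho> i) x (int_vec p)" using near_mono[OF p(3)] by simp
    have xR: "sup_norm x \<le> 2 * R" using sup_norm_triangle_sub[of x z] x s by (simp add: R_def)
    have "near (s / R) z (int_vec p)"
      unfolding near_def
    proof (intro allI)
      fix a c
      define e where "e = (int_vec p :: 'k ^ 'n)"
      have "vabs (z $ a * e $ c - z $ c * e $ a)
          \<le> vabs (x $ a * e $ c - x $ c * e $ a) + vabs ((z - x) $ a * e $ c - (z - x) $ c * e $ a)"
        using vabs_triangle[of "x $ a * e $ c - x $ c * e $ a" "(z - x) $ a * e $ c - (z - x) $ c * e $ a"]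
        by (simp add: algebra_simps)
      also have "\<dots> \<le> CD / (b ^ j * int_height p) * sup_norm x * sup_norm e + 2 * sup_norm (z - x) * sup_norm e"
        using p(3) by (intro add_mono minor_le) (auto simp: near_def e_def)
      also have "\<dots> \<le> CD / b ^ j * (2 * R) * sup_norm e + 2 * (s / 8) * sup_norm e"
        using h1 x xR b0
        by (intro add_mono mult_right_mono mult_mono divide_left_mono)
          (auto simp: sup_norm_diff_commute)
      also have "\<dots> \<le> s / 4 * sup_norm e + 2 * (s / 8) * sup_norm e"
        using jbig s by (intro add_mono mult_right_mono) (auto simp: R_def)
      also have "\<dots> \<le> s / R * sup_norm z * sup_norm e"
        using R s by (simp add: R_def field_simps)
      finally show "vabs (z $ a * int_vec p $ c - z $ c * int_vec p $ a)
          \<le> s / R * sup_norm z * sup_norm (int_vec p :: 'k ^ 'n)" by (simp add: e_def)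
    qed
    then have "p \<in> Z i" using p i by (simp add: Z_def)
    moreover have "x \<in> tube (\<rho> i) (int_vec p) \<inter> sup_ball z s"
      using near_x x s by (simp add: mem_tube mem_sup_ball)
    ultimately show "x \<in> (\<Union>i\<in>{..N}. \<Union>p\<in>Z i. tube (\<rho> i) (int_vec p) \<inter> sup_ball z s)"
      using i by blast
  qed
  \<comment> \<open>Summed over the ranges, the term \<open>R ^ d\<close> gives the factor
    \<open>j * d + 1\<close>, which is negligible against \<open>b ^ (j * d)\<close>. The term
    \<open>s ^ d * b ^ i\<close> grows geometrically and is dominated by the highest range, which
    gives \<open>1 / b ^ m\<close>.\<close>
  have range_le: "(\<Sum>p\<in>Z i. measure \<beta> (tube (\<rho> i) (int_vec p) \<inter> sup_ball z s))
     \<le> K0 * 2 ^ d * s / b ^ (j * d) * (R ^ d + s ^ d * b ^ i)" for i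
  proof -
    have bi: "real b ^ i \<ge> 1" using b1 by simp
    have "(\<Sum>p\<in>Z i. measure \<beta> (tube (\<rho> i) (int_vec p) \<inter> sup_ball z s))
        \<le> (\<Sum>p\<in>Z i. CU * s * (\<rho> i * R) ^ d)"
      unfolding R_def using s \<rho> P_nonzero by (intro sum_mono tube_ub) (auto simp: Z_def)
    also have "\<dots> = real (card (Z i)) * (CU * s * (\<rho> i * R) ^ d)" by simp
    also have "\<dots> \<le> (KC * b ^ i * (1 + b ^ i * (s / R)) ^ d) * (CU * s * (\<rho> i * R) ^ d)"
      unfolding Z_def using R s CU_pos \<rho> z0 bi
      by (intro mult_right_mono counting) (auto simp: R_def less_imp_le)
    also have "\<dots> = K0 * s * b ^ i * ((1 + b ^ i * (s / R)) * (R / (b ^ j * b ^ i))) ^ d"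
      by (simp add: K0_def \<rho>_def power_mult_distrib power_divide)
    also have "(1 + b ^ i * (s / R)) * (R / (b ^ j * b ^ i)) = (R / b ^ i + s) / b ^ j"
      using R b0 by (simp add: field_simps)
    also have "K0 * s * b ^ i * ((R / b ^ i + s) / b ^ j) ^ d = K0 * s / b ^ (j * d) * (b ^ i * (R / b ^ i + s) ^ d)"
      by (simp add: power_divide power_mult)
    also have "\<dots> \<le> K0 * s / b ^ (j * d) * (b ^ i * (2 ^ d * ((R / b ^ i) ^ d + s ^ d)))"
      using R b0 s K0 by (intro mult_left_mono power_add_le_real) auto
    also have "\<dots> = K0 * 2 ^ d * s / b ^ (j * d) * (b ^ i * (R / b ^ i) ^ d + s ^ d * b ^ i)"
      by (simp add: algebra_simps)
    also have "\<dots> \<le> K0 * 2 ^ d * s / b ^ (j * d) * (R ^ d + s ^ d * b ^ i)"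
    proof (intro mult_left_mono add_right_mono)
      have "real b ^ i \<le> (real b ^ i) ^ d" using bi d_pos by (rule self_le_power)
      then have "R ^ d * real b ^ i \<le> R ^ d * (real b ^ i) ^ d" using R by (intro mult_left_mono) auto
      then show "b ^ i * (R / b ^ i) ^ d \<le> R ^ d"
        using b0 by (simp add: power_divide field_simps)
    qed (use K0 s b0 in auto)
    finally show ?thesis .
  qed
  have "measure \<beta> (bad j m \<inter> sup_ball z (s/8))
      \<le> measure \<beta> (\<Union>i\<in>{..N}. \<Union>p\<in>Z i. tube (\<rho> i) (int_vec p) \<inter> sup_ball z s)"
    using finZ by (intro measure_le_fm sub fmeasurable.finite_UN) auto
  also have "\<dots> \<le> (\<Sum>i\<le>N. measure \<beta> (\<Union>p\<in>Z i. tube (\<rho> i) (int_vec p) \<inter> sup_ball z s))"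
    using finZ by (intro measure_UNION_le) auto
  also have "\<dots> \<le> (\<Sum>i\<le>N. \<Sum>p\<in>Z i. measure \<beta> (tube (\<rho> i) (int_vec p) \<inter> sup_ball z s))"
    using finZ by (intro sum_mono measure_UNION_le) auto
  also have "\<dots> \<le> (\<Sum>i\<le>N. K0 * 2 ^ d * s / b ^ (j * d) * (R ^ d + s ^ d * b ^ i))"
    by (intro sum_mono range_le)
  also have "\<dots> = K0 * 2 ^ d * s / b ^ (j * d) * (R ^ d * (real N + 1) + s ^ d * (\<Sum>i\<le>N. real b ^ i))"
    by (simp only: sum_distrib_left[symmetric] sum.distrib) (simp add: mult.commute add.commute)
  also have "\<dots> \<le> K0 * 2 ^ d * s / b ^ (j * d) * (R ^ d * (2 * (real (j * d) + 1)) + s ^ d * (2 * real b ^ N))"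
  proof (intro mult_left_mono add_mono)
    define M where "M = j * d"
    have "N \<le> M" by (simp add: N_def M_def)
    then show "real N + 1 \<le> 2 * (real (j * d) + 1)" unfolding M_def[symmetric] by simp
    show "(\<Sum>i\<le>N. real b ^ i) \<le> 2 * real b ^ N" by (rule sum_powers_le)
  qed (use K0 s R in auto)
  also have "\<dots> = K0 * 2 ^ d * 2 * s * (R ^ d * (real (j * d) + 1) / b ^ (j * d) + s ^ d * (real b ^ N / b ^ (j * d)))"
    by (simp add: algebra_simps add_divide_distrib)
  also have "real b ^ N / b ^ (j * d) = 1 / b ^ m"
    using m b0 unfolding N_def by (simp add: power_diff)
  finally show "measure \<beta> (bad j m \<inter> sup_ball z (s/8))
     \<le> K0 * 2 ^ d * 2 * s * (sup_norm z ^ d * (real (j * d) + 1) / b ^ (j * d) + s ^ d / b ^ m)"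
    by (simp add: R_def)
qed

end

lemma sup_norm_zero [simp]: "sup_norm 0 = 0"
  by simp

lemma linear_over_power_tendsto_0:
  assumes "b \<ge> (2 :: nat)" "d > 0"
  shows "(\<lambda>j. (real (j * d) + 1) / b ^ (j * d)) \<longlonglongrightarrow> 0"
proof -
  define x where "x = 1 / real b"
  have x: "norm x < 1" using assms by (simp add: x_def)
  have "(\<lambda>N. of_nat N * x ^ N + x ^ N) \<longlonglongrightarrow> 0 + 0"
    using x by (intro tendsto_add powser_times_n_limit_0 LIMSEQ_power_zero)
  then have "(\<lambda>N. (real N + 1) / b ^ N) \<longlonglongrightarrow> 0"
    by (simp add: x_def power_divide add_divide_distrib)
  moreover have "filterlim (\<lambda>j. j * d) at_top sequentially"
    using assms(2) by (intro filterlim_subseq) (auto simp: strict_mono_def)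
  ultimately show ?thesis by (rule filterlim_compose)
qed

context projective_khinchin
begin

lemma measure_origin: "measure \<beta> {0} = 0"
proof -
  have "measure \<beta> {0} \<le> CM * r ^ Suc d" if r: "r > 0" for r
  proof -
    have "measure \<beta> {0} \<le> measure \<beta> (sup_ball 0 r)"
      using r by (intro measure_le_fm) (auto simp: mem_sup_ball sets_eq)
    then show ?thesis using ball_ub[OF r, of 0] by linarith
  qed
  then have ev: "\<forall>\<^sub>F r in at_right 0. measure \<beta> {0} \<le> CM * r ^ Suc d"
    by (auto simp: eventually_at_right_less intro: eventually_mono[OF eventually_at_right_less])
  have lim: "((\<lambda>r. CM * r ^ Suc d) \<longlongrightarrow> CM * 0 ^ Suc d) (at_right 0)"
    by (intro tendsto_intros)
  have "measure \<beta> {0} \<le> CM * 0 ^ Suc d"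
    using tendsto_lowerbound[OF lim ev] by simp
  then show ?thesis by (simp add: measure_le_0_iff)
qed

text \<open>Cones can only be disjoint away from the origin. The lower bound for
  \<open>card S\<close> says that the tubes of radius \<open>\<tau>\<close> fill a fixed proportion
  of the ball, up to the length \<open>s\<close> along the axis. The last clause is stated for all
  thinner tubes because these will replace the tubes of radius \<open>\<tau>\<close>.\<close>

definition separated_family :: "real \<Rightarrow> real \<Rightarrow> 'k ^ 'n \<Rightarrow> real \<Rightarrow> nat \<Rightarrow> (int ^ 'n) set \<Rightarrow> bool" where
  "separated_family c \<tau> z s j S \<longleftrightarrow> \<tau> \<le> 1/2 \<and> S \<subseteq> {p \<in> P. int_height p \<le> CD * b ^ (j * d)} \<and>
     c * s ^ d \<le> real (card S) * (\<tau> * sup_norm z) ^ d \<and>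
     (\<forall>p\<in>S. \<forall>q\<in>S. p \<noteq> q \<longrightarrow> tube \<tau> (int_vec p) \<inter> tube \<tau> (int_vec q) \<subseteq> {0}) \<and>
     (\<forall>p\<in>S. \<forall>\<rho>. 0 < \<rho> \<longrightarrow> \<rho> \<le> \<tau> \<longrightarrow>
        cL * s * (\<rho> * sup_norm z) ^ d \<le> measure \<beta> (tube \<rho> (int_vec p) \<inter> sup_ball z (s/2)))"

text \<open>
  Many well separated rational points: Dirichlet's theorem covers the ball by tubes, those of
  small height are discarded by \<open>bad_measure\<close>, and from the rest one takes a maximal family
  of disjoint tubes.
\<close>

lemma ubiquity:
  obtains CT cN where "CT > 0" "cN > 0"
    "\<And>z s. 0 < s \<Longrightarrow> 4 * s \<le> sup_norm z \<Longrightarrow>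
      \<forall>\<^sub>F j in sequentially. \<exists>S. separated_family cN (CT / real b ^ (j * Suc d)) z s j S"
proof -
  obtain A where A: "A > 0"
    "\<And>z s j m. 0 < s \<Longrightarrow> 4 * s \<le> sup_norm z \<Longrightarrow> m \<le> j * d \<Longrightarrow> CD / b ^ j * (2 * sup_norm z) \<le> s / 4 \<Longrightarrow>
       measure \<beta> (bad j m \<inter> sup_ball z (s/8))
         \<le> A * s * (sup_norm z ^ d * (real (j * d) + 1) / b ^ (j * d) + s ^ d / b ^ m)"
    using bad_measure by blast
  have b0: "real b > 0" and b1: "real b > 1" using b_ge_2 by auto
  \<comment> \<open>The ball of radius \<open>s / 8\<close> has measure at least
    \<open>\<kappa> * s ^ Suc d\<close>. Half of this is conceded to the bad set, the other half
    must be covered by tubes.\<close>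
  define \<kappa> where "\<kappa> = cM / 8 ^ Suc d"
  have \<kappa>: "\<kappa> > 0" using consts_pos by (simp add: \<kappa>_def)
  \<comment> \<open>Makes the second term in \<open>bad_measure\<close> at most a quarter of the
    measure at hand; the first term tends to 0 as \<open>j\<close> grows, see
    \<open>e3\<close>.\<close>
  obtain m where m: "4 * A / \<kappa> < real b ^ m"
    using real_arch_pow[OF b1] by blast
  have m': "A / b ^ m \<le> \<kappa> / 4" using m \<kappa> b0 A(1) by (simp add: field_simps)
  \<comment> \<open>Points of height above \<open>b ^ (j * d - m)\<close> have a Dirichlet radius of
    at most \<open>CD * b ^ m / b ^ (j * Suc d)\<close>.\<close>
  define CT where "CT = CD * real b ^ m"
  have CT: "CT > 0" using consts_pos b0 by (simp add: CT_def)
  \<comment> \<open>The remaining half of \<open>\<kappa>\<close>, divided by the constant for the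
    measure of a tube enlarged 24 times.\<close>
  define cN where "cN = \<kappa> / (2 * CU * 24 ^ d)"
  have cN: "cN > 0" using \<kappa> CU_pos by (simp add: cN_def)
  show ?thesis
  proof (rule that[OF CT cN])
    fix z :: "'k ^ 'n" and s :: real
    assume s: "0 < s" "4 * s \<le> sup_norm z"
    define R where "R = sup_norm z"
    have R: "R > 0" using s unfolding R_def by linarith
    have sR: "4 * s \<le> R" using s by (simp add: R_def)
    have inv_b: "(\<lambda>j. 1 / real b ^ j) \<longlonglongrightarrow> 0"
      using LIMSEQ_power_zero[of "1 / real b"] b1 by (simp add: power_divide)
    have e1: "\<forall>\<^sub>F j in sequentially. m \<le> j * d"
      using eventually_ge_at_top[of m]
    proof eventually_elim
      case (elim j)
      have "j * 1 \<le> j * d" using d_pos by (intro mult_le_mono2) auto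
      then show ?case using elim by linarith
    qed
    have "(\<lambda>j. CD * (2 * R) * (1 / real b ^ j)) \<longlonglongrightarrow> CD * (2 * R) * 0"
      by (intro tendsto_mult_left inv_b)
    then have e2: "\<forall>\<^sub>F j in sequentially. CD * (2 * R) * (1 / real b ^ j) < s / 4"
      using s by (intro order_tendstoD(2)) auto
    have "(\<lambda>j. A * s * R ^ d * ((real (j * d) + 1) / b ^ (j * d))) \<longlonglongrightarrow> A * s * R ^ d * 0"
      by (intro tendsto_mult_left linear_over_power_tendsto_0 b_ge_2 d_pos)
    then have e3: "\<forall>\<^sub>F j in sequentially. A * s * R ^ d * ((real (j * d) + 1) / b ^ (j * d)) < \<kappa> / 4 * s ^ Suc d"
      using s \<kappa> by (intro order_tendstoD(2)) auto
    have "(\<lambda>j. CT * R * (1 / real b ^ j)) \<longlonglongrightarrow> CT * R * 0"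
      by (intro tendsto_mult_left inv_b)
    then have e4: "\<forall>\<^sub>F j in sequentially. CT * R * (1 / real b ^ j) < s / 16"
      using s by (intro order_tendstoD(2)) auto
    show "\<forall>\<^sub>F j in sequentially. \<exists>S. separated_family cN (CT / real b ^ (j * Suc d)) z s j S"
      using e1 e2 e3 e4
    proof eventually_elim
      case (elim j)
      define \<tau> where "\<tau> = CT / real b ^ (j * Suc d)"
      have \<tau>0: "\<tau> > 0" using CT b0 by (simp add: \<tau>_def)
      have "\<tau> \<le> CT / b ^ j"
        unfolding \<tau>_def using CT b1 by (intro divide_left_mono power_increasing) auto
      then have "\<tau> * R \<le> CT / b ^ j * R" using R by (intro mult_right_mono) auto
      moreover have "CT / b ^ j * R = CT * R * (1 / real b ^ j)" by simp
      ultimately have \<tau>R: "\<tau> * R \<le> s / 16" using elim(4) by linarith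
      have "\<tau> * R \<le> 1/2 * R" using \<tau>R sR s by linarith
      then have \<tau>half: "\<tau> \<le> 1/2" using R by (simp only: mult_le_cancel_right_pos)
      define G where "G = sup_ball z (s/8)"
      define Y where "Y = {p \<in> P. int_height p \<le> CD * b ^ (j * d) \<and> (\<exists>x\<in>G. near \<tau> x (int_vec p))}"
      have finY: "finite Y"
        by (rule finite_subset[OF _ finite_P_height[of "CD * b ^ (j * d)"]]) (auto simp: Y_def)
      obtain S where S: "S \<subseteq> Y"
        and disj: "\<And>p q. p \<in> S \<Longrightarrow> q \<in> S \<Longrightarrow> p \<noteq> q \<Longrightarrow>
          \<not> (\<not> tube \<tau> (int_vec p) \<inter> tube \<tau> (int_vec q) \<subseteq> {0})"
        and max: "\<And>p. p \<in> Y \<Longrightarrow> p \<in> S \<or>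
          (\<exists>q\<in>S. \<not> tube \<tau> (int_vec p) \<inter> tube \<tau> (int_vec q) \<subseteq> {0} \<or> \<not> tube \<tau> (int_vec q) \<inter> tube \<tau> (int_vec p) \<subseteq> {0})"
        using finite_maximal_pairwise[OF finY, of "\<lambda>p q. \<not> tube \<tau> (int_vec p) \<inter> tube \<tau> (int_vec q) \<subseteq> {0}"]
        by (auto simp only:)
      have finS: "finite S" using S finY by (rule finite_subset)
      have SP: "p \<in> P" if "p \<in> S" for p using S that by (auto simp: Y_def)
      then have nz: "(int_vec p :: 'k ^ 'n) \<noteq> 0" if "p \<in> S" for p using P_nonzero that by auto
      have lower: "cL * s * (\<rho> * R) ^ d \<le> measure \<beta> (tube \<rho> (int_vec p) \<inter> sup_ball z (s/2))"
        if p: "p \<in> S" and \<rho>: "0 < \<rho>" "\<rho> \<le> \<tau>" for p \<rho>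
      proof -
        obtain x where x: "x \<in> G" "near \<tau> x (int_vec p)" using p S by (auto simp: Y_def)
        have "\<rho> * R \<le> \<tau> * R" using \<rho> R by (intro mult_right_mono) auto
        then have "\<rho> * R \<le> s / 4" using \<tau>R s by linarith
        then show ?thesis unfolding R_def
          using x \<rho> \<tau>R \<tau>0 s nz[OF p] by (intro tube_lb[of _ _ _ x \<tau>]) (auto simp: G_def R_def)
      qed
      \<comment> \<open>A Vitali covering argument: by maximality a tube that was not chosen meets a
        chosen one away from the origin, and hence by \<open>near_trans\<close> lies in the chosen
        tube enlarged by the factor \<open>24 = 8 * 3\<close>.\<close>
      have cover: "G - bad j m - {0} \<subseteq> (\<Union>p\<in>S. tube (24 * \<tau>) (int_vec p) \<inter> sup_ball z s)"
      proof
        fix x assume x: "x \<in> G - bad j m - {0}"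
        then obtain p where p: "p \<in> P" "int_height p \<le> CD * b ^ (j * d)"
            "near (CD / (b ^ j * int_height p)) x (int_vec p)"
          using Dirichlet[of x j] by auto
        have big: "int_height p > b ^ (j * d - m)"
        proof (rule ccontr)
          assume "\<not> ?thesis"
          then have "x \<in> bad j m" using p unfolding bad_def by (auto simp: mem_tube)
          then show False using x by simp
        qed
        have "CD / (b ^ j * int_height p) \<le> CD / (real b ^ j * real b ^ (j * d - m))"
          using big b0 by (intro divide_left_mono mult_left_mono mult_pos_pos)
            (auto intro: less_trans[OF zero_less_power[OF b0]])
        also have "\<dots> = \<tau>"
          using elim(1) b0 by (simp add: \<tau>_def CT_def power_diff power_add)
        finally have near: "near \<tau> x (int_vec p)" using p(3) near_mono by blast
        have pY: "p \<in> Y" using p near x by (auto simp: Y_def)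
        have xs: "x \<in> sup_ball z s" using x s by (simp add: G_def mem_sup_ball)
        show "x \<in> (\<Union>p\<in>S. tube (24 * \<tau>) (int_vec p) \<inter> sup_ball z s)"
        proof (cases "p \<in> S")
          case True
          have "near (24 * \<tau>) x (int_vec p)" using near_mono[OF near] \<tau>0 by simp
          then show ?thesis using True xs by (auto simp: mem_tube)
        next
          case False
          then obtain q where q: "q \<in> S" "\<not> tube \<tau> (int_vec p) \<inter> tube \<tau> (int_vec q) \<subseteq> {0}"
            using max[OF pY] by auto
          from q(2) have "\<exists>u\<in>tube \<tau> (int_vec p) \<inter> tube \<tau> (int_vec q). u \<noteq> 0" by blast
          then obtain u :: "'k ^ 'n" where u: "near \<tau> u (int_vec p)" "near \<tau> u (int_vec q)" "u \<noteq> 0"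
            unfolding mem_tube by (auto simp: mem_tube)
          have "near (8 * (\<tau> + \<tau> + \<tau>)) x (int_vec q)"
            using \<tau>half \<tau>0 nz[OF q(1)] P_nonzero[OF p(1)]
            by (intro near_trans[OF u(2,1,3) near]) auto
          then show ?thesis using q xs by (auto simp: mem_tube)
        qed
      qed
      have zero_sets: "{0} \<in> sets \<beta>" by (intro sets_closed) simp
      have bad_le: "measure \<beta> (bad j m \<inter> G) \<le> \<kappa> / 2 * s ^ Suc d"
      proof -
        have "measure \<beta> (bad j m \<inter> G)
            \<le> A * s * (R ^ d * (real (j * d) + 1) / b ^ (j * d) + s ^ d / b ^ m)"
          unfolding G_def R_def using elim(1,2) s by (intro A(2)) (auto simp: R_def mult_ac)
        also have "\<dots> = A * s * R ^ d * ((real (j * d) + 1) / b ^ (j * d)) + A / b ^ m * s ^ Suc d"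
          by (simp add: algebra_simps)
        also have "\<dots> \<le> \<kappa> / 4 * s ^ Suc d + \<kappa> / 4 * s ^ Suc d"
          using add_mono[OF less_imp_le[OF elim(3)] mult_right_mono[OF m', of "s ^ Suc d"]] s by simp
        finally show ?thesis by simp
      qed
      have "\<kappa> * s ^ Suc d \<le> measure \<beta> G"
        using ball_lb[of "s/8" z] s by (simp add: G_def \<kappa>_def power_divide)
      also have "\<dots> \<le> measure \<beta> ((\<Union>p\<in>S. tube (24 * \<tau>) (int_vec p) \<inter> sup_ball z s) \<union> ((bad j m \<inter> G) \<union> {0}))"
      proof (intro measure_le_fm fmeasurable.Un fmeasurable.finite_UN finS)
        show "G \<subseteq> (\<Union>p\<in>S. tube (24 * \<tau>) (int_vec p) \<inter> sup_ball z s) \<union> ((bad j m \<inter> G) \<union> {0})"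
          using cover by blast
        show "bad j m \<inter> G \<in> fmeasurable \<beta>"
          unfolding G_def by (subst Int_commute) auto
        show "{0} \<in> fmeasurable \<beta>"
          using fmeasurableI2[OF sup_ball_fmeasurable[of 0 1], of "{0}"] zero_sets
          by (auto simp: mem_sup_ball)
      qed (auto simp: G_def)
      also have "\<dots> \<le> measure \<beta> (\<Union>p\<in>S. tube (24 * \<tau>) (int_vec p) \<inter> sup_ball z s)
          + (measure \<beta> (bad j m \<inter> G) + measure \<beta> {0})"
        using finS zero_sets
        by (intro order_trans[OF measure_Un_le] add_mono order_refl sets.Un sets.finite_UN)
          (auto simp: G_def)
      also have "\<dots> \<le> (\<Sum>p\<in>S. measure \<beta> (tube (24 * \<tau>) (int_vec p) \<inter> sup_ball z s)) + (\<kappa> / 2 * s ^ Suc d + 0)"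
        using finS bad_le measure_origin by (intro add_mono measure_UNION_le) auto
      also have "\<dots> \<le> (\<Sum>p\<in>S. CU * s * (24 * \<tau> * R) ^ d) + (\<kappa> / 2 * s ^ Suc d + 0)"
        unfolding R_def using s \<tau>0 nz by (intro add_mono sum_mono tube_ub order_refl) auto
      finally have "\<kappa> / 2 * s ^ Suc d \<le> real (card S) * (CU * s * (24 * \<tau> * R) ^ d)" by simp
      also have "\<dots> = s * (CU * 24 ^ d) * (real (card S) * (\<tau> * R) ^ d)"
        by (simp add: power_mult_distrib)
      finally have "s * (CU * 24 ^ d) * (cN * s ^ d) \<le> s * (CU * 24 ^ d) * (real (card S) * (\<tau> * R) ^ d)"
        using CU_pos by (simp add: cN_def mult.left_commute)
      then have "cN * s ^ d \<le> real (card S) * (\<tau> * R) ^ d"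
        using s CU_pos by (subst (asm) mult_le_cancel_left_pos) auto
      moreover have "S \<subseteq> {p \<in> P. int_height p \<le> CD * b ^ (j * d)}" using S by (auto simp: Y_def)
      ultimately show ?case
        using lower disj \<tau>half unfolding \<tau>_def[symmetric] separated_family_def R_def[symmetric]
        by (intro exI[of _ S]) simp
    qed
  qed
qed

end

section \<open>Second moments: overlaps between different scales\<close>

lemma not_summable_partial_sum_ge:
  fixes a :: "nat \<Rightarrow> real"
  assumes "\<not> summable a" "\<And>j. a j \<ge> 0"
  obtains M where "B \<le> (\<Sum>j\<in>{K..<M}. a j)"
proof -
  have "\<exists>M. B \<le> (\<Sum>j\<in>{K..<M}. a j)"
  proof (rule ccontr)
    assume "\<not> ?thesis"
    then have lt: "(\<Sum>j\<in>{K..<M}. a j) < B" for M by (meson not_le)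
    have "summable (\<lambda>j. a (j + K))"
    proof (rule summableI_nonneg_bounded)
      fix n
      have "(\<Sum>i<n. a (i + K)) = (\<Sum>j\<in>{K..<n + K}. a j)"
        using sum.shift_bounds_nat_ivl[of a 0 K n] by (simp add: atLeast0LessThan)
      then show "(\<Sum>i<n. a (i + K)) \<le> B" using lt[of "n + K"] by simp
    qed (use assms(2) in auto)
    then show False using assms(1) by (simp add: summable_iff_shift)
  qed
  then show ?thesis using that by blast
qed

lemma sum_half_powers_le: "(\<Sum>j\<le>l. (1/2 :: real) ^ (l - j)) \<le> 2"
proof (induction l)
  case (Suc l)
  have "(\<Sum>j\<le>Suc l. (1/2 :: real) ^ (Suc l - j)) = (\<Sum>j\<le>l. (1/2) ^ (Suc l - j)) + 1" by simp
  also have "(\<Sum>j\<le>l. (1/2 :: real) ^ (Suc l - j)) = (\<Sum>j\<le>l. 1/2 * (1/2) ^ (l - j))"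
    by (intro sum.cong) (auto simp: Suc_diff_le)
  also have "\<dots> = 1/2 * (\<Sum>j\<le>l. (1/2) ^ (l - j))" by (simp only: sum_distrib_left)
  finally show ?case using Suc by simp
qed simp

text \<open>Errors that decay geometrically in the gap between two scales contribute only a linear
  amount, which the square of a large sum absorbs.\<close>

lemma double_sum_half_powers_le:
  fixes a :: "nat \<Rightarrow> real"
  assumes "\<And>j. a j \<ge> 0" "finite J"
  shows "(\<Sum>j\<in>J. \<Sum>l\<in>J. if j \<le> l then a l * (1/2) ^ (l - j) else 0) \<le> 2 * (\<Sum>l\<in>J. a l)"
proof -
  have "(\<Sum>j\<in>J. \<Sum>l\<in>J. if j \<le> l then a l * (1/2) ^ (l - j) else 0)
      = (\<Sum>l\<in>J. \<Sum>j\<in>J. if j \<le> l then a l * (1/2) ^ (l - j) else 0)"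
    by (rule sum.swap)
  also have "\<dots> \<le> (\<Sum>l\<in>J. 2 * a l)"
  proof (rule sum_mono)
    fix l
    have "(\<Sum>j\<in>J. if j \<le> l then a l * (1/2) ^ (l - j) else 0)
        = (\<Sum>j\<in>J \<inter> {..l}. a l * (1/2) ^ (l - j))"
      using assms(2) by (subst sum.inter_restrict) auto
    also have "\<dots> \<le> (\<Sum>j\<le>l. a l * (1/2) ^ (l - j))"
      using assms by (intro sum_mono2) auto
    also have "\<dots> = a l * (\<Sum>j\<le>l. (1/2) ^ (l - j))" by (simp only: sum_distrib_left)
    also have "\<dots> \<le> a l * 2" using assms sum_half_powers_le by (intro mult_left_mono) auto
    finally show "(\<Sum>j\<in>J. if j \<le> l then a l * (1/2) ^ (l - j) else 0) \<le> 2 * a l" by simp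
  qed
  finally show ?thesis by (simp add: sum_distrib_left)
qed

context projective_khinchin
begin

text \<open>All points up to the height of scale \<open>j\<close> are used and not a separated
  selection: a selection depends on the ball considered, whereas these sets have to serve all balls
  at once.\<close>

definition approx_set :: "(nat \<Rightarrow> real) \<Rightarrow> nat \<Rightarrow> ('k ^ 'n) set" where
  "approx_set \<rho> j = (\<Union>p\<in>{p \<in> P. int_height p \<le> CD * b ^ (j * d)}. tube (\<rho> j) (int_vec p))"

lemma closed_approx_set: "closed (approx_set \<rho> j)"
  unfolding approx_set_def by (intro closed_UN finite_P_height ballI closed_tube)

lemma measure_disjoint_tubes:
  assumes "finite S" "\<And>p q. p \<in> S \<Longrightarrow> q \<in> S \<Longrightarrow> p \<noteq> q \<Longrightarrow> tube \<tau> (int_vec p) \<inter> tube \<tau> (int_vec q) \<subseteq> {0}"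
    and "\<rho> \<le> \<tau>" "s < sup_norm z"
  shows "measure \<beta> (\<Union>p\<in>S. tube \<rho> (int_vec p) \<inter> sup_ball z s)
    = (\<Sum>p\<in>S. measure \<beta> (tube \<rho> (int_vec p) \<inter> sup_ball z s))"
proof (rule measure_UNION')
  show "pairwise (\<lambda>p q. disjnt (tube \<rho> (int_vec p) \<inter> sup_ball z s) (tube \<rho> (int_vec q) \<inter> sup_ball z s)) S"
  proof (rule pairwiseI, unfold disjnt_def, rule ccontr)
    fix p q assume pq: "p \<in> S" "q \<in> S" "p \<noteq> q"
      and "\<not> (tube \<rho> (int_vec p) \<inter> sup_ball z s) \<inter> (tube \<rho> (int_vec q) \<inter> sup_ball z s) = {}"
    then obtain x where x: "near \<rho> x (int_vec p)" "near \<rho> x (int_vec q)" "x \<in> sup_ball z s"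
      by (auto simp: mem_tube)
    then have "near \<tau> x (int_vec p)" "near \<tau> x (int_vec q)"
      using near_mono assms(3) by blast+
    then have "x = 0" using assms(2)[OF pq] by (auto simp: mem_tube)
    then show False using x(3) assms(4) by (simp add: mem_sup_ball)
  qed
qed (use assms(1) in auto)

text \<open>Second moment method inside one ball. With \<open>a j\<close> the ratio of
  \<open>\<rho> j\<close> to the radius of scale \<open>j\<close>, raised to the power
  \<open>d\<close>, the separated tubes shrunk to radius \<open>\<rho> j\<close> have measure
  comparable to \<open>a j * s ^ Suc d\<close>, and overlaps at scales \<open>j < l\<close> are at
  most of order \<open>(a j * a l + a l * (1/2) ^ (l - j)) * s ^ Suc d\<close>. It is essential that
  \<open>c\<close> depends neither on the ball nor on \<open>K\<close> nor on
  \<open>\<rho>\<close>.\<close>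

lemma local_lower_bound:
  obtains CT c where "CT > 0" "c > 0"
    "\<And>\<rho> z s K. (\<And>j. 0 < \<rho> j) \<Longrightarrow> (\<And>j. \<rho> j \<le> CT / real b ^ (j * Suc d)) \<Longrightarrow>
       \<not> summable (\<lambda>j. (\<rho> j / (CT / real b ^ (j * Suc d))) ^ d) \<Longrightarrow> 0 < s \<Longrightarrow> 4 * s \<le> sup_norm z \<Longrightarrow>
       c * s ^ Suc d \<le> measure \<beta> (sup_ball z (s/2) \<inter> (\<Union>j\<in>{K..}. approx_set \<rho> j))"
proof (rule ubiquity)
  fix CT cN :: real
  assume CT: "CT > 0" and cN: "cN > 0"
    and ubi: "\<And>z s. 0 < s \<Longrightarrow> 4 * s \<le> sup_norm z \<Longrightarrow>
      \<forall>\<^sub>F j in sequentially. \<exists>S. separated_family cN (CT / real b ^ (j * Suc d)) z s j S"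
  have b0: "real b > 0" and b1: "real b \<ge> 1" using b_ge_2 by auto
  \<comment> \<open>\<open>X\<close> controls the number of tubes at one scale, \<open>Y\<close> the
    number of finer tubes meeting a coarser one, and \<open>W\<close> the overlaps. The 5 in
    \<open>c\<close> is 1 + 2 + 2, from the products \<open>a j * a l\<close> and the two geometric
    sums.\<close>
  define X where "X = CM / cL"
  define Y where "Y = CU * 32 ^ d / cL"
  define W where "W = CU * X + Y * CU * X"
  define c where "c = (cL * cN)\<^sup>2 / (5 * W)"
  have X: "X > 0" and Y: "Y > 0" using consts_pos cL_pos CU_pos by (auto simp: X_def Y_def)
  have W: "W > 0" unfolding W_def using X Y CU_pos by (intro add_pos_pos mult_pos_pos)
  have c: "c > 0" using W cL_pos cN by (simp add: c_def)
  show thesis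
  proof (rule that[OF CT c])
    fix \<rho> :: "nat \<Rightarrow> real" and z :: "'k ^ 'n" and s :: real and K :: nat
    assume \<rho>: "\<And>j. 0 < \<rho> j" "\<And>j. \<rho> j \<le> CT / real b ^ (j * Suc d)"
      and div: "\<not> summable (\<lambda>j. (\<rho> j / (CT / real b ^ (j * Suc d))) ^ d)"
      and s: "0 < s" "4 * s \<le> sup_norm z"
    define R where "R = sup_norm z"
    have R: "R > 0" "4 * s \<le> R" using s unfolding R_def by linarith+
    define \<tau> where "\<tau> j = CT / real b ^ (j * Suc d)" for j
    have \<tau>0: "\<tau> j > 0" for j using CT b0 by (simp add: \<tau>_def)
    have \<rho>\<tau>: "\<rho> j \<le> \<tau> j" for j using \<rho>(2) by (simp add: \<tau>_def)
    define a where "a j = (\<rho> j / \<tau> j) ^ d" for j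
    have a0: "a j \<ge> 0" for j unfolding a_def using \<rho>(1)[of j] \<tau>0[of j] by simp
    have \<rho>d: "\<rho> j ^ d = a j * \<tau> j ^ d" for j
      using \<tau>0[of j] by (simp add: a_def power_divide)
    define Q where "Q j = separated_family cN (\<tau> j) z s j" for j
    have "\<forall>\<^sub>F j in sequentially. \<exists>S. Q j S"
      unfolding Q_def \<tau>_def by (rule ubi[OF s])
    then obtain j0 where j0: "\<And>j. j \<ge> j0 \<Longrightarrow> \<exists>S. Q j S"
      by (auto simp: eventually_sequentially)
    define S where "S j = (SOME S. Q j S)" for j
    have QS: "Q j (S j)" if "j \<ge> j0" for j
      unfolding S_def using j0[OF that] by (rule someI_ex)
    note QS' = QS[unfolded Q_def separated_family_def R_def[symmetric]]
    have SP: "S j \<subseteq> {p \<in> P. int_height p \<le> CD * b ^ (j * d)}" and \<tau>_half: "\<tau> j \<le> 1/2"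
      and S_card: "cN * s ^ d \<le> real (card (S j)) * (\<tau> j * R) ^ d" if "j \<ge> j0" for j
      using QS'[OF that] by simp_all
    have finS: "finite (S j)" if "j \<ge> j0" for j
      using SP[OF that] finite_P_height by (rule finite_subset)
    have nz: "(int_vec p :: 'k ^ 'n) \<noteq> 0" if "p \<in> S j" "j \<ge> j0" for p j
      using SP[OF that(2)] that(1) P_nonzero by auto
    have S_lb: "cL * s * (r * R) ^ d \<le> measure \<beta> (tube r (int_vec p) \<inter> sup_ball z (s/2))"
      if "j \<ge> j0" "p \<in> S j" "0 < r" "r \<le> \<tau> j" for j p r
      using QS'[OF that(1)] that(2-) by simp
    have S_disj: "tube (\<tau> j) (int_vec p) \<inter> tube (\<tau> j) (int_vec q) \<subseteq> {0}"
      if "j \<ge> j0" "p \<in> S j" "q \<in> S j" "p \<noteq> q" for j p q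
      using QS'[OF that(1)] that(2-) by simp
    have meas_disj: "measure \<beta> (\<Union>p\<in>S'. tube r (int_vec p) \<inter> sup_ball z (s/2))
        = (\<Sum>p\<in>S'. measure \<beta> (tube r (int_vec p) \<inter> sup_ball z (s/2)))"
      if "j \<ge> j0" "S' \<subseteq> S j" "r \<le> \<tau> j" for j S' r
    proof (rule measure_disjoint_tubes[of S' "\<tau> j"])
      show "finite S'" using that finS by (auto intro: finite_subset)
      show "s / 2 < sup_norm z" using s by linarith
    qed (use that S_disj in blast)+
    \<comment> \<open>Packing: the tubes are disjoint in the ball and each has at least the measure
      given by \<open>cL\<close>.\<close>
    have S_card_ub: "real (card (S j)) * (\<tau> j * R) ^ d \<le> X * s ^ d" if j: "j \<ge> j0" for j
    proof -
      have "real (card (S j)) * (cL * s * (\<tau> j * R) ^ d) = (\<Sum>p\<in>S j. cL * s * (\<tau> j * R) ^ d)" by simp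
      also have "\<dots> \<le> (\<Sum>p\<in>S j. measure \<beta> (tube (\<tau> j) (int_vec p) \<inter> sup_ball z (s/2)))"
        using S_lb[OF j] \<tau>0 by (intro sum_mono) auto
      also have "\<dots> = measure \<beta> (\<Union>p\<in>S j. tube (\<tau> j) (int_vec p) \<inter> sup_ball z (s/2))"
        using meas_disj[OF j, of "S j" "\<tau> j"] by simp
      also have "\<dots> \<le> measure \<beta> (sup_ball z s)"
        using s finS[OF j] by (intro measure_le_fm) (auto simp: mem_sup_ball)
      also have "\<dots> \<le> CM * s ^ Suc d" using ball_ub s by simp
      finally have "s * cL * (real (card (S j)) * (\<tau> j * R) ^ d) \<le> s * cL * (X * s ^ d)"
        using cL_pos by (simp add: X_def mult_ac)
      then show ?thesis using s cL_pos by (subst (asm) mult_le_cancel_left_pos) auto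
    qed
    define A where "A j = (\<Union>p\<in>S j. tube (\<rho> j) (int_vec p) \<inter> sup_ball z (s/2))" for j
    have As: "A j \<in> sets \<beta>" if "j \<ge> j0" for j
      unfolding A_def using finS[OF that] by (intro sets.finite_UN) auto
    have Asub: "A j \<subseteq> sup_ball z (s/2)" for j by (auto simp: A_def)
    have Afin: "emeasure \<beta> (A j) < \<infinity>" for j
      using emeasure_mono[OF Asub[of j]] emeasure_ball[of z "s/2"] by (auto intro: le_less_trans)
    have A_lb: "cL * cN * s ^ Suc d * a j \<le> measure \<beta> (A j)" if j: "j \<ge> j0" for j
    proof -
      have "cL * cN * s ^ Suc d * a j = cL * s * a j * (cN * s ^ d)" by simp
      also have "\<dots> \<le> cL * s * a j * (real (card (S j)) * (\<tau> j * R) ^ d)"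
        using S_card[OF j] cL_pos s a0 by (intro mult_left_mono) auto
      also have "\<dots> = (\<Sum>p\<in>S j. cL * s * (\<rho> j * R) ^ d)"
        by (simp add: power_mult_distrib \<rho>d)
      also have "\<dots> \<le> (\<Sum>p\<in>S j. measure \<beta> (tube (\<rho> j) (int_vec p) \<inter> sup_ball z (s/2)))"
        using S_lb[OF j] \<rho>(1) \<rho>\<tau> by (intro sum_mono) auto
      also have "\<dots> = measure \<beta> (A j)"
        unfolding A_def using meas_disj[OF j, of "S j" "\<rho> j"] \<rho>\<tau> by simp
      finally show ?thesis .
    qed
    have tube_ball: "measure \<beta> (tube r (int_vec p) \<inter> sup_ball z (s/2)) \<le> CU * s * (r * R) ^ d"
      if "j \<ge> j0" "p \<in> S j" "r > 0" for j p r
    proof -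
      have "measure \<beta> (tube r (int_vec p) \<inter> sup_ball z (s/2)) \<le> measure \<beta> (tube r (int_vec p) \<inter> sup_ball z s)"
        using s by (intro measure_le_fm) (auto simp: mem_sup_ball)
      also have "\<dots> \<le> CU * s * (r * R) ^ d"
        unfolding R_def using that s nz by (intro tube_ub) auto
      finally show ?thesis .
    qed
    have A_ub: "measure \<beta> (A j) \<le> CU * X * s ^ Suc d * a j" if j: "j \<ge> j0" for j
    proof -
      have "measure \<beta> (A j) \<le> (\<Sum>p\<in>S j. measure \<beta> (tube (\<rho> j) (int_vec p) \<inter> sup_ball z (s/2)))"
        unfolding A_def using finS[OF j] by (intro measure_UNION_le) auto
      also have "\<dots> \<le> (\<Sum>p\<in>S j. CU * s * (\<rho> j * R) ^ d)"
        using tube_ball[OF j] \<rho>(1) by (intro sum_mono) auto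
      also have "\<dots> = CU * s * a j * (real (card (S j)) * (\<tau> j * R) ^ d)"
        by (simp add: power_mult_distrib \<rho>d)
      also have "\<dots> \<le> CU * s * a j * (X * s ^ d)"
        using S_card_ub[OF j] CU_pos s a0 by (intro mult_left_mono) auto
      finally show ?thesis by (simp add: mult_ac)
    qed
    \<comment> \<open>Counts the finer tubes meeting a coarser one. Their number is proportional to
      the volume of the coarser tube once this is wider than the spacing at scale \<open>l\<close>,
      which yields \<open>a j * a l\<close>. The other term covers tubes thinner than that spacing
      and decays since \<open>\<tau> l\<close> is geometrically smaller than
      \<open>\<tau> j\<close>.\<close>
    have overlap: "measure \<beta> (A j \<inter> A l) \<le> Y * CU * X * s ^ Suc d * (a j * a l + a l * (1/2) ^ (l - j))"
      if j: "j \<ge> j0" and jl: "j < l" for j l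
    proof -
      have l: "l \<ge> j0" using j jl by simp
      define T where "T p = {q \<in> S l. \<exists>x. x \<noteq> 0 \<and> near (\<rho> j) x (int_vec p) \<and>
          near (\<rho> l) x (int_vec q :: 'k ^ 'n)}" for p
      have TS: "T p \<subseteq> S l" for p by (auto simp: T_def)
      have finT: "finite (T p)" for p using TS finS[OF l] by (rule finite_subset)
      \<comment> \<open>The tubes of full radius \<open>\<tau> l\<close> about the points of
        \<open>T p\<close> are still disjoint and by \<open>near_trans\<close> lie in one tube of
        radius \<open>\<sigma>\<close> about \<open>p\<close>; their volumes are compared.\<close>
      have cardT: "real (card (T p)) * \<tau> l ^ d \<le> Y * (\<rho> j ^ d + \<tau> l ^ d)" if p: "p \<in> S j" for p
      proof -
        define \<sigma> where "\<sigma> = 8 * (\<rho> j + \<rho> l + \<tau> l)"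
        have \<sigma>: "\<sigma> > 0" using \<rho>(1)[of j] \<rho>(1)[of l] \<tau>0[of l] by (simp add: \<sigma>_def)
        have "real (card (T p)) * (cL * s * (\<tau> l * R) ^ d) = (\<Sum>q\<in>T p. cL * s * (\<tau> l * R) ^ d)" by simp
        also have "\<dots> \<le> (\<Sum>q\<in>T p. measure \<beta> (tube (\<tau> l) (int_vec q) \<inter> sup_ball z (s/2)))"
          by (intro sum_mono S_lb[OF l] subsetD[OF TS] \<tau>0 order_refl)
        also have "\<dots> = measure \<beta> (\<Union>q\<in>T p. tube (\<tau> l) (int_vec q) \<inter> sup_ball z (s/2))"
          using meas_disj[OF l TS, of "\<tau> l"] by simp
        also have "\<dots> \<le> measure \<beta> (tube \<sigma> (int_vec p) \<inter> sup_ball z (s/2))"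
        proof (rule measure_le_fm)
          show "(\<Union>q\<in>T p. tube (\<tau> l) (int_vec q) \<inter> sup_ball z (s/2)) \<subseteq> tube \<sigma> (int_vec p) \<inter> sup_ball z (s/2)"
          proof
            fix u assume "u \<in> (\<Union>q\<in>T p. tube (\<tau> l) (int_vec q) \<inter> sup_ball z (s/2))"
            then obtain q where q: "q \<in> T p" "near (\<tau> l) u (int_vec q)" "u \<in> sup_ball z (s/2)"
              by (auto simp: mem_tube)
            then obtain x where x: "x \<noteq> 0" "near (\<rho> j) x (int_vec p)" "near (\<rho> l) x (int_vec q :: 'k ^ 'n)"
              by (auto simp: T_def)
            have "near \<sigma> u (int_vec p)"
              unfolding \<sigma>_def
              using nz[OF p j] nz[OF _ l, of q] q(1) TS \<tau>_half[OF l] \<rho>\<tau>[of l] \<rho>(1)[of j] \<rho>(1)[of l] \<tau>0[of l]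
              by (intro near_trans[OF x(2,3,1) q(2)]) (auto simp del: int_vec_eq_0_iff)
            then show "u \<in> tube \<sigma> (int_vec p) \<inter> sup_ball z (s/2)" using q by (simp add: mem_tube)
          qed
        qed (use finT in auto)
        also have "\<dots> \<le> CU * s * (\<sigma> * R) ^ d" by (rule tube_ball[OF j p \<sigma>])
        also have "\<dots> \<le> CU * s * (16 * (\<rho> j + \<tau> l) * R) ^ d"
          using \<sigma> R CU_pos s \<rho>\<tau>[of l] \<rho>(1)[of j] \<rho>(1)[of l]
          by (intro mult_left_mono power_mono mult_right_mono) (auto simp: \<sigma>_def)
        also have "\<dots> = CU * s * 16 ^ d * R ^ d * (\<rho> j + \<tau> l) ^ d"
          by (simp only: power_mult_distrib mult_ac)
        also have "\<dots> \<le> CU * s * 16 ^ d * R ^ d * (2 ^ d * (\<rho> j ^ d + \<tau> l ^ d))"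
          using R CU_pos s \<rho>(1)[of j] \<tau>0[of l] by (intro mult_left_mono power_add_le_real) auto
        also have "\<dots> = CU * 32 ^ d * (s * R ^ d * (\<rho> j ^ d + \<tau> l ^ d))"
        proof -
          have "(32::real) ^ d = 16 ^ d * 2 ^ d" by (simp flip: power_mult_distrib)
          then show ?thesis by simp
        qed
        finally have "(cL * s * R ^ d) * (real (card (T p)) * \<tau> l ^ d) \<le> (cL * s * R ^ d) * (Y * (\<rho> j ^ d + \<tau> l ^ d))"
          using cL_pos by (simp add: Y_def power_mult_distrib mult_ac)
        then show ?thesis using s cL_pos R by (subst (asm) mult_le_cancel_left_pos) auto
      qed
      have \<tau>l: "\<tau> l ^ d \<le> \<tau> j ^ d * (1/2) ^ (l - j)"
      proof -
        have "\<tau> l = \<tau> j * (1 / real b ^ ((l - j) * Suc d))"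
        proof -
          have "l * Suc d = j * Suc d + (l - j) * Suc d"
            using jl by (simp flip: add_mult_distrib)
          then show ?thesis by (simp only: \<tau>_def power_add) simp
        qed
        then have "\<tau> l ^ d = \<tau> j ^ d * (1 / real b ^ ((l - j) * Suc d)) ^ d" by (simp only: power_mult_distrib)
        also have "(1 / real b ^ ((l - j) * Suc d)) ^ d = 1 / real b ^ ((l - j) * Suc d * d)"
          by (simp add: power_divide flip: power_mult)
        also have "\<dots> \<le> 1 / 2 ^ (l - j)"
        proof (rule divide_left_mono)
          have "(2::real) ^ (l - j) \<le> real b ^ (l - j)" using b_ge_2 by (intro power_mono) auto
          also have "\<dots> \<le> real b ^ ((l - j) * Suc d * d)"
          proof (rule power_increasing[OF _ b1])
            have "(l - j) * (1 * 1) \<le> (l - j) * (Suc d * d)" using d_pos by (intro mult_le_mono) auto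
            then show "l - j \<le> (l - j) * Suc d * d" by (simp only: mult.assoc mult_1_right)
          qed
          finally show "(2::real) ^ (l - j) \<le> real b ^ ((l - j) * Suc d * d)" .
        qed (use b0 in auto)
        also have "1 / 2 ^ (l - j) = (1/2 :: real) ^ (l - j)" by (simp add: power_divide)
        finally show ?thesis using \<tau>0[of j] by (simp add: mult_left_mono)
      qed
      have "A j \<inter> A l \<subseteq> (\<Union>p\<in>S j. \<Union>q\<in>T p. tube (\<rho> l) (int_vec q) \<inter> sup_ball z (s/2))"
      proof
        fix x assume x: "x \<in> A j \<inter> A l"
        then obtain p q where pq: "p \<in> S j" "q \<in> S l" "near (\<rho> j) x (int_vec p)" "near (\<rho> l) x (int_vec q)"
          and xs: "x \<in> sup_ball z (s/2)" by (auto simp: A_def mem_tube)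
        have "x \<noteq> 0" using xs s by (auto simp: mem_sup_ball)
        then have "q \<in> T p" using pq by (auto simp: T_def)
        then show "x \<in> (\<Union>p\<in>S j. \<Union>q\<in>T p. tube (\<rho> l) (int_vec q) \<inter> sup_ball z (s/2))"
          using pq xs by (auto simp: mem_tube)
      qed
      then have "measure \<beta> (A j \<inter> A l)
          \<le> measure \<beta> (\<Union>p\<in>S j. \<Union>q\<in>T p. tube (\<rho> l) (int_vec q) \<inter> sup_ball z (s/2))"
        using As[OF j] As[OF l] finS[OF j] finT by (intro measure_le_fm fmeasurable.finite_UN) auto
      also have "\<dots> \<le> (\<Sum>p\<in>S j. \<Sum>q\<in>T p. measure \<beta> (tube (\<rho> l) (int_vec q) \<inter> sup_ball z (s/2)))"
        using finS[OF j] finT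
        by (intro order_trans[OF measure_UNION_le] sum_mono measure_UNION_le) auto
      also have "\<dots> \<le> (\<Sum>p\<in>S j. \<Sum>q\<in>T p. CU * s * (\<rho> l * R) ^ d)"
        using tube_ball[OF l] TS \<rho>(1) by (intro sum_mono) blast
      also have "\<dots> = (\<Sum>p\<in>S j. real (card (T p)) * \<tau> l ^ d * (CU * s * a l * R ^ d))"
        by (simp add: power_mult_distrib \<rho>d mult_ac)
      also have "\<dots> \<le> (\<Sum>p\<in>S j. Y * (\<tau> j ^ d * (a j + (1/2) ^ (l - j))) * (CU * s * a l * R ^ d))"
      proof (intro sum_mono mult_right_mono)
        fix p assume "p \<in> S j"
        then have "real (card (T p)) * \<tau> l ^ d \<le> Y * (\<rho> j ^ d + \<tau> l ^ d)" by (rule cardT)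
        also have "\<dots> \<le> Y * (a j * \<tau> j ^ d + \<tau> j ^ d * (1/2) ^ (l - j))"
          unfolding \<rho>d using Y \<tau>l by (intro mult_left_mono add_left_mono) auto
        finally show "real (card (T p)) * \<tau> l ^ d \<le> Y * (\<tau> j ^ d * (a j + (1/2) ^ (l - j)))"
          by (simp add: algebra_simps)
      qed (use CU_pos s a0 R in auto)
      also have "\<dots> = Y * CU * s * a l * (a j + (1/2) ^ (l - j)) * (real (card (S j)) * (\<tau> j * R) ^ d)"
        by (simp add: power_mult_distrib)
      also have "\<dots> \<le> Y * CU * s * a l * (a j + (1/2) ^ (l - j)) * (X * s ^ d)"
        using S_card_ub[OF j] Y CU_pos s a0 by (intro mult_left_mono) auto
      also have "\<dots> = Y * CU * X * s ^ Suc d * (a j * a l + a l * (1/2) ^ (l - j))"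
        by (simp add: algebra_simps)
      finally show ?thesis .
    qed
    \<comment> \<open>The diagonal is included with \<open>h j j = a j\<close>: there the overlap is
      \<open>A j\<close> itself.\<close>
    define h where "h j l = (if j \<le> l then a l * (1/2) ^ (l - j) else 0)" for j l :: nat
    have h0: "h j l \<ge> 0" for j l using a0 by (simp add: h_def)
    have pair: "measure \<beta> (A j \<inter> A l) \<le> W * s ^ Suc d * (a j * a l + h j l + h l j)"
      if j: "j \<ge> j0" and l: "l \<ge> j0" for j l
    proof -
      have WY: "Y * CU * X \<le> W" "CU * X \<le> W" using X Y CU_pos by (auto simp: W_def)
      consider "j < l" | "l < j" | "j = l" by linarith
      then show ?thesis
      proof cases
        case 1
        have "measure \<beta> (A j \<inter> A l) \<le> Y * CU * X * s ^ Suc d * (a j * a l + h j l)"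
          using overlap[OF j 1] 1 by (simp add: h_def)
        also have "\<dots> \<le> W * s ^ Suc d * (a j * a l + h j l + h l j)"
          using WY W s a0 h0 X Y CU_pos by (intro mult_mono) auto
        finally show ?thesis .
      next
        case 2
        have "measure \<beta> (A j \<inter> A l) \<le> Y * CU * X * s ^ Suc d * (a j * a l + h l j)"
          using overlap[OF l 2] 2 by (simp add: h_def Int_commute mult.commute[of "a j" "a l"])
        also have "\<dots> \<le> W * s ^ Suc d * (a j * a l + h j l + h l j)"
          using WY W s a0 h0 X Y CU_pos by (intro mult_mono) auto
        finally show ?thesis .
      next
        case 3
        have "measure \<beta> (A j \<inter> A l) \<le> CU * X * s ^ Suc d * h j l"
          using A_ub[OF j] 3 by (simp add: h_def)
        also have "\<dots> \<le> W * s ^ Suc d * (a j * a l + h j l + h l j)"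
          using WY W s a0 h0 X Y CU_pos by (intro mult_mono) auto
        finally show ?thesis .
      qed
    qed
    have nsum: "\<not> summable a" using div by (simp add: a_def[abs_def] \<tau>_def)
    define K' where "K' = max K j0"
    \<comment> \<open>A total of at least 1 makes \<open>\<Sigma>\<close> at most
      \<open>\<Sigma> * \<Sigma>\<close>, so the linear error is absorbed by the main term.\<close>
    obtain M where M: "1 \<le> (\<Sum>j\<in>{K'..<M}. a j)"
      using not_summable_partial_sum_ge[OF nsum a0] .
    define J where "J = {K'..<M}"
    define \<Sigma> where "\<Sigma> = (\<Sum>j\<in>J. a j)"
    have \<Sigma>: "\<Sigma> \<ge> 1" using M by (simp add: \<Sigma>_def J_def)
    have J: "finite J" "\<And>j. j \<in> J \<Longrightarrow> j \<ge> j0" "\<And>j. j \<in> J \<Longrightarrow> j \<ge> K"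
      by (auto simp: J_def K'_def)
    have "(\<Sum>j\<in>J. \<Sum>l\<in>J. measure \<beta> (A j \<inter> A l)) \<le> (\<Sum>j\<in>J. \<Sum>l\<in>J. W * s ^ Suc d * (a j * a l + h j l + h l j))"
      using J pair by (intro sum_mono) auto
    also have "\<dots> = W * s ^ Suc d * ((\<Sum>j\<in>J. \<Sum>l\<in>J. a j * a l) + (\<Sum>j\<in>J. \<Sum>l\<in>J. h j l) + (\<Sum>j\<in>J. \<Sum>l\<in>J. h l j))"
      by (simp only: sum_distrib_left[symmetric] sum.distrib)
    also have "(\<Sum>j\<in>J. \<Sum>l\<in>J. a j * a l) = \<Sigma> * \<Sigma>"
      by (simp add: \<Sigma>_def sum_product)
    also have "(\<Sum>j\<in>J. \<Sum>l\<in>J. h l j) = (\<Sum>j\<in>J. \<Sum>l\<in>J. h j l)" by (rule sum.swap)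
    also have "W * s ^ Suc d * (\<Sigma> * \<Sigma> + (\<Sum>j\<in>J. \<Sum>l\<in>J. h j l) + (\<Sum>j\<in>J. \<Sum>l\<in>J. h j l))
        \<le> W * s ^ Suc d * (\<Sigma> * \<Sigma> + 2 * \<Sigma> + 2 * \<Sigma>)"
      unfolding h_def \<Sigma>_def using W s a0 J
      by (intro mult_left_mono add_mono double_sum_half_powers_le order_refl) auto
    also have "\<dots> \<le> W * s ^ Suc d * (5 * (\<Sigma> * \<Sigma>))"
    proof (intro mult_left_mono)
      have "1 * \<Sigma> \<le> \<Sigma> * \<Sigma>" using \<Sigma> by (intro mult_right_mono) auto
      then show "\<Sigma> * \<Sigma> + 2 * \<Sigma> + 2 * \<Sigma> \<le> 5 * (\<Sigma> * \<Sigma>)" by linarith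
    qed (use W s in auto)
    finally have T: "(\<Sum>j\<in>J. \<Sum>l\<in>J. measure \<beta> (A j \<inter> A l)) \<le> 5 * W * s ^ Suc d * \<Sigma>\<^sup>2"
      by (simp add: power2_eq_square mult_ac)
    define U where "U = measure \<beta> (\<Union>j\<in>J. A j)"
    have "cL * cN * s ^ Suc d * \<Sigma> \<le> (\<Sum>j\<in>J. measure \<beta> (A j))"
      unfolding \<Sigma>_def sum_distrib_left using A_lb J by (intro sum_mono) auto
    then have "(cL * cN * s ^ Suc d * \<Sigma>)\<^sup>2 \<le> (\<Sum>j\<in>J. measure \<beta> (A j))\<^sup>2"
      using cL_pos cN s \<Sigma> by (intro power_mono) auto
    also have "\<dots> \<le> U * (\<Sum>j\<in>J. \<Sum>l\<in>J. measure \<beta> (A j \<inter> A l))"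
      unfolding U_def using J As Afin by (intro Chung_Erdos) auto
    also have "\<dots> \<le> U * (5 * W * s ^ Suc d * \<Sigma>\<^sup>2)"
      using T by (intro mult_left_mono) (auto simp: U_def)
    finally have "(5 * W * s ^ Suc d * \<Sigma>\<^sup>2) * (c * s ^ Suc d) \<le> (5 * W * s ^ Suc d * \<Sigma>\<^sup>2) * U"
      using W by (simp add: c_def power_mult_distrib power2_eq_square mult_ac)
    then have "c * s ^ Suc d \<le> U"
      using W s \<Sigma> by (subst (asm) mult_le_cancel_left_pos) auto
    also have "U \<le> measure \<beta> (sup_ball z (s/2) \<inter> (\<Union>j\<in>{K..}. approx_set \<rho> j))"
      unfolding U_def
    proof (rule measure_le_fm)
      show "(\<Union>j\<in>J. A j) \<subseteq> sup_ball z (s/2) \<inter> (\<Union>j\<in>{K..}. approx_set \<rho> j)"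
      proof
        fix x assume "x \<in> (\<Union>j\<in>J. A j)"
        then obtain j p where j: "j \<in> J" and p: "p \<in> S j" "x \<in> tube (\<rho> j) (int_vec p)" "x \<in> sup_ball z (s/2)"
          by (auto simp: A_def)
        have "x \<in> approx_set \<rho> j"
          unfolding approx_set_def using SP[OF J(2)[OF j]] p by blast
        then show "x \<in> sup_ball z (s/2) \<inter> (\<Union>j\<in>{K..}. approx_set \<rho> j)"
          using J(3)[OF j] p by blast
      qed
      show "(\<Union>j\<in>J. A j) \<in> sets \<beta>" using J As by auto
      have "(\<Union>j\<in>{K..}. approx_set \<rho> j) \<in> sets \<beta>"
        by (intro sets.countable_UN') (auto simp: sets_closed[OF closed_approx_set])
      then show "sup_ball z (s/2) \<inter> (\<Union>j\<in>{K..}. approx_set \<rho> j) \<in> fmeasurable \<beta>" by blast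
    qed
    finally show "c * s ^ Suc d \<le> measure \<beta> (sup_ball z (s/2) \<inter> (\<Union>j\<in>{K..}. approx_set \<rho> j))" .
  qed
qed

end

section \<open>From a proportion of every good cell to almost every point\<close>

context projective_khinchin
begin

lemma cell_fm: "cell k x \<in> fmeasurable \<beta>"
  using cell_ball[of k x] sets_cell sup_ball_fmeasurable fmeasurableI2 by meson

lemma cell_diameter:
  assumes "u \<in> cell k x" "v \<in> cell k x"
  shows "sup_norm (u - v) \<le> 2 / real b ^ k"
proof -
  obtain z where "cell k x \<subseteq> sup_ball z (1 / real b ^ k)" using cell_ball[of k x] by auto
  then have "sup_norm (u - z) \<le> 1 / real b ^ k" "sup_norm (v - z) \<le> 1 / real b ^ k"
    using assms by (auto simp: mem_sup_ball)
  then show ?thesis using sup_norm_triangle_diff[of "u - z" "v - z"] by simp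
qed

lemma eventually_small_cells:
  assumes "e > 0"
  shows "\<exists>k0. \<forall>k\<ge>k0. 1 / real b ^ k < e"
proof -
  have "(\<lambda>k. (1 / real b) ^ k) \<longlonglongrightarrow> 0"
    using b_ge_2 by (intro LIMSEQ_power_zero) auto
  then have "\<forall>\<^sub>F k in sequentially. (1 / real b) ^ k < e"
    using assms by (rule order_tendstoD(2))
  then show ?thesis by (simp add: eventually_sequentially power_divide)
qed

lemma closed_imp_cell_open_Compl:
  assumes "closed E"
  shows "cell_open (- E)"
  unfolding cell_open_def
proof
  fix x assume "x \<in> - E"
  then obtain e where e: "e > 0" "ball x e \<subseteq> - E"
    using assms open_contains_ball by (metis open_Compl)
  obtain k0 where k0: "\<And>k. k \<ge> k0 \<Longrightarrow> 1 / real b ^ k < e / (2 * real CARD('n))"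
    using eventually_small_cells[of "e / (2 * real CARD('n))"] e by auto
  have "cell k x \<subseteq> - E" if "k \<ge> k0" for k
  proof
    fix u assume "u \<in> cell k x"
    then have "sup_norm (x - u) \<le> 2 / real b ^ k" using cell_diameter cell_self by blast
    then have "real CARD('n) * sup_norm (x - u) \<le> real CARD('n) * (2 / real b ^ k)"
      by (intro mult_left_mono) auto
    also have "\<dots> = (2 * real CARD('n)) * (1 / real b ^ k)" by simp
    also have "\<dots> < (2 * real CARD('n)) * (e / (2 * real CARD('n)))"
      using k0[OF that] by (intro mult_strict_left_mono) auto
    also have "\<dots> = e" by simp
    finally have "dist x u < e" using dist_le_sup_norm[of x u] by simp
    then show "u \<in> - E" using e by auto
  qed
  then show "\<exists>k0. \<forall>k\<ge>k0. cell k x \<subseteq> - E" by blast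
qed

text \<open>Cells whose distance from the origin is large compared with their size, as the local
  lower bound requires. Quantifying over the whole cell makes this a property of the cell rather
  than of \<open>x\<close>, so that it suits the partition into good cells.\<close>

definition good :: "nat \<Rightarrow> 'k ^ 'n \<Rightarrow> bool" where
  "good k x \<longleftrightarrow> (\<forall>u\<in>cell k x. 4 / real b ^ k \<le> sup_norm u)"

lemma good_cong: "y \<in> cell k x \<Longrightarrow> good k y = good k x"
  using cell_eq by (simp add: good_def)

lemma eventually_good:
  assumes "x \<noteq> 0"
  shows "\<exists>k0. \<forall>k\<ge>k0. good k x"
proof -
  obtain k0 where k0: "\<And>k. k \<ge> k0 \<Longrightarrow> 1 / real b ^ k < sup_norm x / 6"
    using eventually_small_cells[of "sup_norm x / 6"] assms by auto
  have "good k x" if "k \<ge> k0" for k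
    unfolding good_def
  proof
    fix u assume "u \<in> cell k x"
    then have "sup_norm (x - u) \<le> 2 / real b ^ k" using cell_diameter cell_self by blast
    then show "4 / real b ^ k \<le> sup_norm u"
      using k0[OF that] sup_norm_triangle_sub[of x u] by simp
  qed
  then show ?thesis by blast
qed

lemma good_nonzero: "good k x \<Longrightarrow> cell k x \<subseteq> {x. x \<noteq> 0}"
proof
  fix u assume "good k x" "u \<in> cell k x"
  then have "4 / real b ^ k \<le> sup_norm u" by (simp add: good_def)
  moreover have "4 / real b ^ k > 0" using b_ge_2 by simp
  ultimately have "sup_norm u > 0" by linarith
  then show "u \<in> {x. x \<noteq> 0}" by simp
qed

lemma good_cell_ball:
  assumes "good k x"
  obtains z where "sup_ball z (1 / real b ^ k / 2) \<subseteq> cell k x" "cell k x \<subseteq> sup_ball z (1 / real b ^ k)"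
    "4 * (1 / real b ^ k) \<le> sup_norm z"
proof -
  obtain z where z: "sup_ball z (1 / real b ^ k / 2) \<subseteq> cell k x" "cell k x \<subseteq> sup_ball z (1 / real b ^ k)"
    using cell_ball[of k x] by auto
  have "z \<in> cell k x" using z(1) by (auto simp: mem_sup_ball)
  then have "4 * (1 / real b ^ k) \<le> sup_norm z" using assms by (simp add: good_def)
  then show ?thesis using that z by blast
qed

text \<open>Every nonzero point lies in one of the countably many good cells, and the origin is a
  null set.\<close>

lemma null_setsI_good_cells:
  assumes A: "A \<in> sets \<beta>" and null: "\<And>k x. good k x \<Longrightarrow> emeasure \<beta> (cell k x \<inter> A) = 0"
  shows "A \<in> null_sets \<beta>"
proof -
  define \<C> where "\<C> = {C. \<exists>k x. C = cell k x \<and> good k x}"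
  have "\<C> \<subseteq> (\<Union>k. range (cell k))" by (auto simp: \<C>_def)
  then have count: "countable \<C>" by (rule countable_subset) (simp add: countable_cells)
  have zero: "{0} \<in> null_sets \<beta>"
  proof -
    have "{0} \<in> fmeasurable \<beta>"
      using fmeasurableI2[OF sup_ball_fmeasurable[of 0 1], of "{0}"]
      by (auto simp: mem_sup_ball sets_eq)
    then show ?thesis
      using measure_origin emeasure_eq_measure2[of "{0}" \<beta>] by (auto simp: null_sets_def)
  qed
  have "(\<Union>C\<in>\<C>. C \<inter> A) \<in> null_sets \<beta>"
    using count A null sets_cell by (intro null_sets_UN') (auto simp: \<C>_def null_sets_def)
  then have "{0} \<union> (\<Union>C\<in>\<C>. C \<inter> A) \<in> null_sets \<beta>" using zero by (rule null_sets.Un[rotated])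
  moreover have "A \<subseteq> {0} \<union> (\<Union>C\<in>\<C>. C \<inter> A)"
  proof
    fix x assume x: "x \<in> A"
    show "x \<in> {0} \<union> (\<Union>C\<in>\<C>. C \<inter> A)"
    proof (cases "x = 0")
      case False
      then obtain k where "good k x" using eventually_good by blast
      then have "cell k x \<in> \<C>" by (auto simp: \<C>_def)
      then show ?thesis using x cell_self by blast
    qed auto
  qed
  ultimately show ?thesis using A null_sets_subset by blast
qed

text \<open>\<open>tube 0 e\<close> is the line spanned by \<open>e\<close>. It lies in all tubes of
  positive radius about \<open>e\<close>, whose measure in a ball tends to 0 with the radius because
  \<open>d > 0\<close>. It is used to discard the points lying on rational lines.\<close>

lemma line_null:
  assumes "e \<noteq> 0"
  shows "tube 0 e \<in> null_sets \<beta>"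
proof (rule null_setsI_good_cells)
  fix k x assume good: "good k x"
  obtain z where "sup_ball z (1 / real b ^ k / 2) \<subseteq> cell k x"
    and z: "cell k x \<subseteq> sup_ball z (1 / real b ^ k)" "4 * (1 / real b ^ k) \<le> sup_norm z"
    by (rule good_cell_ball[OF good])
  define s where "s = 1 / real b ^ k"
  have s: "0 < s" "4 * s \<le> sup_norm z" using b_ge_2 z by (auto simp: s_def)
  have "measure \<beta> (cell k x \<inter> tube 0 e) \<le> CU * s * (\<rho> * sup_norm z) ^ d" if "\<rho> > 0" for \<rho>
  proof -
    have "tube 0 e \<subseteq> tube \<rho> e"
      unfolding tube_def using near_mono[of 0 _ e \<rho>] that by auto
    then have "measure \<beta> (cell k x \<inter> tube 0 e) \<le> measure \<beta> (tube \<rho> e \<inter> sup_ball z s)"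
      using z sets_cell by (intro measure_le_fm) (auto simp: s_def)
    also have "\<dots> \<le> CU * s * (\<rho> * sup_norm z) ^ d"
      using assms s that by (intro tube_ub) auto
    finally show ?thesis .
  qed
  then have ev: "\<forall>\<^sub>F \<rho> in at_right 0. measure \<beta> (cell k x \<inter> tube 0 e) \<le> CU * s * (\<rho> * sup_norm z) ^ d"
    by (auto intro: eventually_mono[OF eventually_at_right_less])
  have lim: "((\<lambda>\<rho>. CU * s * (\<rho> * sup_norm z) ^ d) \<longlongrightarrow> CU * s * (0 * sup_norm z) ^ d) (at_right 0)"
    by (intro tendsto_intros)
  have "measure \<beta> (cell k x \<inter> tube 0 e) \<le> CU * s * (0 * sup_norm z) ^ d"
    using tendsto_lowerbound[OF lim ev] by simp
  then have "measure \<beta> (cell k x \<inter> tube 0 e) = 0"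
    using d_pos by (simp add: measure_le_0_iff zero_power)
  moreover have "cell k x \<inter> tube 0 e \<in> fmeasurable \<beta>"
    using cell_fm by (rule fmeasurable_Int_fmeasurable) auto
  ultimately show "emeasure \<beta> (cell k x \<inter> tube 0 e) = 0"
    using emeasure_eq_measure2[of "cell k x \<inter> tube 0 e" \<beta>] by simp
qed auto

text \<open>A good cell contains a ball of half the radius of the ball that contains it, so a
  proportion of the smaller ball is a proportion of the cell. The constant \<open>CT\<close> is
  fixed before \<open>\<rho>\<close>, so that an approximation function can be truncated at
  it.\<close>

lemma limsup_AE:
  obtains CT where "CT > 0"
    "\<And>\<rho>. (\<And>j. 0 < \<rho> j) \<Longrightarrow> (\<And>j. \<rho> j \<le> CT / real b ^ (j * Suc d)) \<Longrightarrow>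
       \<not> summable (\<lambda>j. (\<rho> j / (CT / real b ^ (j * Suc d))) ^ d) \<Longrightarrow>
       AE x in \<beta>. \<forall>K. \<exists>j\<ge>K. x \<in> approx_set \<rho> j"
proof (rule local_lower_bound)
  fix CT c :: real
  assume CT: "CT > 0" and c: "c > 0"
    and lower: "\<And>\<rho> z s K. (\<And>j. 0 < \<rho> j) \<Longrightarrow> (\<And>j. \<rho> j \<le> CT / real b ^ (j * Suc d)) \<Longrightarrow>
       \<not> summable (\<lambda>j. (\<rho> j / (CT / real b ^ (j * Suc d))) ^ d) \<Longrightarrow> 0 < s \<Longrightarrow> 4 * s \<le> sup_norm z \<Longrightarrow>
       c * s ^ Suc d \<le> measure \<beta> (sup_ball z (s/2) \<inter> (\<Union>j\<in>{K..}. approx_set \<rho> j))"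
  show thesis
  proof (rule that[OF CT])
    fix \<rho> :: "nat \<Rightarrow> real"
    assume \<rho>: "\<And>j. 0 < \<rho> j" "\<And>j. \<rho> j \<le> CT / real b ^ (j * Suc d)"
      "\<not> summable (\<lambda>j. (\<rho> j / (CT / real b ^ (j * Suc d))) ^ d)"
    \<comment> \<open>The cell has measure at most \<open>CM * s ^ Suc d\<close>, whence
      \<open>c / CM\<close>; the cap at 1 meets the hypothesis of
      \<open>limsup_full_in_good_cell\<close>.\<close>
    define c' where "c' = min 1 (c / CM)"
    have "0 < c / CM" using c consts_pos by simp
    then have c'0: "0 < c'" "c' \<le> 1" "c' \<le> c / CM" by (simp_all add: c'_def)
    then have c': "0 < c'" "c' \<le> 1" "c' * CM \<le> c"
      using consts_pos(2) by (simp_all add: pos_le_divide_eq)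
    have Es: "(\<Union>j\<in>{K..}. approx_set \<rho> j) \<in> sets \<beta>" for K
    proof (rule sets.countable_UN'')
      show "approx_set \<rho> j \<in> sets \<beta>" for j by (rule sets_closed[OF closed_approx_set])
    qed simp
    have null: "emeasure \<beta> (cell k x - (\<Union>j\<in>{K..}. approx_set \<rho> j)) = 0" if "good k x" for k x K
    proof (rule limsup_full_in_good_cell[where good = good and X = "{x. x \<noteq> 0}" and c = c'])
      show "\<exists>k0. \<forall>k\<ge>k0. good k y" if "y \<in> {x. x \<noteq> 0}" for y
        using that eventually_good by simp
      show "good i v = good i y" if "v \<in> cell i y" for i v y using that by (rule good_cong)
      show "cell i y \<subseteq> {x. x \<noteq> 0}" if "good i y" for i y using that by (rule good_nonzero)
      show "emeasure \<beta> (cell i y) < \<infinity>" for i y using cell_fm[of i y] by (simp add: fmeasurable_def)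
      show "cell_open (- approx_set \<rho> j)" for j
        by (rule closed_imp_cell_open_Compl[OF closed_approx_set])
      show "approx_set \<rho> j \<in> sets \<beta>" for j by (rule sets_closed[OF closed_approx_set])
      show "0 < c'" "c' \<le> 1" by (rule c')+
      show "good k x" by (rule that)
    next
      fix k x K assume good: "good k x"
      define s where "s = 1 / real b ^ k"
      obtain z where z: "sup_ball z (s / 2) \<subseteq> cell k x" "cell k x \<subseteq> sup_ball z s" "4 * s \<le> sup_norm z"
        unfolding s_def by (rule good_cell_ball[OF good])
      have s: "s > 0" using b_ge_2 by (simp add: s_def)
      have "c' * measure \<beta> (cell k x) \<le> c' * (CM * s ^ Suc d)"
        using c'(1) sets_cell ball_ub[OF s, of z]
        by (intro mult_left_mono order_trans[OF measure_le_fm[OF z(2)]]) simp_all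
      also have "\<dots> \<le> c * s ^ Suc d"
        using mult_right_mono[OF c'(3), of "s ^ Suc d"] s by simp
      also have "\<dots> \<le> measure \<beta> (sup_ball z (s/2) \<inter> (\<Union>j\<in>{K..}. approx_set \<rho> j))"
        by (rule lower[OF \<rho> s z(3)])
      also have "\<dots> \<le> measure \<beta> (cell k x \<inter> (\<Union>j\<in>{K..}. approx_set \<rho> j))"
        using z(1) Es by (intro measure_le_fm fmeasurable_Int_fmeasurable cell_fm) auto
      finally show "c' * measure \<beta> (cell k x) \<le> measure \<beta> (cell k x \<inter> (\<Union>j\<in>{K..}. approx_set \<rho> j))" .
    qed
    have "space \<beta> = UNIV" using sets_eq_imp_space_eq[OF sets_eq] by simp
    have "UNIV - (\<Union>j\<in>{K..}. approx_set \<rho> j) \<in> null_sets \<beta>" for K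
    proof (rule null_setsI_good_cells)
      show "UNIV - (\<Union>j\<in>{K..}. approx_set \<rho> j) \<in> sets \<beta>"
        using sets.compl_sets[OF Es[of K]] \<open>space \<beta> = UNIV\<close> by simp
      fix k x assume "good k x"
      then show "emeasure \<beta> (cell k x \<inter> (UNIV - (\<Union>j\<in>{K..}. approx_set \<rho> j))) = 0"
        using null[of k x K] by (simp add: Diff_eq)
    qed
    then have "AE x in \<beta>. x \<notin> UNIV - (\<Union>j\<in>{K..}. approx_set \<rho> j)" for K by (rule AE_not_in)
    then have "AE x in \<beta>. \<forall>K. x \<notin> UNIV - (\<Union>j\<in>{K..}. approx_set \<rho> j)" by (simp add: AE_all_countable)
    then show "AE x in \<beta>. \<forall>K. \<exists>j\<ge>K. x \<in> approx_set \<rho> j"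
      by eventually_elim auto
  qed
qed

end

text \<open>Cauchy condensation along the heights \<open>H j = D * b ^ (j * d)\<close>. A block has
  at most \<open>H (Suc j)\<close> terms, each at most
  \<open>H (Suc j) ^ d * \<psi> (H j) ^ d\<close>. The exponents match because
  \<open>j * d * Suc d = j * Suc d * d\<close>; what remains is the constant
  \<open>E\<close>.\<close>

lemma summable_condensed:
  fixes \<psi> :: "real \<Rightarrow> real"
  assumes \<psi>: "\<And>x. x \<ge> 0 \<Longrightarrow> \<psi> x \<ge> 0" "antimono_on {0..} \<psi>"
    and D: "D > (0::nat)" and b: "b \<ge> (2::nat)" and d: "d > 0"
    and sum: "summable (\<lambda>j. (\<psi> (real (D * b ^ (j * d))) * real b ^ (j * Suc d)) ^ d)"
  shows "summable (\<lambda>q. real q ^ d * \<psi> (real q) ^ d)"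
proof -
  define H where "H j = D * b ^ (j * d)" for j
  define u where "u j = (\<psi> (real (H j)) * real b ^ (j * Suc d)) ^ d" for j
  define f where "f q = real q ^ d * \<psi> (real q) ^ d" for q :: nat
  have u0: "u j \<ge> 0" for j using \<psi>(1) by (simp add: u_def)
  have f0: "f q \<ge> 0" for q using \<psi>(1) by (simp add: f_def)
  define E where "E = (real D * real b ^ d) ^ Suc d"
  have mono: "H j \<le> H (Suc j)" for j
    unfolding H_def using b d by (intro mult_le_mono2 power_increasing) auto
  have block: "(\<Sum>q\<in>{H j..<H (Suc j)}. f q) \<le> E * u j" for j
  proof -
    have "(\<Sum>q\<in>{H j..<H (Suc j)}. f q) \<le> (\<Sum>q\<in>{H j..<H (Suc j)}. real (H (Suc j)) ^ d * \<psi> (real (H j)) ^ d)"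
    proof (rule sum_mono)
      fix q assume q: "q \<in> {H j..<H (Suc j)}"
      then have "\<psi> (real q) \<le> \<psi> (real (H j))"
        using \<psi>(2) by (auto simp: monotone_on_def)
      then show "f q \<le> real (H (Suc j)) ^ d * \<psi> (real (H j)) ^ d"
        unfolding f_def using q \<psi>(1) by (intro mult_mono power_mono) auto
    qed
    also have "\<dots> = real (H (Suc j) - H j) * (real (H (Suc j)) ^ d * \<psi> (real (H j)) ^ d)" by simp
    also have "\<dots> \<le> real (H (Suc j)) * (real (H (Suc j)) ^ d * \<psi> (real (H j)) ^ d)"
      using \<psi>(1) by (intro mult_right_mono) auto
    also have "\<dots> = real (H (Suc j)) ^ Suc d * \<psi> (real (H j)) ^ d" by simp
    also have "real (H (Suc j)) ^ Suc d = E * (real b ^ (j * Suc d)) ^ d"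
    proof -
      have "real (H (Suc j)) = real D * real b ^ d * real b ^ (j * d)"
        by (simp add: H_def power_add)
      moreover have "(real b ^ (j * d)) ^ Suc d = (real b ^ (j * Suc d)) ^ d"
        by (simp only: power_mult[symmetric] mult_ac)
      ultimately show ?thesis unfolding E_def by (simp only: power_mult_distrib)
    qed
    finally show ?thesis by (simp only: u_def power_mult_distrib mult_ac)
  qed
  have part: "(\<Sum>q<H J. f q) \<le> (\<Sum>q<H 0. f q) + E * (\<Sum>j<J. u j)" for J
  proof (induction J)
    case (Suc J)
    have "(\<Sum>q<H (Suc J). f q) = (\<Sum>q<H J. f q) + (\<Sum>q\<in>{H J..<H (Suc J)}. f q)"
      using mono[of J] by (simp add: lessThan_atLeast0 sum.atLeastLessThan_concat)
    also have "\<dots> \<le> ((\<Sum>q<H 0. f q) + E * (\<Sum>j<J. u j)) + E * u J"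
      by (intro add_mono Suc block)
    finally show ?case by (simp add: algebra_simps)
  qed simp
  have su: "summable u" using sum by (simp add: u_def[abs_def] H_def)
  have "summable f"
  proof (rule summableI_nonneg_bounded[OF f0])
    fix N
    have "N < b ^ N" using b by (simp add: power_gt_expt)
    also have "\<dots> \<le> 1 * b ^ (N * d)" using b d by (simp add: power_increasing)
    also have "\<dots> \<le> H N" unfolding H_def using D by (intro mult_le_mono1) auto
    finally have "(\<Sum>q<N. f q) \<le> (\<Sum>q<H N. f q)" using f0 by (intro sum_mono2) auto
    also have "\<dots> \<le> (\<Sum>q<H 0. f q) + E * (\<Sum>j<N. u j)" by (rule part)
    also have "\<dots> \<le> (\<Sum>q<H 0. f q) + E * suminf u"
      using su u0 by (intro add_left_mono mult_left_mono sum_le_suminf) (auto simp: E_def)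
    finally show "(\<Sum>q<N. f q) \<le> (\<Sum>q<H 0. f q) + E * suminf u" .
  qed
  then show ?thesis by (simp add: f_def[abs_def])
qed

text \<open>If the truncated series converged, its terms would tend to 0, the truncation would be
  inactive from some index on, and the untruncated condensed series would converge as well.\<close>

lemma not_summable_truncated:
  fixes \<psi> :: "real \<Rightarrow> real"
  assumes \<psi>: "\<And>x. x \<ge> 0 \<Longrightarrow> \<psi> x \<ge> 0" "antimono_on {0..} \<psi>"
    and D: "D > (0::nat)" and b: "b \<ge> (2::nat)" and d: "d > 0" and C: "C > 0" "CT > 0"
    and div: "\<not> summable (\<lambda>q. real q ^ d * \<psi> (real q) ^ d)"
  shows "\<not> summable (\<lambda>j. (min (\<psi> (real (D * b ^ (j * d))) / C) (CT / real b ^ (j * Suc d)) / (CT / real b ^ (j * Suc d))) ^ d)"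
proof
  define t where "t j = \<psi> (real (D * b ^ (j * d))) * real b ^ (j * Suc d) / (C * CT)" for j
  have b0: "real b > 0" using b by simp
  have eq: "min (\<psi> (real (D * b ^ (j * d))) / C) (CT / real b ^ (j * Suc d)) / (CT / real b ^ (j * Suc d)) = min (t j) 1" for j
    using C b0 by (simp add: t_def min_def field_simps)
  assume "summable (\<lambda>j. (min (\<psi> (real (D * b ^ (j * d))) / C) (CT / real b ^ (j * Suc d)) / (CT / real b ^ (j * Suc d))) ^ d)"
  then have sum: "summable (\<lambda>j. min (t j) 1 ^ d)" unfolding eq .
  then have "(\<lambda>j. min (t j) 1 ^ d) \<longlonglongrightarrow> 0" by (rule summable_LIMSEQ_zero)
  then have "\<forall>\<^sub>F j in sequentially. min (t j) 1 ^ d < 1" by (rule order_tendstoD(2)) simp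
  then have "\<forall>\<^sub>F j in sequentially. norm (t j ^ d) = min (t j) 1 ^ d"
  proof eventually_elim
    case (elim j)
    have "t j \<ge> 0" using \<psi>(1) C by (simp add: t_def)
    moreover have "t j < 1"
    proof (rule ccontr)
      assume "\<not> ?thesis"
      then have "min (t j) 1 = 1" by simp
      then show False using elim by simp
    qed
    ultimately show ?case by (simp add: min_def)
  qed
  then have "\<forall>\<^sub>F j in sequentially. norm (t j ^ d) \<le> min (t j) 1 ^ d"
    by eventually_elim simp
  then have "summable (\<lambda>j. t j ^ d)" using sum by (rule summable_comparison_test_ev)
  then have "summable (\<lambda>j. (C * CT) ^ d * t j ^ d)" by (rule summable_mult)
  moreover have "(C * CT) ^ d * t j ^ d = (\<psi> (real (D * b ^ (j * d))) * real b ^ (j * Suc d)) ^ d" for j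
    using C by (simp add: t_def flip: power_mult_distrib)
  ultimately have "summable (\<lambda>j. (\<psi> (real (D * b ^ (j * d))) * real b ^ (j * Suc d)) ^ d)" by simp
  from summable_condensed[OF \<psi> D b d this] div show False by simp
qed

section \<open>Projective distance and height\<close>

lemma proj_rel_refl: "x \<noteq> 0 \<Longrightarrow> proj_rel x x"
  unfolding proj_rel_def by (auto intro!: exI[of _ 1])

lemma place_norm_le:
  assumes "finite I" "\<And>i. i \<in> I \<Longrightarrow> 0 \<le> f i" "\<And>i. i \<in> I \<Longrightarrow> f i \<le> B"
  shows "place_norm v f I \<le> real (card I) * B"
proof (cases "I = {}")
  case False
  then obtain i where "i \<in> I" by blast
  then have B: "0 \<le> B" using assms order_trans by blast
  have "L2_set f I \<le> sum f I" using assms by (intro L2_set_le_sum) auto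
  also have "\<dots> \<le> (\<Sum>i\<in>I. B)" using assms by (intro sum_mono) auto
  finally have 1: "L2_set f I \<le> real (card I) * B" by simp
  have "1 * B \<le> real (card I) * B"
    using False assms(1) B by (intro mult_right_mono) (auto simp: Suc_le_eq card_gt_0_iff)
  then have "Max (insert 0 (f ` I)) \<le> real (card I) * B"
    using assms B by (subst Max_le_iff) (auto intro: order_trans)
  then show ?thesis using 1 by (simp add: place_norm_def)
qed (simp add: place_norm_def)

lemma place_norm_ge: "finite I \<Longrightarrow> i \<in> I \<Longrightarrow> f i \<le> place_norm v f I"
  using member_le_L2_set[of I i f] by (simp add: place_norm_def)

lemma sup_norm_le_vec_norm: "sup_norm x \<le> vec_norm x"
  unfolding sup_norm_le_iff vec_norm_def
  using place_norm_ge[of UNIV _ "\<lambda>i. vabs (x $ i)"] by auto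

lemma vec_norm_le_sup_norm: "vec_norm (x :: 'k::rat_completion ^ 'n) \<le> real CARD('n) * sup_norm x"
  unfolding vec_norm_def by (rule place_norm_le) (auto intro: sup_norm_ge)

lemma wedge_norm_le:
  fixes x e :: "'k::rat_completion ^ 'n::{finite,linorder}"
  assumes "near \<rho> x e" "\<rho> \<ge> 0"
  shows "wedge_norm x e \<le> real (CARD('n) ^ 2) * (\<rho> * sup_norm x * sup_norm e)"
proof -
  have "wedge_norm x e \<le> real (card {(i :: 'n, j). i < j}) * (\<rho> * sup_norm x * sup_norm e)"
    unfolding wedge_norm_def using assms by (intro place_norm_le) (auto simp: near_def)
  also have "\<dots> \<le> real (CARD('n) ^ 2) * (\<rho> * sup_norm x * sup_norm e)"
  proof (intro mult_right_mono of_nat_mono)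
    have "card {(i :: 'n, j). i < j} \<le> CARD('n \<times> 'n)" by (intro card_mono) auto
    then show "card {(i :: 'n, j). i < j} \<le> CARD('n) ^ 2" by (simp add: power2_eq_square)
  qed (use assms in auto)
  finally show ?thesis .
qed

lemma proj_dist_le:
  fixes x e :: "'k::rat_completion ^ 'n::{finite,linorder}"
  assumes "near \<rho> x e" "\<rho> \<ge> 0" "x \<noteq> 0" "e \<noteq> 0"
  shows "proj_dist (to_proj x) (to_proj e) \<le> real (CARD('n) ^ 2) * \<rho>"
proof -
  have pos: "0 < sup_norm x * sup_norm e" using assms by simp
  also have le: "\<dots> \<le> vec_norm x * vec_norm e"
    by (intro mult_mono sup_norm_le_vec_norm order_trans[OF sup_norm_nonneg sup_norm_le_vec_norm]) auto
  finally have pos': "0 < vec_norm x * vec_norm e" .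
  have "proj_dist (to_proj x) (to_proj e) = wedge_norm x e / (vec_norm x * vec_norm e)"
    using assms by (simp add: proj_dist.abs_eq proj_rel_refl)
  also have "\<dots> \<le> real (CARD('n) ^ 2) * \<rho> * (sup_norm x * sup_norm e) / (vec_norm x * vec_norm e)"
    using wedge_norm_le[OF assms(1,2)] pos' by (intro divide_right_mono) (auto simp: mult_ac)
  also have "\<dots> \<le> real (CARD('n) ^ 2) * \<rho>"
    using mult_left_mono[OF le, of "real (CARD('n) ^ 2) * \<rho>"] assms(2) pos' by (subst pos_divide_le_eq) auto
  finally show ?thesis .
qed

text \<open>Off the rational lines a fixed rational point stays at positive distance, so arbitrarily
  good approximations must use infinitely many points.\<close>

lemma proj_dist_pos:
  fixes x e :: "'k::rat_completion ^ 'n::{finite,linorder}"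
  assumes "x \<noteq> 0" "e \<noteq> 0" "\<not> near 0 x e"
  shows "proj_dist (to_proj x) (to_proj e) > 0"
proof -
  have pos: "vec_norm x > 0" "vec_norm e > 0"
    using assms sup_norm_pos_iff sup_norm_le_vec_norm less_le_trans by metis+
  obtain i j where ij: "vabs (x $ i * e $ j - x $ j * e $ i) > 0"
    using assms(3) unfolding near_def by (auto simp: not_le)
  obtain k l where kl: "k < l" "vabs (x $ k * e $ l - x $ l * e $ k) > 0"
  proof (cases i j rule: linorder_cases)
    case less
    then show ?thesis using ij that by blast
  next
    case equal
    then show ?thesis using ij by (simp add: mult.commute)
  next
    case greater
    then show ?thesis using ij that[of j i] vabs_diff_commute[of "x $ i * e $ j"] by simp
  qed
  have "vabs (x $ k * e $ l - x $ l * e $ k) \<le> wedge_norm x e"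
    unfolding wedge_norm_def
    using kl(1) place_norm_ge[of "{(i, j). i < j}" "(k, l)" "\<lambda>(i, j). vabs (x $ i * e $ j - x $ j * e $ i)"]
    by simp
  then have "wedge_norm x e > 0" using kl by simp
  then show ?thesis using assms pos by (simp add: proj_dist.abs_eq proj_rel_refl)
qed

definition rat_vec :: "int ^ 'n \<Rightarrow> rat ^ 'n" where
  "rat_vec z = (\<chi> i. of_int (z $ i))"

lemma rat_vec_eq_0_iff [simp]: "rat_vec z = 0 \<longleftrightarrow> z = 0"
  by (simp add: rat_vec_def vec_eq_iff)

lemma proj_of_rat_rat_vec: "z \<noteq> 0 \<Longrightarrow> proj_of_rat (to_proj (rat_vec z)) = to_proj (int_vec z)"
  by (simp add: proj_of_rat.abs_eq proj_rel_refl rat_vec_def int_vec_def vec_eq_iff)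

lemma padic_abs_of_int_le_1: "prime p \<Longrightarrow> padic_abs p (of_int a) \<le> 1"
  by (auto simp: padic_abs_def power_int_minus intro!: inverse_le_1_iff[THEN iffD2] one_le_power
      dest: prime_ge_1_nat)

text \<open>For integer coordinates the factors at the finite places are at most 1, which leaves the
  Euclidean norm. An upper bound is all that is wanted, as \<open>\<psi>\<close> decreases.\<close>

lemma height_rat_vec_le:
  assumes "z \<noteq> (0 :: int ^ 'n)"
  shows "height (to_proj (rat_vec z)) \<le> real CARD('n) * int_height z"
proof -
  define F where "F v = (if is_place v then rat_vec_norm v (rat_vec z) else 1)" for v
  define S where "S = {v. F v \<noteq> 1} - {\<infinity>}"
  have "{v. F v \<noteq> 1} = {v. is_place v \<and> rat_vec_norm v (rat_vec z) \<noteq> 1}"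
    by (auto simp: F_def)
  then have fin: "finite S"
    using finite_rat_vec_norm[of "rat_vec z"] assms by (simp add: S_def)
  have "height (to_proj (rat_vec z)) = Prod_any F"
    unfolding F_def using assms by (simp add: height.abs_eq proj_rel_refl)
  also have "\<dots> = prod F (insert \<infinity> S)"
    using fin by (intro Prod_any.expand_superset) (auto simp: S_def)
  also have "\<dots> = F \<infinity> * prod F S" using fin by (intro prod.insert) (auto simp: S_def)
  also have "\<dots> \<le> F \<infinity> * 1"
  proof (intro mult_left_mono prod_le_1)
    fix v assume v: "v \<in> S"
    show "0 \<le> F v \<and> F v \<le> 1"
    proof (cases "is_place v")
      case True
      then obtain p where p: "v = enat p" "prime p" using v by (auto simp: is_place_def S_def)
      have "Max (insert 0 (range (\<lambda>i. rat_abs v (rat_vec z $ i)))) \<le> 1"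
        by (subst Max_le_iff) (auto simp: rat_abs_def p rat_vec_def intro: padic_abs_of_int_le_1)
      then have "rat_vec_norm v (rat_vec z) \<le> 1" by (simp add: rat_vec_norm_def place_norm_def p)
      then show ?thesis using True by (simp add: F_def rat_vec_norm_def place_norm_nonneg)
    qed (simp add: F_def)
  qed (simp add: F_def rat_vec_norm_def place_norm_nonneg)
  also have "F \<infinity> = rat_vec_norm \<infinity> (rat_vec z)" by (simp add: F_def is_place_def)
  also have "\<dots> \<le> real CARD('n) * int_height z"
    unfolding rat_vec_norm_def
    by (rule place_norm_le) (auto simp: rat_abs_def rat_vec_def intro: order_trans[OF _ int_height_ge])
  finally show ?thesis by simp
qed

lemma height_nonneg: "height y \<ge> 0"
proof -
  have "height y = Prod_any (\<lambda>v. if is_place v then rat_vec_norm v (rep_proj y) else 1)"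
    by (simp add: height.rep_eq)
  also have "\<dots> \<ge> 0"
    unfolding Prod_any.expand_set by (intro prod_nonneg) (simp add: rat_vec_norm_def place_norm_nonneg)
  finally show ?thesis .
qed

section \<open>Measurability of the set of approximable points\<close>

lemma borel_measurable_vec_norm:
  "(vec_norm :: 'k::rat_completion ^ 'n \<Rightarrow> real) \<in> borel_measurable borel"
proof -
  have "(\<lambda>x :: 'k ^ 'n. vabs (x $ i)) \<in> borel_measurable borel" for i
    by (rule borel_measurable_continuous_onI[OF continuous_on_vabs_component])
  note [measurable] = this
  have L2: "(\<lambda>x :: 'k ^ 'n. L2_set (\<lambda>i. vabs (x $ i)) UNIV) \<in> borel_measurable borel"
    unfolding L2_set_def by measurable
  have "Max (insert 0 (range (\<lambda>i. vabs (x $ i)))) = sup_norm x" for x :: "'k ^ 'n"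
    using sup_norm_nonneg[of x] by (subst Max_insert) (auto simp: sup_norm_def)
  then have eq: "vec_norm = (if place_of TYPE('k) = \<infinity> then (\<lambda>x :: 'k ^ 'n. L2_set (\<lambda>i. vabs (x $ i)) UNIV) else sup_norm)"
    by (auto simp: vec_norm_def[abs_def] place_norm_def)
  show ?thesis
    unfolding eq using L2 borel_measurable_continuous_onI[OF continuous_on_sup_norm]
    by (cases "place_of TYPE('k) = \<infinity>") simp_all
qed

lemma borel_measurable_wedge_norm:
  "(\<lambda>x :: ('k::rat_completion, 'n::{finite,linorder}) vec. wedge_norm x e) \<in> borel_measurable borel"
proof -
  define f where "f x ij = (case ij of (i, j) \<Rightarrow> vabs (x $ i * e $ j - x $ j * e $ i))" for x :: "('k, 'n) vec" and ij :: "'n \<times> 'n"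
  have [measurable]: "(\<lambda>x. f x ij) \<in> borel_measurable borel" for ij
    unfolding f_def by (cases ij) (auto intro!: borel_measurable_continuous_onI continuous_on_minor)
  define I where "I = {(i :: 'n, j). i < j}"
  have L2: "(\<lambda>x. L2_set (f x) I) \<in> borel_measurable borel"
    unfolding L2_set_def by measurable
  have Mx: "(\<lambda>x. Max (insert 0 (f x ` I))) \<in> borel_measurable borel"
  proof (rule borel_measurableI_le)
    fix c
    have "{x \<in> space borel. Max (insert 0 (f x ` I)) \<le> c} = {x \<in> space borel. 0 \<le> c \<and> (\<forall>ij\<in>I. f x ij \<le> c)}"
      by (subst Max_le_iff) auto
    also have "\<dots> \<in> sets borel"
      by measurable
    finally show "{x \<in> space borel. Max (insert 0 (f x ` I)) \<le> c} \<in> sets borel" .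
  qed
  have f_eq: "f x = (\<lambda>(i, j). vabs (x $ i * e $ j - x $ j * e $ i))" for x
    by (rule ext) (simp add: f_def)
  have eq: "(\<lambda>x :: ('k, 'n) vec. wedge_norm x e) = (if place_of TYPE('k) = \<infinity> then (\<lambda>x. L2_set (f x) I) else (\<lambda>x. Max (insert 0 (f x ` I))))"
    unfolding wedge_norm_def place_norm_def f_eq I_def
    by (cases "place_of TYPE('k) = \<infinity>") (simp_all del: not_infinity_eq)
  show ?thesis unfolding eq using L2 Mx by (cases "place_of TYPE('k) = \<infinity>") simp_all
qed

text \<open>Turns the existence of infinitely many points into a countable intersection of countable
  unions: the rational points are countable, and so are their finite subsets.\<close>

lemma infinite_iff_avoids_finite: "infinite A \<longleftrightarrow> (\<forall>F. finite F \<longrightarrow> (\<exists>y. y \<notin> F \<and> y \<in> A))"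
  by (metis (no_types, lifting) finite_subset infinite_super subsetI)

lemma proj_of_rat_cases:
  fixes y :: "(rat, 'n::finite) proj"
  obtains q where "q \<noteq> 0" "y = to_proj q"
    "proj_of_rat y = to_proj ((\<chi> i. of_rat (q $ i)) :: 'k::field_char_0 ^ 'n)"
proof -
  have q: "proj_rel (rep_proj y) (rep_proj y)" by (rule Quotient3_rep_reflp[OF Quotient3_proj])
  then have "y = to_proj (rep_proj y)" by (simp add: Quotient3_abs_rep[OF Quotient3_proj])
  moreover have "rep_proj y \<noteq> 0" using q by (simp add: proj_rel_def)
  ultimately show ?thesis using that proj_of_rat.abs_eq[OF q] by metis
qed

lemma countable_proj_rat: "countable (UNIV :: (rat, 'n::finite) proj set)"
proof -
  have "(UNIV :: (rat, 'n) proj set) = range to_proj"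
    using proj_of_rat_cases by blast
  then show ?thesis by (metis countableI_type countable_image)
qed

lemma sets_approximable:
  "{x. x \<noteq> 0 \<and> to_proj x \<in> (approximable \<psi> :: ('k::rat_completion, 'n::{finite,linorder}) proj set)} \<in> sets borel"
proof -
  define A where "A y = {x :: ('k, 'n) vec. x \<noteq> 0 \<and> proj_dist (to_proj x) (proj_of_rat y) \<le> \<psi> (height y)}" for y :: "(rat, 'n) proj"
  have A: "A y \<in> sets borel" for y
  proof -
    obtain q :: "(rat, 'n) vec" where q: "q \<noteq> 0" "proj_of_rat y = to_proj ((\<chi> i. of_rat (q $ i)) :: ('k, 'n) vec)"
      by (rule proj_of_rat_cases)
    define e where "e = ((\<chi> i. of_rat (q $ i)) :: ('k, 'n) vec)"
    have e: "e \<noteq> 0" using q by (simp add: e_def vec_eq_iff)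
    have "A y = {x. x \<noteq> 0 \<and> wedge_norm x e / (vec_norm x * vec_norm e) \<le> \<psi> (height y)}"
      unfolding A_def using q e by (auto simp: proj_dist.abs_eq proj_rel_refl simp flip: e_def)
    also have "\<dots> = - {0} \<inter> {x \<in> space borel. wedge_norm x e / (vec_norm x * vec_norm e) \<le> \<psi> (height y)}"
      by auto
    also have "\<dots> \<in> sets borel"
      using borel_measurable_wedge_norm[of e] borel_measurable_vec_norm
      by (intro sets.Int borel_measurable_le borel_measurable_divide borel_measurable_times
          borel_measurable_const) (auto simp: borel_open)
    finally show ?thesis .
  qed
  define \<F> where "\<F> = {F :: (rat, 'n) proj set. finite F}"
  have count: "countable \<F>"
    using countable_Collect_finite_subset[OF countable_proj_rat[where 'n = 'n]] by (simp add: \<F>_def)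
  have "{x. x \<noteq> 0 \<and> to_proj x \<in> (approximable \<psi> :: ('k, 'n) proj set)} = (\<Inter>F\<in>\<F>. \<Union>y\<in>- F. A y)"
  proof (rule Set.set_eqI)
    fix x :: "('k, 'n) vec"
    show "x \<in> {x. x \<noteq> 0 \<and> to_proj x \<in> (approximable \<psi> :: ('k, 'n) proj set)} \<longleftrightarrow> x \<in> (\<Inter>F\<in>\<F>. \<Union>y\<in>- F. A y)"
    proof (cases "x = 0")
      case True
      have "{} \<in> \<F>" by (simp add: \<F>_def)
      then show ?thesis using True by (auto simp: A_def)
    next
      case False
      then show ?thesis
        unfolding approximable_def mem_Collect_eq infinite_iff_avoids_finite
        by (auto simp: A_def \<F>_def)
    qed
  qed
  also have "\<dots> \<in> sets borel"
  proof (rule sets.countable_INT''[OF _ count])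
    show "(\<Union>y\<in>- F. A y) \<in> sets borel" if "F \<in> \<F>" for F
      using A countable_subset[OF subset_UNIV countable_proj_rat[where 'n = 'n], of "- F"]
      by (intro sets.countable_UN'') auto
  qed (auto simp: \<F>_def)
  finally show ?thesis .
qed

text \<open>Arbitrarily small radii express that infinitely many scales succeed. The constant
  \<open>C\<close> provides for the loss in passing from \<open>near\<close> to the projective
  distance, and \<open>D\<close> for the loss in passing from \<open>int_height\<close> to the
  height; both are put in before condensation.\<close>

theorem (in projective_khinchin) AE_infinitely_often_close:
  fixes \<psi> :: "real \<Rightarrow> real"
  assumes \<psi>: "\<And>x. x \<ge> 0 \<Longrightarrow> \<psi> x \<ge> 0" "antimono_on {0..} \<psi>"
    and div: "\<not> summable (\<lambda>q. real q ^ d * \<psi> (real q) ^ d)" and C: "C > 0" and D: "D > 0"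
  shows "AE x in \<beta>. \<forall>\<epsilon>>0. \<exists>\<rho> j p. 0 < \<rho> \<and> \<rho> < \<epsilon> \<and> p \<in> P \<and> near \<rho> x (int_vec p) \<and>
    C * \<rho> \<le> \<psi> (real (D * CD * b ^ (j * d))) \<and> int_height p \<le> CD * b ^ (j * d)"
proof (rule limsup_AE)
  fix CT :: real
  assume CT: "CT > 0"
    and AE: "\<And>\<rho>. (\<And>j. 0 < \<rho> j) \<Longrightarrow> (\<And>j. \<rho> j \<le> CT / real b ^ (j * Suc d)) \<Longrightarrow>
       \<not> summable (\<lambda>j. (\<rho> j / (CT / real b ^ (j * Suc d))) ^ d) \<Longrightarrow>
       AE x in \<beta>. \<forall>K. \<exists>j\<ge>K. x \<in> approx_set \<rho> j"
  define H where "H j = real (D * CD * b ^ (j * d))" for j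
  \<comment> \<open>Truncated at the radius up to which the selected tubes are disjoint;
    \<open>not_summable_truncated\<close> preserves the divergence.\<close>
  define \<rho> where "\<rho> j = min (\<psi> (H j) / C) (CT / real b ^ (j * Suc d))" for j
  have b0: "real b > 0" and b1: "real b > 1" using b_ge_2 by auto
  \<comment> \<open>A zero of \<open>\<psi>\<close> would make all later terms of the series vanish,
    so divergence forces the positivity that \<open>limsup_AE\<close> asks of the radii.\<close>
  have pos: "\<psi> x > 0" if x: "x \<ge> 0" for x
  proof (rule ccontr)
    assume "\<not> ?thesis"
    then have "\<psi> x = 0" using \<psi>(1)[OF x] by simp
    have "\<psi> (real q) = 0" if q: "q \<ge> nat \<lceil>x\<rceil>" for q
    proof -
      have "x \<le> real q" using q by linarith
      then have "\<psi> (real q) \<le> \<psi> x" using \<psi>(2) x by (auto simp: monotone_on_def)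
      then show ?thesis using \<open>\<psi> x = 0\<close> \<psi>(1)[of "real q"] by simp
    qed
    then have "summable (\<lambda>q. real q ^ d * \<psi> (real q) ^ d)"
      using d_pos by (intro summable_finite[of "{..<nat \<lceil>x\<rceil>}"]) (auto simp: not_less)
    then show False using div by simp
  qed
  have \<rho>0: "\<rho> j > 0" for j
    using pos[of "H j"] C CT b0 by (simp add: \<rho>_def H_def)
  have \<rho>_le: "\<rho> j \<le> CT / real b ^ (j * Suc d)" for j by (simp add: \<rho>_def)
  have \<rho>_\<psi>: "C * \<rho> j \<le> \<psi> (H j)" for j
  proof -
    have "\<rho> j \<le> \<psi> (H j) / C" by (simp add: \<rho>_def)
    then show ?thesis using C by (simp add: field_simps)
  qed
  have DCD: "D * CD > 0" using D consts_pos by simp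
  have "\<not> summable (\<lambda>j. (\<rho> j / (CT / real b ^ (j * Suc d))) ^ d)"
    unfolding \<rho>_def H_def
    using \<psi>(1) by (rule not_summable_truncated[OF _ \<psi>(2) DCD b_ge_2 d_pos C CT div])
  from AE[OF \<rho>0 \<rho>_le this] show ?thesis
  proof eventually_elim
    case (elim x)
    show ?case
    proof (intro allI impI)
      fix \<epsilon> :: real
      assume \<epsilon>: "\<epsilon> > 0"
      obtain k0 where k0: "\<And>k. k \<ge> k0 \<Longrightarrow> 1 / real b ^ k < \<epsilon> / CT"
        using eventually_small_cells[of "\<epsilon> / CT"] \<epsilon> CT by auto
      obtain j where j: "j \<ge> k0" "x \<in> approx_set \<rho> j" using elim by blast
      then obtain p where p: "p \<in> P" "int_height p \<le> CD * b ^ (j * d)" "near (\<rho> j) x (int_vec p)"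
        by (auto simp: approx_set_def mem_tube)
      have "CT * (1 / real b ^ (j * Suc d)) < CT * (\<epsilon> / CT)"
        using j CT by (intro mult_strict_left_mono k0) auto
      then have "\<rho> j < \<epsilon>" using \<rho>_le[of j] CT by simp
      then show "\<exists>\<rho> j p. 0 < \<rho> \<and> \<rho> < \<epsilon> \<and> p \<in> P \<and> near \<rho> x (int_vec p) \<and>
        C * \<rho> \<le> \<psi> (real (D * CD * b ^ (j * d))) \<and> int_height p \<le> CD * b ^ (j * d)"
        using p \<rho>0[of j] \<rho>_\<psi>[of j] unfolding H_def by blast
    qed
  qed
qed

text \<open>For almost every \<open>x\<close> all rational points are at positive distance. If only
  finitely many were admissible, a radius below the least of their distances would produce a further
  one.\<close>

theorem proj_measure_approximable:
  fixes \<beta> :: "('k::rat_completion, 'n::{finite,linorder}) vec measure" and \<psi> :: "real \<Rightarrow> real"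
  assumes kh: "projective_khinchin \<beta> cell d b CD P cM CM cS CC KC"
    and \<psi>: "\<And>x. x \<ge> 0 \<Longrightarrow> \<psi> x \<ge> 0" "antimono_on {0..} \<psi>"
    and div: "\<not> summable (\<lambda>q. real q ^ d * \<psi> (real q) ^ d)"
  shows "proj_measure \<beta> (approximable \<psi>) = 1"
proof -
  interpret projective_khinchin \<beta> cell d b CD P cM CM cS CC KC by fact
  define n where "n = CARD('n)"
  have n: "n > 0" by (simp add: n_def)
  have irr: "AE x in \<beta>. \<forall>q :: (rat, 'n) vec. q \<noteq> 0 \<longrightarrow> \<not> near 0 x (\<chi> i. of_rat (q $ i))"
  proof (subst AE_all_countable, rule allI)
    fix q :: "(rat, 'n) vec"
    show "AE x in \<beta>. q \<noteq> 0 \<longrightarrow> \<not> near 0 x (\<chi> i. of_rat (q $ i))"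
    proof (cases "q = 0")
      case False
      then have "(\<chi> i. of_rat (q $ i)) \<noteq> (0 :: ('k, 'n) vec)" by (simp add: vec_eq_iff)
      from AE_not_in[OF line_null[OF this]] show ?thesis by (simp add: mem_tube)
    qed simp
  qed
  have nonzero: "AE x in \<beta>. x \<noteq> 0"
  proof -
    \<comment> \<open>Any line contains the origin.\<close>
    have "tube 0 1 \<in> null_sets \<beta>" by (rule line_null) simp
    from AE_not_in[OF this] show ?thesis
      by eventually_elim (auto simp: mem_tube near_def)
  qed
  have "real (n ^ 2) > 0" using n by simp
  then have "AE x in \<beta>. \<forall>\<epsilon>>0. \<exists>\<rho> j p. 0 < \<rho> \<and> \<rho> < \<epsilon> \<and> p \<in> P \<and> near \<rho> x (int_vec p) \<and>
      real (n ^ 2) * \<rho> \<le> \<psi> (real (n * CD * b ^ (j * d))) \<and> int_height p \<le> CD * b ^ (j * d)"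
    using \<psi>(1) by (intro AE_infinitely_often_close \<psi>(2) div n)
  then have AE: "AE x in \<beta>. x \<noteq> 0 \<and> to_proj x \<in> (approximable \<psi> :: ('k, 'n) proj set)"
    using irr nonzero
  proof eventually_elim
    case (elim x)
    note close = elim(1) and irr = elim(2) and x = elim(3)
    define Y where "Y = {y :: (rat, 'n) proj. proj_dist (to_proj x) (proj_of_rat y) \<le> \<psi> (height y)}"
    have pos: "proj_dist (to_proj x) (proj_of_rat y) > 0" for y :: "(rat, 'n) proj"
    proof -
      obtain q :: "(rat, 'n) vec" where q: "q \<noteq> 0"
        "proj_of_rat y = to_proj ((\<chi> i. of_rat (q $ i)) :: ('k, 'n) vec)"
        by (rule proj_of_rat_cases)
      have "(\<chi> i. of_rat (q $ i)) \<noteq> (0 :: ('k, 'n) vec)" using q by (simp add: vec_eq_iff)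
      then show ?thesis using q x irr by (auto intro: proj_dist_pos)
    qed
    have "infinite Y"
    proof
      assume fin: "finite Y"
      \<comment> \<open>The 1 keeps the minimum defined in case \<open>Y\<close> is empty.\<close>
      define m where "m = Min (insert 1 ((\<lambda>y. proj_dist (to_proj x) (proj_of_rat y :: ('k, 'n) proj)) ` Y))"
      have m: "m > 0" unfolding m_def using fin pos by (subst Min_gr_iff) auto
      then have "m / real (n ^ 2) > 0" using n by simp
      with close obtain \<rho> j p where p: "0 < \<rho>" "\<rho> < m / real (n ^ 2)" "p \<in> P" "near \<rho> x (int_vec p)"
          "real (n ^ 2) * \<rho> \<le> \<psi> (real (n * CD * b ^ (j * d)))" "int_height p \<le> CD * b ^ (j * d)"
        by blast
      define y where "y = to_proj (rat_vec p)"
      have p0: "p \<noteq> 0" using P_nonzero p by blast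
      have y: "proj_of_rat y = (to_proj (int_vec p) :: ('k, 'n) proj)"
        unfolding y_def using p0 by (rule proj_of_rat_rat_vec)
      have dist: "proj_dist (to_proj x) (proj_of_rat y :: ('k, 'n) proj) \<le> real (n ^ 2) * \<rho>"
        unfolding y n_def using p x p0 by (intro proj_dist_le) auto
      have "height y \<le> real n * int_height p" unfolding y_def n_def by (rule height_rat_vec_le[OF p0])
      also have "\<dots> \<le> real n * (CD * b ^ (j * d))" using p(6) by (intro mult_left_mono) auto
      finally have "height y \<le> real (n * CD * b ^ (j * d))" by (simp add: mult_ac)
      then have "\<psi> (real (n * CD * b ^ (j * d))) \<le> \<psi> (height y)"
        using \<psi>(2) height_nonneg[of y] by (auto simp: monotone_on_def)
      then have "y \<in> Y" using dist p(5) by (simp add: Y_def)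
      then have "m \<le> proj_dist (to_proj x) (proj_of_rat y :: ('k, 'n) proj)"
        unfolding m_def using fin by (intro Min_le) auto
      also have "\<dots> < m" using dist p(2) n by (simp add: field_simps)
      finally show False by simp
    qed
    then show ?case using x by (simp add: approximable_def Y_def)
  qed
  define A where "A = {x. x \<noteq> 0 \<and> to_proj x \<in> (approximable \<psi> :: ('k, 'n) proj set)}"
  define B where "B = {x :: ('k, 'n) vec. vec_norm x \<le> 1}"
  have As: "A \<in> sets \<beta>" unfolding A_def sets_eq by (rule sets_approximable)
  have "B = {x \<in> space borel. vec_norm x \<le> 1}" by (simp add: B_def)
  also have "\<dots> \<in> sets borel" using borel_measurable_vec_norm by (intro borel_measurable_le) auto
  finally have Bs: "B \<in> sets \<beta>" by (simp add: sets_eq)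
  have B_sub: "B \<subseteq> sup_ball 0 1"
    using sup_norm_le_vec_norm order_trans by (fastforce simp: B_def mem_sup_ball)
  have Bfm: "B \<in> fmeasurable \<beta>" using fmeasurableI2[OF sup_ball_fmeasurable B_sub Bs] .
  \<comment> \<open>Gives \<open>B\<close> positive measure, which makes the quotient in
    \<open>proj_measure\<close> equal to 1.\<close>
  have sub_B: "sup_ball 0 (1 / real n) \<subseteq> B"
  proof
    fix x :: "('k, 'n) vec" assume "x \<in> sup_ball 0 (1 / real n)"
    then have "real n * sup_norm x \<le> real n * (1 / real n)" by (intro mult_left_mono) (auto simp: mem_sup_ball)
    then show "x \<in> B" using vec_norm_le_sup_norm[of x] n by (simp add: B_def n_def)
  qed
  have "0 < cM * (1 / real n) ^ Suc d" using consts_pos n by simp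
  also have "\<dots> \<le> measure \<beta> (sup_ball 0 (1 / real n))" using n by (intro ball_lb) auto
  also have "\<dots> \<le> measure \<beta> B" by (rule measure_le_fm[OF sub_B]) (auto intro: Bfm)
  finally have "measure \<beta> B > 0" .
  moreover have "measure \<beta> (A \<inter> B) = measure \<beta> B"
    by (rule measure_eq_AE) (use AE As Bs in \<open>auto simp: A_def\<close>)
  ultimately show ?thesis
    unfolding proj_measure_def by (simp add: A_def B_def)
qed

section \<open>Counting integer points near a line\<close>

lemma near_commute: "near \<rho> x e \<longleftrightarrow> near \<rho> e x"
proof -
  have "near \<rho> e x" if "near \<rho> x e" for x e :: "'a ^ 'b"
    unfolding near_def
  proof (intro allI)
    fix i j
    have "vabs (e $ i * x $ j - e $ j * x $ i) = vabs (x $ j * e $ i - x $ i * e $ j)"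
      by (simp add: mult.commute)
    also have "\<dots> \<le> \<rho> * sup_norm x * sup_norm e" using that unfolding near_def by blast
    finally show "vabs (e $ i * x $ j - e $ j * x $ i) \<le> \<rho> * sup_norm e * sup_norm x"
      by (simp add: mult_ac)
  qed
  then show ?thesis by blast
qed

text \<open>
  Integer points near a line: one coordinate is free, and each of the others lies within
  \<open>r * L\<close> of a number determined by it.
\<close>

lemma count_integer_points_near_line:
  fixes x :: "'k::rat_completion ^ 'n"
  assumes x: "x \<noteq> 0" and h: "h \<ge> 1" and r: "0 < r" and d: "CARD('n) = Suc d"
    and L: "\<And>z. z \<in> P \<Longrightarrow> int_height z \<le> h \<Longrightarrow> sup_norm (int_vec z :: 'k ^ 'n) \<le> L"
    and one: "\<And>a :: 'k. real (card {m. real_of_int \<bar>m\<bar> \<le> h \<and> vabs (of_int m - a) \<le> r * L}) \<le> 2 * h * r + 1"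
  shows "real (card {z \<in> P. int_height z \<le> h \<and> near r x (int_vec z)}) \<le> 3 * 2 ^ d * h * (1 + h * r) ^ d"
proof -
  define M where "M = {m :: int. real_of_int \<bar>m\<bar> \<le> h}"
  have M_eq: "M = {- \<lfloor>h\<rfloor>..\<lfloor>h\<rfloor>}" by (auto simp: M_def abs_le_iff le_floor_iff) linarith+
  have finM: "finite M" by (simp add: M_eq)
  have cardM: "real (card M) \<le> 3 * h"
  proof -
    have "0 \<le> \<lfloor>h\<rfloor>" using h by simp
    then have "real (card M) = 2 * real_of_int \<lfloor>h\<rfloor> + 1" by (simp add: M_eq)
    then show ?thesis using h of_int_floor_le[of h] by linarith
  qed
  obtain i where i: "sup_norm x = vabs (x $ i)" by (rule sup_norm_attained)
  have "vabs (x $ i) > 0" using x unfolding i[symmetric] by simp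
  then have xi: "vabs (x $ i) > 0" "x $ i \<noteq> 0" by auto
  define A where "A m j = (if j = i then {m} else
    {k. real_of_int \<bar>k\<bar> \<le> h \<and> vabs (of_int k - x $ j / x $ i * of_int m) \<le> r * L})" for m :: int and j
  have finA: "finite (A m j)" for m j
  proof -
    have "A m j \<subseteq> insert m M" by (auto simp: A_def M_def)
    then show ?thesis using finM by (auto intro: finite_subset)
  qed
  have sub: "{z \<in> P. int_height z \<le> h \<and> near r x (int_vec z)} \<subseteq> (\<Union>m\<in>M. {z. \<forall>j. z $ j \<in> A m j})"
  proof
    fix z assume "z \<in> {z \<in> P. int_height z \<le> h \<and> near r x (int_vec z)}"
    then have z: "z \<in> P" "int_height z \<le> h" and near: "near r x (int_vec z)" by auto
    have zh: "real_of_int \<bar>z $ j\<bar> \<le> h" for j using int_height_ge[of z j] z by simp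
    have "z $ j \<in> A (z $ i) j" for j
    proof (cases "j = i")
      case False
      have "vabs (x $ i * of_int (z $ j) - x $ j * of_int (z $ i)) \<le> r * vabs (x $ i) * sup_norm (int_vec z :: 'k ^ 'n)"
        using near unfolding near_def i by (simp add: int_vec_def)
      also have "\<dots> \<le> r * vabs (x $ i) * L" using L[OF z] r by (intro mult_left_mono) auto
      finally have le: "vabs (x $ i * of_int (z $ j) - x $ j * of_int (z $ i)) \<le> r * vabs (x $ i) * L" .
      have "of_int (z $ j) - x $ j / x $ i * of_int (z $ i)
          = (x $ i * of_int (z $ j) - x $ j * of_int (z $ i)) / x $ i"
        using xi by (simp add: field_simps)
      then have "vabs (of_int (z $ j) - x $ j / x $ i * of_int (z $ i))
          = vabs (x $ i * of_int (z $ j) - x $ j * of_int (z $ i)) / vabs (x $ i)"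
        by (simp only: vabs_divide)
      also have "\<dots> \<le> r * L" using le xi by (simp add: pos_divide_le_eq mult_ac)
      finally show ?thesis using False zh by (simp add: A_def)
    qed (simp add: A_def)
    moreover have "z $ i \<in> M" using zh by (simp add: M_def)
    ultimately show "z \<in> (\<Union>m\<in>M. {z. \<forall>j. z $ j \<in> A m j})" by blast
  qed
  have card_box: "real (card {z :: int ^ 'n. \<forall>j. z $ j \<in> A m j}) \<le> (2 * h * r + 1) ^ d" for m
  proof -
    have "real (card {z :: int ^ 'n. \<forall>j. z $ j \<in> A m j}) = (\<Prod>j\<in>UNIV. real (card (A m j)))"
      using finite_vec_Collect(2)[of "A m"] finA by simp
    also have "\<dots> = real (card (A m i)) * (\<Prod>j\<in>UNIV - {i}. real (card (A m j)))"
      by (simp add: prod.remove[of UNIV i])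
    also have "\<dots> = (\<Prod>j\<in>UNIV - {i}. real (card (A m j)))" by (simp add: A_def)
    also have "\<dots> \<le> (\<Prod>j\<in>UNIV - {i}. 2 * h * r + 1)"
    proof (rule prod_mono)
      fix j assume "j \<in> UNIV - {i}"
      then show "0 \<le> real (card (A m j)) \<and> real (card (A m j)) \<le> 2 * h * r + 1"
        using one[of "x $ j / x $ i * of_int m"] by (simp add: A_def)
    qed
    also have "\<dots> = (2 * h * r + 1) ^ d" using d by (simp add: card_Diff_singleton)
    finally show ?thesis .
  qed
  have "real (card {z \<in> P. int_height z \<le> h \<and> near r x (int_vec z)})
      \<le> real (card (\<Union>m\<in>M. {z. \<forall>j. z $ j \<in> A m j}))"
    using finM finA by (intro of_nat_mono card_mono sub finite_UN_I finite_vec_Collect(1))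
  also have "\<dots> \<le> (\<Sum>m\<in>M. real (card {z :: int ^ 'n. \<forall>j. z $ j \<in> A m j}))"
    using of_nat_mono[OF card_UN_le[OF finM, of "\<lambda>m. {z :: int ^ 'n. \<forall>j. z $ j \<in> A m j}"], where 'a = real] by simp
  also have "\<dots> \<le> (\<Sum>m\<in>M. (2 * h * r + 1) ^ d)" by (intro sum_mono card_box)
  also have "\<dots> = real (card M) * (2 * h * r + 1) ^ d" by simp
  also have "\<dots> \<le> 3 * h * (2 * (1 + h * r)) ^ d"
    using cardM h r by (intro mult_mono power_mono) (auto simp: algebra_simps)
  also have "\<dots> = 3 * 2 ^ d * h * (1 + h * r) ^ d" by (simp only: power_mult_distrib mult_ac)
  finally show ?thesis .
qed

section \<open>The real case\<close>

lemma vabs_real: "vabs (x :: real) = \<bar>x\<bar>"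
  by (rule vabs_real_def)

lemma sup_norm_int_vec_real: "sup_norm (int_vec z :: real ^ 'n) = int_height z"
  by (simp add: sup_norm_def int_height_def int_vec_def vabs_real)

lemma sup_ball_real: "sup_ball (z :: real ^ 'n) r = cbox (\<chi> i. z $ i - r) (\<chi> i. z $ i + r)"
  by (auto simp: sup_ball_def sup_norm_le_iff vabs_real mem_box_cart abs_le_iff) (smt (verit))+

lemma measure_sup_ball_real:
  assumes "r > 0"
  shows "measure lborel (sup_ball (z :: real ^ 'n) r) = (2 * r) ^ CARD('n)"
proof -
  have "cbox ((\<chi> i. z $ i - r) :: real ^ 'n) (\<chi> i. z $ i + r) \<noteq> {}"
  proof -
    have "z \<in> cbox (\<chi> i. z $ i - r) (\<chi> i. z $ i + r)" using assms by (simp add: mem_box_cart)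
    then show ?thesis by blast
  qed
  then show ?thesis
    by (simp add: sup_ball_real content_cbox_cart)
qed

text \<open>Half-open dyadic cubes of side \<open>2 / 2 ^ k\<close>. The division by 2 inside the
  floor makes the ball of radius \<open>1 / 2 ^ k\<close> about the centre the closure of the cube,
  in agreement with \<open>cell_ball\<close>.\<close>

definition real_cell :: "nat \<Rightarrow> real ^ 'n \<Rightarrow> (real ^ 'n) set" where
  "real_cell k x = {u. \<forall>i. \<lfloor>2 ^ k * (u $ i) / 2\<rfloor> = \<lfloor>2 ^ k * (x $ i) / 2\<rfloor>}"

lemma nested_cells_real: "nested_cells lborel (real_cell :: nat \<Rightarrow> real ^ 'n \<Rightarrow> (real ^ 'n) set)"
proof
  fix k :: nat and x y :: "real ^ 'n"
  show "x \<in> real_cell k x" by (simp add: real_cell_def)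
  show "y \<in> real_cell k x \<Longrightarrow> real_cell k y = real_cell k x" by (simp add: real_cell_def)
  have eq: "\<lfloor>2 ^ k * t / 2\<rfloor> = \<lfloor>2 ^ Suc k * t / 2\<rfloor> div 2" for t :: real
    using floor_divide_real_eq_div[of 2 "2 ^ Suc k * t / 2"] by (simp add: mult_ac)
  show "real_cell (Suc k) x \<subseteq> real_cell k x"
    unfolding real_cell_def eq by auto
  have "range (real_cell k :: real ^ 'n \<Rightarrow> _) \<subseteq> range (\<lambda>c :: int ^ 'n. {u. \<forall>i. \<lfloor>2 ^ k * (u $ i) / 2\<rfloor> = c $ i})"
  proof
    fix C assume "C \<in> range (real_cell k :: real ^ 'n \<Rightarrow> _)"
    then obtain x :: "real ^ 'n" where "C = real_cell k x" by blast
    then have "C = {u. \<forall>i. \<lfloor>2 ^ k * (u $ i) / 2\<rfloor> = (\<chi> i. \<lfloor>2 ^ k * (x $ i) / 2\<rfloor>) $ i}" by (simp add: real_cell_def)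
    then show "C \<in> range (\<lambda>c :: int ^ 'n. {u. \<forall>i. \<lfloor>2 ^ k * (u $ i) / 2\<rfloor> = c $ i})" by blast
  qed
  then show "countable (range (real_cell k :: real ^ 'n \<Rightarrow> _))" by (rule countable_subset) simp
  have "real_cell k x = (\<Inter>i\<in>UNIV. (\<lambda>u :: real ^ 'n. \<lfloor>2 ^ k * (u $ i) / 2\<rfloor>) -` {\<lfloor>2 ^ k * (x $ i) / 2\<rfloor>} \<inter> space borel)"
    by (auto simp: real_cell_def)
  also have "\<dots> \<in> sets borel"
  proof (intro sets.finite_INT)
    fix i
    have "(\<lambda>u :: real ^ 'n. 2 ^ k * (u $ i) / 2) \<in> borel_measurable borel"
      by (intro borel_measurable_continuous_onI continuous_intros) auto
    then have "(\<lambda>u :: real ^ 'n. \<lfloor>2 ^ k * (u $ i) / 2\<rfloor>) \<in> measurable borel (count_space UNIV)"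
      by measurable
    then show "(\<lambda>u :: real ^ 'n. \<lfloor>2 ^ k * (u $ i) / 2\<rfloor>) -` {\<lfloor>2 ^ k * (x $ i) / 2\<rfloor>} \<inter> space borel \<in> sets borel"
      by (rule measurable_sets) simp
  qed auto
  finally show "real_cell k x \<in> sets lborel" by simp
qed

lemma real_cell_ball:
  "\<exists>z. sup_ball z (1 / real 2 ^ k / 2) \<subseteq> real_cell k x \<and> real_cell k x \<subseteq> sup_ball z (1 / real 2 ^ k)"
proof -
  define s :: real where "s = 1 / 2 ^ k"
  have s: "s > 0" by (simp add: s_def)
  define z where "z = (\<chi> i. (2 * real_of_int \<lfloor>2 ^ k * (x $ i) / 2\<rfloor> + 1) * s)"
  have key: "2 ^ k * u / 2 = (u / s) / 2" for u :: real by (simp add: s_def)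
  have 1: "\<lfloor>2 ^ k * u / 2\<rfloor> = m" if "\<bar>u - (2 * real_of_int m + 1) * s\<bar> \<le> s / 2" for u m
  proof -
    have "(2 * real_of_int m + 1) * s - s / 2 \<le> u" "u \<le> (2 * real_of_int m + 1) * s + s / 2"
      using that unfolding abs_le_iff by linarith+
    then have "2 * real_of_int m + 1/2 \<le> u / s" "u / s \<le> 2 * real_of_int m + 3/2"
      using s by (auto simp: field_simps)
    then show ?thesis unfolding key by (intro floor_unique) auto
  qed
  have 2: "\<bar>u - (2 * real_of_int m + 1) * s\<bar> \<le> s" if "\<lfloor>2 ^ k * u / 2\<rfloor> = m" for u m
  proof -
    have "real_of_int m \<le> u / s / 2" "u / s / 2 < real_of_int m + 1"
      using that unfolding key by linarith+
    then have "2 * real_of_int m * s \<le> u" "u \<le> (2 * real_of_int m + 2) * s"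
      using s by (auto simp: field_simps)
    then show ?thesis by (auto simp: abs_le_iff algebra_simps)
  qed
  have "sup_ball z (s / 2) \<subseteq> real_cell k x"
  proof
    fix u assume "u \<in> sup_ball z (s / 2)"
    then have "\<bar>(u - z) $ i\<bar> \<le> s / 2" for i
      using sup_norm_ge[of "u - z" i] by (simp add: mem_sup_ball vabs_real)
    then have "\<lfloor>2 ^ k * (u $ i) / 2\<rfloor> = \<lfloor>2 ^ k * (x $ i) / 2\<rfloor>" for i
      by (intro 1) (simp add: z_def)
    then show "u \<in> real_cell k x" by (simp add: real_cell_def)
  qed
  moreover have "real_cell k x \<subseteq> sup_ball z s"
  proof
    fix u assume "u \<in> real_cell k x"
    then have "\<lfloor>2 ^ k * (u $ i) / 2\<rfloor> = \<lfloor>2 ^ k * (x $ i) / 2\<rfloor>" for i by (simp add: real_cell_def)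
    from 2[OF this] have "vabs ((u - z) $ i) \<le> s" for i by (simp add: vabs_real z_def)
    then show "u \<in> sup_ball z s" by (simp add: mem_sup_ball sup_norm_le_iff)
  qed
  ultimately show ?thesis by (auto simp: s_def)
qed

text \<open>Multiples of \<open>2 * \<eta>\<close> between 0 and \<open>s\<close>; their spacing
  exceeds \<open>\<eta>\<close> strictly.\<close>

lemma separated_real:
  fixes \<eta> s :: real
  assumes "0 < \<eta>" "\<eta> \<le> s"
  shows "\<exists>F. finite F \<and> (\<forall>f\<in>F. vabs f \<le> s) \<and>
    (\<forall>f\<in>F. \<forall>g\<in>F. f \<noteq> g \<longrightarrow> \<eta> < vabs (f - g :: real)) \<and> 1/2 * s / \<eta> \<le> real (card F)"
proof -
  define N where "N = \<lfloor>s / (2 * \<eta>)\<rfloor>"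
  have N: "0 \<le> N" "real_of_int N * (2 * \<eta>) \<le> s" "s / (2 * \<eta>) \<le> real_of_int N + 1"
  proof -
    have "real_of_int N \<le> s / (2 * \<eta>)" unfolding N_def by (rule of_int_floor_le)
    then show "real_of_int N * (2 * \<eta>) \<le> s" using assms by (simp add: pos_le_divide_eq)
    show "s / (2 * \<eta>) \<le> real_of_int N + 1" unfolding N_def by (rule real_of_int_floor_add_one_ge)
    show "0 \<le> N" using assms by (simp add: N_def)
  qed
  define F where "F = (\<lambda>m. 2 * \<eta> * real_of_int m) ` {0..N}"
  have "card F = nat (N + 1)"
    unfolding F_def using assms by (subst card_image) (auto simp: inj_on_def)
  then have c: "1/2 * s / \<eta> \<le> real (card F)" using N by simp
  have b: "vabs f \<le> s" if "f \<in> F" for f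
  proof -
    obtain m where m: "0 \<le> m" "m \<le> N" "f = 2 * \<eta> * real_of_int m" using \<open>f \<in> F\<close> by (auto simp: F_def)
    have "2 * \<eta> * real_of_int m \<le> 2 * \<eta> * real_of_int N" using assms m by (intro mult_left_mono) auto
    also have "\<dots> \<le> s" using N(2) by (simp add: mult.commute)
    finally have "f \<le> s" by (simp add: m)
    moreover have "0 \<le> f" using m assms by simp
    ultimately show ?thesis by (simp add: vabs_real)
  qed
  have d: "\<eta> < vabs (f - g)" if fg: "f \<in> F" "g \<in> F" "f \<noteq> g" for f g
  proof -
    obtain m l where ml: "f = 2 * \<eta> * real_of_int m" "g = 2 * \<eta> * real_of_int l" using fg by (auto simp: F_def)
    then have "1 \<le> \<bar>m - l\<bar>" using fg by auto
    then have "2 * \<eta> * 1 \<le> 2 * \<eta> * real_of_int \<bar>m - l\<bar>" using assms by (intro mult_left_mono) linarith+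
    also have "\<dots> = \<bar>f - g\<bar>"
      using assms by (simp add: ml abs_mult flip: right_diff_distrib)
    finally show ?thesis using assms by (simp add: vabs_real)
  qed
  show ?thesis using b c d by (intro exI[of _ F]) (simp add: F_def)
qed

text \<open>A grid of step \<open>\<eta>\<close> starting at \<open>a - s\<close>. It has at most
  \<open>2 * s / \<eta> + 1\<close> points, and \<open>\<eta> \<le> s\<close> turns the 1 into a
  further \<open>s / \<eta>\<close>.\<close>

lemma covering_real:
  fixes \<eta> s a :: real
  assumes "0 < \<eta>" "\<eta> \<le> s"
  shows "\<exists>F. finite F \<and> real (card F) \<le> 3 * s / \<eta> \<and>
    (\<forall>t. vabs (t - a) \<le> s \<longrightarrow> (\<exists>f\<in>F. vabs (t - f) \<le> \<eta>))"
proof -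
  define F where "F = (\<lambda>m. a - s + \<eta> * real_of_int m) ` {0..\<lfloor>2 * s / \<eta>\<rfloor>}"
  have "0 \<le> \<lfloor>2 * s / \<eta>\<rfloor>" using assms by simp
  have "card F \<le> card {0..\<lfloor>2 * s / \<eta>\<rfloor>}" unfolding F_def by (rule card_image_le) simp
  then have "real (card F) \<le> real_of_int \<lfloor>2 * s / \<eta>\<rfloor> + 1"
    using \<open>0 \<le> \<lfloor>2 * s / \<eta>\<rfloor>\<close> by (simp add: of_nat_le_iff[symmetric, where 'a = real] del: of_nat_le_iff)
  also have "\<dots> \<le> 2 * s / \<eta> + s / \<eta>" using assms by (intro add_mono of_int_floor_le) simp
  finally have c: "real (card F) \<le> 3 * s / \<eta>" by (simp add: field_simps)
  have "\<exists>f\<in>F. vabs (t - f) \<le> \<eta>" if t: "vabs (t - a) \<le> s" for t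
  proof -
    define y where "y = (t - a + s) / \<eta>"
    have "0 \<le> t - a + s" "t - a + s \<le> 2 * s" using t by (auto simp: vabs_real abs_le_iff)
    then have y: "0 \<le> y" "y \<le> 2 * s / \<eta>"
      unfolding y_def using assms by (auto intro: divide_right_mono)
    have "a - s + \<eta> * real_of_int \<lfloor>y\<rfloor> \<in> F"
      unfolding F_def using y by (intro imageI) (auto intro: floor_mono)
    moreover have "t - (a - s + \<eta> * real_of_int \<lfloor>y\<rfloor>) = \<eta> * (y - real_of_int \<lfloor>y\<rfloor>)"
      using assms by (simp add: y_def right_diff_distrib)
    moreover have "vabs (\<eta> * (y - real_of_int \<lfloor>y\<rfloor>)) \<le> \<eta> * 1"
      unfolding vabs_real abs_mult using assms by (intro mult_mono) (auto, linarith)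
    ultimately show ?thesis by (metis mult.right_neutral)
  qed
  then show ?thesis using c by (intro exI[of _ F]) (auto simp: F_def)
qed

text \<open>The ratios of the coordinates to the largest one are approximated simultaneously with a
  common denominator \<open>q \<le> 2 ^ (j * d)\<close>. Since these ratios are at most 1 in
  absolute value, the numerators are hardly larger than \<open>q\<close>.\<close>

lemma Dirichlet_real:
  fixes x :: "real ^ 'n"
  assumes x: "x \<noteq> 0" and d: "CARD('n) = Suc d"
  shows "\<exists>z\<in>{z. z \<noteq> 0}. int_height z \<le> real 2 * real 2 ^ (j * d) \<and>
    near (real 2 / (real 2 ^ j * int_height z)) x (int_vec z)"
proof -
  obtain i where i: "sup_norm x = vabs (x $ i)" by (rule sup_norm_attained)
  have "vabs (x $ i) > 0" using x unfolding i[symmetric] by simp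
  then have xi: "x $ i \<noteq> 0" by auto
  have "card (UNIV - {i}) = d" using d by (simp add: card_Diff_singleton)
  then obtain e where e: "bij_betw e {0..<d} (UNIV - {i})"
    using ex_bij_betw_nat_finite[of "UNIV - {i}"] by auto
  define \<theta> where "\<theta> j = x $ j / x $ i" for j
  have \<theta>: "\<bar>\<theta> j\<bar> \<le> 1" for j
    using sup_norm_ge[of x j] xi by (simp add: i \<theta>_def vabs_real abs_divide divide_le_eq)
  obtain q p where qp: "0 < q" "q \<le> int ((2 ^ j) ^ d)"
    "\<And>l. l < d \<Longrightarrow> \<bar>of_int q * \<theta> (e l) - of_int (p l)\<bar> < 1 / real (2 ^ j)"
    using Dirichlet_approx_simult[of "2 ^ j" d "\<lambda>l. \<theta> (e l)"] by auto
  define z :: "int ^ 'n" where "z = (\<chi> l. if l = i then q else p (inv_into {0..<d} e l))"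
  have zi: "z $ i = q" by (simp add: z_def)
  have close: "\<bar>of_int (z $ l) - \<theta> l * of_int q\<bar> \<le> 1 / 2 ^ j" for l
  proof (cases "l = i")
    case True
    then show ?thesis using xi by (simp add: zi \<theta>_def)
  next
    case False
    then have l: "l \<in> e ` {0..<d}" using e by (auto simp: bij_betw_def)
    define m where "m = inv_into {0..<d} e l"
    have "m < d" "e m = l" using inv_into_into[OF l] f_inv_into_f[OF l] by (auto simp: m_def)
    then show ?thesis using qp(3)[of m] False by (simp add: z_def m_def[symmetric] abs_minus_commute mult.commute)
  qed
  have z0: "z \<noteq> 0" using zi qp(1) by auto
  have q_le: "real_of_int q \<le> 2 ^ (j * d)"
  proof -
    have "real_of_int q \<le> real_of_int (int ((2 ^ j) ^ d))" using qp(2) by (simp only: of_int_le_iff)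
    then show ?thesis by (simp add: power_mult)
  qed
  have ht: "int_height z \<le> 2 * 2 ^ (j * d)"
    unfolding int_height_le_iff
  proof
    fix l
    have "real_of_int \<bar>z $ l\<bar> \<le> \<bar>\<theta> l * of_int q\<bar> + 1 / 2 ^ j" using close[of l] by (simp add: abs_le_iff) linarith
    also have "\<bar>\<theta> l * of_int q\<bar> \<le> 1 * real_of_int q"
      unfolding abs_mult using \<theta>[of l] qp(1) by (intro mult_mono) auto
    also have "1 * real_of_int q + 1 / 2 ^ j \<le> 2 ^ (j * d) + 2 ^ (j * d)"
    proof (intro add_mono)
      have "(1::real) / 2 ^ j \<le> 1" by simp
      also have "(1::real) \<le> 2 ^ (j * d)" by simp
      finally show "(1::real) / 2 ^ j \<le> 2 ^ (j * d)" .
    qed (use q_le in simp)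
    finally show "real_of_int \<bar>z $ l\<bar> \<le> 2 * 2 ^ (j * d)" by simp
  qed
  have hpos: "int_height z > 0" using int_height_ge_1[OF z0] by linarith
  have "int_vec z - (of_int q / x $ i) *s x = (\<chi> l. of_int (z $ l) - \<theta> l * of_int q)"
    by (simp add: vec_eq_iff int_vec_def \<theta>_def)
  then have "sup_norm (int_vec z - (of_int q / x $ i) *s x) \<le> 1 / 2 ^ j"
    using close by (simp add: sup_norm_le_iff vabs_real)
  \<comment> \<open>The real sup norm of \<open>int_vec z\<close> is its height, so an absolute
    error \<open>1 / 2 ^ j\<close> is a relative error with the height in the denominator.\<close>
  also have "\<dots> = (1 / (2 ^ j * int_height z)) * sup_norm (int_vec z :: real ^ 'n)"
    using hpos by (simp add: sup_norm_int_vec_real)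
  finally have "near (2 * (1 / (2 ^ j * int_height z))) (int_vec z) x"
    by (rule close_to_line_imp_near)
  then have "near (2 / (2 ^ j * int_height z)) x (int_vec z)" by (simp add: near_commute)
  then show ?thesis using z0 ht by auto
qed

lemma projective_khinchin_real:
  assumes d: "CARD('n::finite) = Suc d" "d > 0"
  shows "projective_khinchin lborel (real_cell :: nat \<Rightarrow> real ^ 'n \<Rightarrow> _) d 2 2 {z. z \<noteq> 0}
    (2 ^ Suc d) (2 ^ Suc d) (1/2) 3 (3 * 2 ^ d)"
proof (intro projective_khinchin.intro nested_cells_real projective_khinchin_axioms.intro)
  fix x :: "real ^ 'n" and r :: real
  show "emeasure lborel (sup_ball x r) < \<infinity>" unfolding sup_ball_real by (rule emeasure_lborel_cbox_finite)
  show "2 ^ Suc d * r ^ Suc d \<le> measure lborel (sup_ball x r)" if "0 < r"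
    unfolding measure_sup_ball_real[OF that] d(1) power_mult_distrib ..
  show "measure lborel (sup_ball x r) \<le> 2 ^ Suc d * r ^ Suc d" if "0 < r"
    unfolding measure_sup_ball_real[OF that] d(1) power_mult_distrib ..
next
  fix x :: "real ^ 'n" and h r :: real
  assume x: "x \<noteq> 0" "h \<ge> 1" "0 < r" "r \<le> 1"
  show "real (card {z \<in> {z. z \<noteq> 0}. int_height z \<le> h \<and> near r x (int_vec z)}) \<le> 3 * 2 ^ d * h * (1 + h * r) ^ d"
  proof (rule count_integer_points_near_line[OF x(1-3) d(1)])
    show "sup_norm (int_vec z :: real ^ 'n) \<le> h" if "int_height z \<le> h" for z
      using that by (simp add: sup_norm_int_vec_real)
    fix a :: real
    have "{m. real_of_int \<bar>m\<bar> \<le> h \<and> vabs (of_int m - a) \<le> r * h} \<subseteq> {\<lceil>a - r * h\<rceil>..\<lfloor>a + r * h\<rfloor>}"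
      by (auto simp: vabs_real abs_le_iff le_floor_iff ceiling_le_iff)
    then have "card {m. real_of_int \<bar>m\<bar> \<le> h \<and> vabs (of_int m - a) \<le> r * h} \<le> card {\<lceil>a - r * h\<rceil>..\<lfloor>a + r * h\<rfloor>}"
      by (intro card_mono) auto
    also have "\<dots> = nat (\<lfloor>a + r * h\<rfloor> + 1 - \<lceil>a - r * h\<rceil>)" by simp
    finally have "card {m. real_of_int \<bar>m\<bar> \<le> h \<and> vabs (of_int m - a) \<le> r * h} \<le> nat (\<lfloor>a + r * h\<rfloor> + 1 - \<lceil>a - r * h\<rceil>)" .
    then have "real (card {m. real_of_int \<bar>m\<bar> \<le> h \<and> vabs (of_int m - a) \<le> r * h})
        \<le> real (nat (\<lfloor>a + r * h\<rfloor> + 1 - \<lceil>a - r * h\<rceil>))" by (rule of_nat_mono)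
    also have "\<dots> \<le> 2 * (r * h) + 1"
    proof (cases "0 \<le> \<lfloor>a + r * h\<rfloor> + 1 - \<lceil>a - r * h\<rceil>")
      case True
      then have "real (nat (\<lfloor>a + r * h\<rfloor> + 1 - \<lceil>a - r * h\<rceil>)) = real_of_int \<lfloor>a + r * h\<rfloor> + 1 - real_of_int \<lceil>a - r * h\<rceil>"
        by simp
      then show ?thesis using of_int_floor_le[of "a + r * h"] le_of_int_ceiling[of "a - r * h"] by linarith
    next
      case False
      then show ?thesis using x by simp
    qed
    finally show "real (card {m. real_of_int \<bar>m\<bar> \<le> h \<and> vabs (of_int m - a) \<le> r * h}) \<le> 2 * h * r + 1"
      by (simp add: mult_ac)
  qed
qed (use d real_cell_ball separated_real covering_real Dirichlet_real[OF _ d(1)] in simp_all)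

section \<open>Arithmetic of p-adic numbers\<close>

lemma prime_card_gt_1: "CARD('p::prime_card) > 1"
  using prime_card prime_gt_1_nat by blast

lemma vabs_of_rat_padic: "vabs (of_rat r :: 'p::prime_card padic) = padic_abs CARD('p) r"
  using vabs_of_rat[of r, where 'a = "'p padic"] by (simp add: place_of_padic_def rat_abs_def)

lemma vabs_of_int_padic: "vabs (of_int m :: 'p::prime_card padic) = padic_abs CARD('p) (of_int m)"
  using vabs_of_rat_padic[of "of_int m"] by simp

lemma vabs_of_int_padic_le_1: "vabs (of_int m :: 'p::prime_card padic) \<le> 1"
  unfolding vabs_of_int_padic
  by (cases "m = 0") (auto simp: padic_abs_def power_int_minus inverse_le_1_iff prime_card
      prime_ge_1_nat intro!: one_le_power)

text \<open>Transferred from the rationals by density; the approximation errors are handled by the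
  ordinary triangle inequality.\<close>

lemma vabs_ultrametric: "vabs (x + y :: 'p::prime_card padic) \<le> max (vabs x) (vabs y)"
proof (rule field_le_epsilon)
  fix e :: real
  assume "e > 0"
  then obtain r s where r: "dist (of_rat r) x < e / 4" and s: "dist (of_rat s) y < e / 4"
    using rat_dense[of "e / 4" x] rat_dense[of "e / 4" y] by auto
  have "vabs (x + y) \<le> vabs (of_rat (r + s) :: 'p padic) + vabs ((x - of_rat r) + (y - of_rat s))"
    using vabs_triangle[of "of_rat (r + s)" "(x - of_rat r) + (y - of_rat s)"] by (simp add: of_rat_add)
  also have "\<dots> \<le> vabs (of_rat (r + s) :: 'p padic) + (vabs (x - of_rat r) + vabs (y - of_rat s))"
    by (intro add_left_mono vabs_triangle)
  also have "\<dots> \<le> max (vabs (of_rat r :: 'p padic)) (vabs (of_rat s :: 'p padic)) + (e / 4 + e / 4)"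
    unfolding vabs_of_rat_padic using r s padic_abs_ultrametric[OF prime_card, of r s]
    by (intro add_mono) (auto simp: dist_vabs vabs_diff_commute less_imp_le)
  also have "max (vabs (of_rat r :: 'p padic)) (vabs (of_rat s :: 'p padic)) \<le> max (vabs x) (vabs y) + e / 4"
    using vabs_triangle[of x "of_rat r - x"] vabs_triangle[of y "of_rat s - y"] r s
    by (auto simp: dist_vabs max_def)
  finally show "vabs (x + y) \<le> max (vabs x) (vabs y) + e" using \<open>e > 0\<close> by simp
qed

lemma vabs_ultrametric_diff: "vabs (x - y :: 'p::prime_card padic) \<le> max (vabs x) (vabs y)"
  using vabs_ultrametric[of x "- y"] by simp

lemma padic_abs_of_int:
  assumes "m \<noteq> 0"
  shows "padic_abs p (of_int m) = 1 / real p ^ multiplicity (int p) m"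
  using assms by (simp add: padic_abs_def power_int_minus inverse_eq_divide)

lemma vabs_of_int_le_iff:
  "vabs (of_int m :: 'p::prime_card padic) \<le> 1 / real CARD('p) ^ k \<longleftrightarrow> int CARD('p) ^ k dvd m"
proof (cases "m = 0")
  case False
  have p: "real CARD('p) > 1" using prime_card_gt_1[where 'p = 'p] by simp
  have "\<not> is_unit (int CARD('p))" using prime_card_gt_1[where 'p = 'p] by simp
  have "vabs (of_int m :: 'p padic) \<le> 1 / real CARD('p) ^ k
      \<longleftrightarrow> real CARD('p) ^ k \<le> real CARD('p) ^ multiplicity (int CARD('p)) m"
    unfolding vabs_of_int_padic padic_abs_of_int[OF False] using p by (simp add: field_simps)
  also have "\<dots> \<longleftrightarrow> k \<le> multiplicity (int CARD('p)) m" using p by simp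
  also have "\<dots> \<longleftrightarrow> int CARD('p) ^ k dvd m"
    using False \<open>\<not> is_unit _\<close> by (simp add: power_dvd_iff_le_multiplicity)
  finally show ?thesis .
qed simp

lemma vabs_of_int_ge:
  assumes "\<not> int CARD('p) ^ Suc k dvd m"
  shows "vabs (of_int m :: 'p::prime_card padic) \<ge> 1 / real CARD('p) ^ k"
proof -
  have p: "real CARD('p) > 1" using prime_card_gt_1[where 'p = 'p] by simp
  have m: "m \<noteq> 0" using assms by auto
  have "multiplicity (int CARD('p)) m \<le> k"
    using assms multiplicity_dvd'[of "Suc k" "int CARD('p)" m] not_less_eq_eq by blast
  then have "real CARD('p) ^ multiplicity (int CARD('p)) m \<le> real CARD('p) ^ k"
    using p by (intro power_increasing) auto
  then show ?thesis
    unfolding vabs_of_int_padic padic_abs_of_int[OF m] using p by (intro divide_left_mono) auto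
qed

text \<open>Density of the integers in the ball of radius 1: approximate \<open>t\<close> by a
  fraction, whose denominator must be prime to \<open>p\<close>, and invert the denominator modulo
  \<open>p ^ k\<close>.\<close>

lemma padic_residue:
  assumes t: "vabs (t :: 'p::prime_card padic) \<le> 1"
  obtains m where "m \<in> {0..<int CARD('p) ^ k}" "vabs (t - of_int m) \<le> 1 / real CARD('p) ^ k"
proof -
  define p where "p = CARD('p)"
  have p: "prime p" unfolding p_def by (rule prime_card)
  then have p1: "real p > 1" "p > 1" using prime_gt_1_nat[of p] by auto
  obtain r where r: "dist (of_rat r) t < 1 / real p ^ k"
    using rat_dense[of "1 / real p ^ k" t] p1 by auto
  have "1 / real p ^ k \<le> 1" using p1 by simp
  then have "vabs (of_rat r - t) \<le> 1" using r by (simp add: dist_vabs)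
  then have "vabs (of_rat r :: 'p padic) \<le> 1"
    using vabs_ultrametric[of "of_rat r - t" t] t by simp
  then have r1: "padic_abs p r \<le> 1" by (simp add: vabs_of_rat_padic p_def)
  obtain c e where ce: "quotient_of r = (c, e)" by fastforce
  then have e: "e > 0" and cop: "coprime c e" and r_eq: "r = of_int c / of_int e"
    by (auto intro: quotient_of_denom_pos quotient_of_coprime quotient_of_div)
  \<comment> \<open>In lowest terms, a factor \<open>p\<close> of the denominator would push the
    absolute value above 1.\<close>
  have ndvd: "\<not> int p dvd e"
  proof
    assume dvd: "int p dvd e"
    then have "\<not> int p dvd c"
      using cop p by (meson coprime_common_divisor not_prime_unit prime_nat_int_transfer)
    then have c0: "c \<noteq> 0" and mc: "multiplicity (int p) c = 0" by (auto intro: not_dvd_imp_multiplicity_0)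
    have "multiplicity (int p) e \<ge> 1"
      using dvd e p1 by (intro multiplicity_geI) auto
    moreover have "padic_abs p r = real p ^ multiplicity (int p) e"
      using c0 padic_abs_fraction[OF p c0, of e] e mc unfolding r_eq by simp
    moreover have "1 < real p ^ multiplicity (int p) e"
      using calculation(1) p1 by (intro one_less_power) auto
    ultimately show False using r1 p1 by simp
  qed
  then have "coprime (int p) e" using p by (simp add: prime_imp_coprime)
  then have "coprime e (int p ^ k)" by (simp add: coprime_commute)
  then obtain y where y: "[e * y = 1] (mod int p ^ k)" using cong_solve_coprime_int by blast
  define m where "m = (c * y) mod int p ^ k"
  have mr: "m \<in> {0..<int p ^ k}" using p1 by (simp add: m_def)
  have "[e * m = e * (c * y)] (mod int p ^ k)" unfolding m_def by (intro cong_scalar_left) simp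
  also have "e * (c * y) = c * (e * y)" by simp
  also have "[c * (e * y) = c * 1] (mod int p ^ k)" using y by (rule cong_scalar_left)
  finally have "int p ^ k dvd c - e * m" by (simp add: cong_iff_dvd_diff dvd_diff_commute)
  then have le: "vabs (of_int (c - e * m) :: 'p padic) \<le> 1 / real p ^ k"
    unfolding p_def by (simp only: vabs_of_int_le_iff)
  have "vabs (of_int e :: 'p padic) \<ge> 1"
    using vabs_of_int_ge[of 0 e, where 'p = 'p] ndvd by (simp add: p_def)
  have "of_rat r - of_int m = (of_int (c - e * m) / of_int e :: 'p padic)"
    using e by (simp add: r_eq of_rat_divide field_simps)
  then have "vabs (of_rat r - of_int m :: 'p padic) = vabs (of_int (c - e * m) :: 'p padic) / vabs (of_int e :: 'p padic)"
    by (simp only: vabs_divide)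
  moreover have "\<dots> \<le> vabs (of_int (c - e * m) :: 'p padic) / 1"
    using \<open>vabs (of_int e :: 'p padic) \<ge> 1\<close> by (intro divide_left_mono) auto
  ultimately have "vabs (of_rat r - of_int m :: 'p padic) \<le> vabs (of_int (c - e * m) :: 'p padic)" by simp
  then have "vabs (of_rat r - of_int m :: 'p padic) \<le> 1 / real p ^ k" using le by linarith
  moreover have "vabs (t - of_rat r) \<le> 1 / real p ^ k" using r by (simp add: dist_vabs vabs_diff_commute)
  ultimately have "vabs (t - of_int m) \<le> 1 / real p ^ k"
    using vabs_ultrametric[of "t - of_rat r" "of_rat r - of_int m"] by simp
  then show ?thesis using that mr by (simp add: p_def)
qed

lemma padic_residue_unique:
  assumes "vabs (t - of_int m :: 'p::prime_card padic) \<le> 1 / real CARD('p) ^ k"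
    "vabs (t - of_int l) \<le> 1 / real CARD('p) ^ k"
    "m \<in> {0..<int CARD('p) ^ k}" "l \<in> {0..<int CARD('p) ^ k}"
  shows "m = l"
proof -
  have "vabs (of_int (m - l) :: 'p padic) \<le> 1 / real CARD('p) ^ k"
    using vabs_ultrametric_diff[of "t - of_int l" "t - of_int m"] assms by simp
  then have "int CARD('p) ^ k dvd m - l" by (simp only: vabs_of_int_le_iff)
  then have "m mod int CARD('p) ^ k = l mod int CARD('p) ^ k" by (simp only: mod_eq_dvd_iff)
  then show ?thesis using assms by simp
qed

section \<open>Packing, covering and counting at arbitrary real radii\<close>

lemma ex_vabs_powi: "\<exists>c :: 'p::prime_card padic. vabs c = real CARD('p) powi l"
proof -
  have p: "vabs (of_int (int CARD('p)) :: 'p padic) = 1 / real CARD('p)"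
  proof -
    have "multiplicity (int CARD('p)) (int CARD('p)) = 1"
      using prime_card_gt_1[where 'p = 'p] by (intro multiplicity_self) auto
    then show ?thesis
      unfolding vabs_of_int_padic using prime_card_gt_1[where 'p = 'p] by (subst padic_abs_of_int) auto
  qed
  show ?thesis
  proof (cases "l \<ge> 0")
    case True
    then have "vabs (inverse (of_int (int CARD('p))) ^ nat l :: 'p padic) = real CARD('p) powi l"
      unfolding vabs_power vabs_inverse p by (simp add: power_int_def)
    then show ?thesis by blast
  next
    case False
    then have "vabs (of_int (int CARD('p)) ^ nat (- l) :: 'p padic) = real CARD('p) powi l"
      unfolding vabs_power p by (simp add: power_int_def inverse_eq_divide)
    then show ?thesis by blast
  qed
qed

text \<open>The nonzero values of the \<open>p\<close>-adic absolute value are powers of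
  \<open>p\<close>; rounding a radius to one of them costs at most a factor
  \<open>p\<close>.\<close>

lemma powi_bracket:
  assumes "p > (1 :: real)" "r > 0"
  obtains k where "p powi k \<le> r" "r < p powi (k + 1)"
proof -
  define k where "k = \<lfloor>log p r\<rfloor>"
  have powi: "p powi l = p powr real_of_int l" for l
    using assms(1) by (simp add: powr_real_of_int' )
  have "p powr real_of_int k \<le> p powr log p r" "p powr log p r < p powr real_of_int (k + 1)"
    using assms(1) by (auto simp: k_def intro: powr_mono) 
  then show ?thesis using that[of k] assms by (simp add: powi)
qed

lemma padic_residue_scaled:
  fixes a c :: "'p::prime_card padic"
  assumes "vabs (t - a) \<le> vabs c" "c \<noteq> 0"
  obtains m where "m \<in> {0..<int CARD('p) ^ g}" "vabs (t - (a + c * of_int m)) \<le> vabs c / real CARD('p) ^ g"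
proof -
  have c: "vabs c > 0" using assms(2) by (simp add: less_le)
  have "vabs ((t - a) / c) \<le> 1" using assms c by (simp add: vabs_divide)
  then obtain m where m: "m \<in> {0..<int CARD('p) ^ g}" "vabs ((t - a) / c - of_int m) \<le> 1 / real CARD('p) ^ g"
    by (rule padic_residue)
  have "t - (a + c * of_int m) = c * ((t - a) / c - of_int m)" using assms(2) by (simp add: field_simps)
  then have "vabs (t - (a + c * of_int m)) = vabs c * vabs ((t - a) / c - of_int m)" by (simp only: vabs_mult)
  also have "\<dots> \<le> vabs c * (1 / real CARD('p) ^ g)" using m by (intro mult_left_mono) auto
  finally show ?thesis using that m by simp
qed

lemma vabs_residue_diff:
  fixes c :: "'p::prime_card padic"
  assumes "m \<in> {0..<int CARD('p) ^ g}" "l \<in> {0..<int CARD('p) ^ g}" "m \<noteq> l"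
  shows "vabs (c * of_int m - c * of_int l) \<ge> vabs c * (real CARD('p) / real CARD('p) ^ g)"
proof -
  have p: "real CARD('p) > 0" using prime_card_gt_1[where 'p = 'p] by simp
  have nd: "\<not> int CARD('p) ^ g dvd m - l"
  proof
    assume "int CARD('p) ^ g dvd m - l"
    then have "m mod int CARD('p) ^ g = l mod int CARD('p) ^ g" by (simp only: mod_eq_dvd_iff)
    then show False using assms by simp
  qed
  then obtain g' where g: "g = Suc g'" by (cases g) auto
  have "vabs (of_int (m - l) :: 'p padic) \<ge> 1 / real CARD('p) ^ g'"
    using nd unfolding g by (rule vabs_of_int_ge)
  then have "vabs c * (1 / real CARD('p) ^ g') \<le> vabs c * vabs (of_int (m - l) :: 'p padic)"
    by (intro mult_left_mono) auto
  also have "\<dots> = vabs (c * of_int m - c * of_int l)"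
    by (simp add: vabs_mult[symmetric] right_diff_distrib)
  finally show ?thesis using p by (simp add: g)
qed

text \<open>The integers below \<open>p ^ g\<close>, scaled by some \<open>c\<close> with absolute
  value \<open>p powi l \<le> s\<close>. Two of them differ by at least
  \<open>p powi (e + 1)\<close>, which exceeds \<open>\<eta>\<close>. Rounding \<open>s\<close> down
  costs the factor \<open>p\<close>.\<close>

lemma separated_padic:
  assumes "0 < \<eta>" "\<eta> \<le> s"
  shows "\<exists>F. finite F \<and> (\<forall>f\<in>F. vabs f \<le> s) \<and>
    (\<forall>f\<in>F. \<forall>g\<in>F. f \<noteq> g \<longrightarrow> \<eta> < vabs (f - g :: 'p::prime_card padic)) \<and>
    1 / real CARD('p) * s / \<eta> \<le> real (card F)"
proof -
  define p where "p = real CARD('p)"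
  have p: "p > 1" unfolding p_def using prime_card_gt_1[where 'p = 'p] by simp
  obtain l where l: "p powi l \<le> s" "s < p powi (l + 1)" using powi_bracket[OF p, of s] assms by auto
  obtain e where e: "p powi e \<le> \<eta>" "\<eta> < p powi (e + 1)" using powi_bracket[OF p, of \<eta>] assms by auto
  have "p powi e < p powi (l + 1)" using e l assms by linarith
  then have "e \<le> l" using p power_int_increasing[of "l + 1" e p] by (cases "e \<le> l") auto
  define g where "g = nat (l - e)"
  have "p powi (e + int g) = p powi e * p ^ g" using p by (simp add: power_int_add)
  then have pg: "p powi l = p powi e * p ^ g" using \<open>e \<le> l\<close> by (simp add: g_def)
  have pl: "p powi (l + 1) = p powi l * p" "p powi (e + 1) = p powi e * p"
    using p by (simp_all add: power_int_add)
  have pe: "p powi e > 0" using p by simp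
  obtain c :: "'p padic" where c: "vabs c = p powi l" using ex_vabs_powi unfolding p_def by blast
  have c0: "c \<noteq> 0" using c p by auto
  define F where "F = (\<lambda>m. c * of_int m) ` {0..<int CARD('p) ^ g}"
  have "inj_on (\<lambda>m. c * of_int m) {0..<int CARD('p) ^ g}"
    using c0 by (auto simp: inj_on_def)
  then have "card F = CARD('p) ^ g" unfolding F_def by (simp add: card_image nat_power_eq)
  then have cF: "real (card F) = p ^ g" by (simp add: p_def)
  have "1 / p * s / \<eta> \<le> real (card F)"
  proof -
    have "s \<le> p powi e * p ^ g * p" using l pl pg by simp
    also have "\<dots> \<le> \<eta> * p ^ g * p" using e p by (intro mult_right_mono) auto
    finally show ?thesis using p assms by (simp add: cF field_simps)
  qed
  moreover have "vabs f \<le> s" if f: "f \<in> F" for f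
  proof -
    obtain m where "f = c * of_int m" using f by (auto simp: F_def)
    then have "vabs f \<le> vabs c * 1"
      unfolding vabs_mult by (simp only: vabs_mult) (intro mult_left_mono vabs_of_int_padic_le_1 vabs_nonneg)
    then show ?thesis using c l by simp
  qed
  moreover have "\<eta> < vabs (f - h)" if fh: "f \<in> F" "h \<in> F" "f \<noteq> h" for f h
  proof -
    obtain m n where mn: "f = c * of_int m" "h = c * of_int n" "m \<in> {0..<int CARD('p) ^ g}" "n \<in> {0..<int CARD('p) ^ g}"
      using fh by (auto simp: F_def)
    have "\<eta> < p powi l * (p / p ^ g)" using e pl pg p by (simp add: field_simps)
    also have "\<dots> \<le> vabs (f - h)"
      using vabs_residue_diff[of m g n c] mn fh(3) c by (auto simp: p_def)
    finally show ?thesis .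
  qed
  ultimately show ?thesis by (intro exI[of _ F]) (simp add: F_def p_def)
qed

text \<open>Here \<open>s\<close> is rounded up, to the absolute value \<open>p powi (l + 1)\<close>
  of \<open>c\<close>, and \<open>\<eta>\<close> down to \<open>p powi e\<close>; the
  representatives modulo \<open>p ^ g\<close>, scaled by \<open>c\<close> and shifted by
  \<open>a\<close>, then come close enough. Each rounding costs a factor \<open>p\<close>.\<close>

lemma covering_padic:
  assumes "0 < \<eta>" "\<eta> \<le> s"
  shows "\<exists>F. finite F \<and> real (card F) \<le> real CARD('p) ^ 2 * s / \<eta> \<and>
    (\<forall>t. vabs (t - a :: 'p::prime_card padic) \<le> s \<longrightarrow> (\<exists>f\<in>F. vabs (t - f) \<le> \<eta>))"
proof -
  define p where "p = real CARD('p)"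
  have p: "p > 1" unfolding p_def using prime_card_gt_1[where 'p = 'p] by simp
  obtain l where l: "p powi l \<le> s" "s < p powi (l + 1)" using powi_bracket[OF p, of s] assms by auto
  obtain e where e: "p powi e \<le> \<eta>" "\<eta> < p powi (e + 1)" using powi_bracket[OF p, of \<eta>] assms by auto
  have "p powi e < p powi (l + 1)" using e l assms by linarith
  then have "e \<le> l" using p power_int_increasing[of "l + 1" e p] by (cases "e \<le> l") auto
  define g where "g = nat (l + 1 - e)"
  have "p powi (e + int g) = p powi e * p ^ g" using p by (simp add: power_int_add)
  then have pg: "p powi (l + 1) = p powi e * p ^ g" using \<open>e \<le> l\<close> by (simp add: g_def)
  have pl: "p powi (l + 1) = p powi l * p" "p powi (e + 1) = p powi e * p"
    using p by (simp_all add: power_int_add)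
  obtain c :: "'p padic" where c: "vabs c = p powi (l + 1)" using ex_vabs_powi unfolding p_def by blast
  have c0: "c \<noteq> 0" using c p by auto
  define F where "F = (\<lambda>m. a + c * of_int m) ` {0..<int CARD('p) ^ g}"
  have "card F \<le> card {0..<int CARD('p) ^ g}" unfolding F_def by (rule card_image_le) simp
  then have "card F \<le> CARD('p) ^ g" by (simp add: nat_power_eq)
  then have "real (card F) \<le> p ^ g" unfolding p_def by (simp flip: of_nat_power)
  also have "p ^ g \<le> p ^ 2 * s / \<eta>"
  proof -
    have "p ^ g * \<eta> \<le> p ^ g * (p powi e * p)" using e pl p by (intro mult_left_mono) auto
    also have "\<dots> = p powi l * p * p" using pg pl by (simp add: mult_ac)
    also have "\<dots> \<le> s * p * p" using l p by (intro mult_right_mono) auto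
    finally show ?thesis using assms by (simp add: power2_eq_square field_simps)
  qed
  finally have "real (card F) \<le> p ^ 2 * s / \<eta>" .
  moreover have "\<exists>f\<in>F. vabs (t - f) \<le> \<eta>" if t: "vabs (t - a) \<le> s" for t
  proof -
    have "vabs (t - a) \<le> vabs c" using t l c by simp
    then obtain m where m: "m \<in> {0..<int CARD('p) ^ g}" "vabs (t - (a + c * of_int m)) \<le> vabs c / real CARD('p) ^ g"
      using c0 by (rule padic_residue_scaled)
    have "vabs c / real CARD('p) ^ g \<le> \<eta>" using e p by (simp add: c pg p_def[symmetric])
    then show ?thesis using m unfolding F_def by (intro bexI[of _ "a + c * of_int m"]) auto
  qed
  ultimately show ?thesis by (intro exI[of _ F]) (simp add: F_def p_def)
qed

text \<open>Integers within \<open>r\<close> of the same \<open>a\<close> are congruent modulo a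
  power \<open>p ^ k\<close> with \<open>1 / p ^ k \<le> r\<close>, so they belong to one residue
  class, which has at most \<open>2 * h / p ^ k + 1\<close> members between \<open>- h\<close> and
  \<open>h\<close>.\<close>

lemma card_int_near_padic:
  assumes h: "h \<ge> 1" and r: "0 < r"
  shows "real (card {m. real_of_int \<bar>m\<bar> \<le> h \<and> vabs (of_int m - a :: 'p::prime_card padic) \<le> r}) \<le> 2 * h * r + 1"
proof -
  define p where "p = real CARD('p)"
  have p: "p > 1" unfolding p_def using prime_card_gt_1[where 'p = 'p] by simp
  define S where "S = {m. real_of_int \<bar>m\<bar> \<le> h \<and> vabs (of_int m - a) \<le> r}"
  have finS: "finite S"
    by (rule finite_subset[of _ "{- \<lfloor>h\<rfloor>..\<lfloor>h\<rfloor>}"]) (auto simp: S_def abs_le_iff le_floor_iff, linarith)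
  show ?thesis
  proof (cases "S = {}")
    case False
    have "\<exists>k. 1 / p ^ k \<le> r"
      using real_arch_pow_inv[of r "1 / p"] r p by (auto simp: power_divide intro: less_imp_le)
    \<comment> \<open>Minimality matters: \<open>1 / p ^ (k - 1)\<close> exceeds \<open>r\<close> if
      \<open>k > 0\<close>, so a difference of absolute value at most \<open>r\<close> is divisible
      by \<open>p ^ k\<close>.\<close>
    define k where "k = (LEAST k. 1 / p ^ k \<le> r)"
    have k: "1 / p ^ k \<le> r" unfolding k_def using \<open>\<exists>k. _\<close> by (rule LeastI_ex)
    define q where "q = int CARD('p) ^ k"
    have q: "q > 0" "real_of_int q = p ^ k" using prime_card_gt_1[where 'p = 'p] by (auto simp: q_def p_def)
    have dvd: "q dvd m - m0" if "m \<in> S" "m0 \<in> S" for m m0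
    proof -
      have le: "vabs (of_int (m - m0) :: 'p padic) \<le> r"
        using order_trans[OF vabs_ultrametric_diff[of "of_int m - a" "of_int m0 - a"], of r] that
        by (simp add: S_def)
      show ?thesis
      proof (rule ccontr)
        assume nd: "\<not> q dvd m - m0"
        then obtain k' where k': "k = Suc k'" by (cases k) (auto simp: q_def)
        have "1 / p ^ k' \<le> vabs (of_int (m - m0) :: 'p padic)"
          unfolding p_def using nd unfolding q_def k' by (rule vabs_of_int_ge)
        then have "1 / p ^ k' \<le> r" using le by linarith
        then have "k \<le> k'" unfolding k_def by (rule Least_le)
        then show False using k' by simp
      qed
    qed
    define m0 where "m0 = Min S"
    have m0: "m0 \<in> S" unfolding m0_def using finS False by (rule Min_in)
    have "inj_on (\<lambda>m. (m - m0) div q) S"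
    proof (rule inj_onI)
      fix m l assume ml: "m \<in> S" "l \<in> S" "(m - m0) div q = (l - m0) div q"
      then have "(m - m0) div q * q = (l - m0) div q * q" by simp
      then show "m = l" using dvd[OF ml(1) m0] dvd[OF ml(2) m0] by simp
    qed
    then have "card S = card ((\<lambda>m. (m - m0) div q) ` S)" by (simp add: card_image)
    also have "\<dots> \<le> card {0..\<lfloor>2 * h / p ^ k\<rfloor>}"
    proof (rule card_mono)
      show "(\<lambda>m. (m - m0) div q) ` S \<subseteq> {0..\<lfloor>2 * h / p ^ k\<rfloor>}"
      proof
        fix t assume "t \<in> (\<lambda>m. (m - m0) div q) ` S"
        then obtain m where m: "m \<in> S" "t = (m - m0) div q" by blast
        have "m0 \<le> m" unfolding m0_def using finS m by simp
        then have t0: "0 \<le> t" using m q by (simp add: pos_imp_zdiv_nonneg_iff)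
        have "t * q = m - m0" using dvd[OF m(1) m0] m by simp
        then have "real_of_int t * p ^ k = real_of_int (m - m0)" unfolding q(2)[symmetric] by (simp flip: of_int_mult)
        also have "\<dots> \<le> 2 * h" using m(1) m0 by (simp add: S_def abs_le_iff)
        finally have "real_of_int t \<le> 2 * h / p ^ k" using p by (simp add: pos_le_divide_eq)
        then show "t \<in> {0..\<lfloor>2 * h / p ^ k\<rfloor>}" using t0 by (simp add: le_floor_iff)
      qed
    qed simp
    also have "\<dots> = nat (\<lfloor>2 * h / p ^ k\<rfloor> + 1)" by simp
    finally have "real (card S) \<le> real (nat (\<lfloor>2 * h / p ^ k\<rfloor> + 1))" by (rule of_nat_mono)
    also have "\<dots> = real_of_int \<lfloor>2 * h / p ^ k\<rfloor> + 1" using h p by simp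
    also have "\<dots> \<le> 2 * h * (1 / p ^ k) + 1" using of_int_floor_le[of "2 * h / p ^ k"] by simp
    also have "\<dots> \<le> 2 * h * r + 1" using k h by (intro add_right_mono mult_left_mono) auto
    finally show ?thesis by (simp add: S_def)
  next
    case True
    then show ?thesis using h r unfolding S_def[symmetric] by simp
  qed
qed

section \<open>Haar measure\<close>

lemma sup_norm_ultrametric: "sup_norm (x + y :: 'p::prime_card padic ^ 'n) \<le> max (sup_norm x) (sup_norm y)"
  unfolding sup_norm_le_iff
proof
  fix i
  have "vabs ((x + y) $ i) \<le> max (vabs (x $ i)) (vabs (y $ i))" by (simp add: vabs_ultrametric)
  also have "\<dots> \<le> max (sup_norm x) (sup_norm y)" by (intro max.mono sup_norm_ge)
  finally show "vabs ((x + y) $ i) \<le> max (sup_norm x) (sup_norm y)" .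
qed

lemma sup_ball_padic_eq:
  assumes "y \<in> sup_ball (x :: 'p::prime_card padic ^ 'n) r"
  shows "sup_ball y r = sup_ball x r"
proof -
  have sub: "sup_ball y r \<subseteq> sup_ball x r" if "y \<in> sup_ball x r" for x y :: "'p padic ^ 'n"
  proof
    fix u assume "u \<in> sup_ball y r"
    then have "max (sup_norm (u - y)) (sup_norm (y - x)) \<le> r" using that by (simp add: mem_sup_ball)
    then show "u \<in> sup_ball x r"
      using order_trans[OF sup_norm_ultrametric[of "u - y" "y - x"], of r] by (simp add: mem_sup_ball)
  qed
  have "x \<in> sup_ball y r" using assms by (simp add: mem_sup_ball sup_norm_diff_commute)
  then show ?thesis using sub[OF assms] sub[of x y] by blast
qed

text \<open>The cosets of \<open>p ^ k\<close> times the integral vectors: by the ultrametric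
  inequality every point of a ball is a centre of it, so balls of one radius partition the
  space.\<close>

definition padic_cell :: "nat \<Rightarrow> 'p::prime_card padic ^ 'n \<Rightarrow> ('p padic ^ 'n) set" where
  "padic_cell k x = sup_ball x (1 / real CARD('p) ^ k)"

lemma mem_padic_cell:
  "y \<in> padic_cell k x \<longleftrightarrow> (\<forall>i. vabs (y $ i - x $ i) \<le> 1 / real CARD('p) ^ k)" for x :: "'p::prime_card padic ^ 'n"
  by (simp add: padic_cell_def mem_sup_ball sup_norm_le_iff)

lemma padic_cell_translate: "a + y \<in> padic_cell k x \<longleftrightarrow> y \<in> padic_cell k (x - a)"
  by (simp add: mem_padic_cell algebra_simps)

lemma padic_cell_eq: "y \<in> padic_cell k x \<Longrightarrow> padic_cell k y = padic_cell k x"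
  unfolding padic_cell_def by (rule sup_ball_padic_eq)

lemma padic_cell_self [simp]: "x \<in> padic_cell k x"
  by (simp add: mem_padic_cell)

lemma nested_cells_padic:
  assumes "sets M = sets borel"
  shows "nested_cells M (padic_cell :: nat \<Rightarrow> 'p::prime_card padic ^ 'n \<Rightarrow> _)"
proof
  have p: "real CARD('p) > 1" using prime_card_gt_1[where 'p = 'p] by simp
  fix k :: nat and x y :: "'p padic ^ 'n"
  show "x \<in> padic_cell k x" by simp
  show "y \<in> padic_cell k x \<Longrightarrow> padic_cell k y = padic_cell k x" by (rule padic_cell_eq)
  have "1 / real CARD('p) ^ Suc k \<le> 1 / real CARD('p) ^ k"
    using p by (intro divide_left_mono power_increasing) auto
  then show "padic_cell (Suc k) x \<subseteq> padic_cell k x"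
    unfolding padic_cell_def by (intro sup_ball_subset) simp
  show "padic_cell k x \<in> sets M"
    unfolding assms padic_cell_def by (intro borel_closed closed_sup_ball)
  \<comment> \<open>Every cell contains a rational vector and is the cell of that vector, whence
    countability.\<close>
  have "range (padic_cell k :: 'p padic ^ 'n \<Rightarrow> _) \<subseteq> range (\<lambda>q :: rat ^ 'n. padic_cell k (\<chi> i. of_rat (q $ i)))"
  proof
    fix C assume "C \<in> range (padic_cell k :: 'p padic ^ 'n \<Rightarrow> _)"
    then obtain x :: "'p padic ^ 'n" where C: "C = padic_cell k x" by blast
    have "\<exists>r. dist (of_rat r) (x $ i) < 1 / real CARD('p) ^ k" for i
      using p by (intro rat_dense) simp
    then obtain r where r: "\<And>i. dist (of_rat (r i)) (x $ i) < 1 / real CARD('p) ^ k" by metis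
    have "(\<chi> i. of_rat (r i)) \<in> padic_cell k x"
      using r by (simp add: mem_padic_cell dist_vabs less_imp_le)
    then have "padic_cell k (\<chi> i. of_rat ((\<chi> i. r i) $ i)) = C"
      using padic_cell_eq C by simp
    then show "C \<in> range (\<lambda>q :: rat ^ 'n. padic_cell k (\<chi> i. of_rat (q $ i)))" by blast
  qed
  then show "countable (range (padic_cell k :: 'p padic ^ 'n \<Rightarrow> _))" by (rule countable_subset) simp
qed

text \<open>An open set is a countable disjoint union of cells, by
  \<open>cell_open_partition\<close> with every cell regarded as good.\<close>

lemma sets_borel_padic:
  "sets (borel :: ('p::prime_card padic ^ 'n) measure)
    = sigma_sets UNIV (insert {} (\<Union>k. range (padic_cell k)))" (is "_ = sigma_sets UNIV ?G")
proof
  interpret nested_cells borel "padic_cell :: nat \<Rightarrow> 'p padic ^ 'n \<Rightarrow> _"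
    by (rule nested_cells_padic) simp
  show "sigma_sets UNIV ?G \<subseteq> sets borel"
    using sets.sigma_sets_subset[of ?G "borel :: ('p padic ^ 'n) measure"] sets_cell by auto
  have p: "real CARD('p) > 1" using prime_card_gt_1[where 'p = 'p] by simp
  have "U \<in> sigma_sets UNIV ?G" if U: "open U" for U :: "('p padic ^ 'n) set"
  proof -
    have "cell_open U"
      unfolding cell_open_def
    proof
      fix x assume "x \<in> U"
      then obtain e where e: "e > 0" "ball x e \<subseteq> U" using U open_contains_ball by blast
      have "(\<lambda>k. (1 / real CARD('p)) ^ k) \<longlonglongrightarrow> 0"
        using p by (intro LIMSEQ_power_zero) auto
      then have "\<forall>\<^sub>F k in sequentially. (1 / real CARD('p)) ^ k < e / real CARD('n)"
        using e by (intro order_tendstoD(2)) auto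
      then obtain k0 where k0: "\<And>k. k \<ge> k0 \<Longrightarrow> 1 / real CARD('p) ^ k < e / real CARD('n)"
        by (auto simp: eventually_sequentially power_divide)
      have "padic_cell k x \<subseteq> U" if "k \<ge> k0" for k
      proof
        fix u assume "u \<in> padic_cell k x"
        then have "sup_norm (x - u) < e / real CARD('n)"
          using k0[OF that] by (simp add: padic_cell_def mem_sup_ball sup_norm_diff_commute)
        then have "real CARD('n) * sup_norm (x - u) < e" by (simp add: pos_less_divide_eq mult.commute)
        then have "dist x u < e" using dist_le_sup_norm[of x u] by simp
        then show "u \<in> U" using e by auto
      qed
      then show "\<exists>k0. \<forall>k\<ge>k0. padic_cell k x \<subseteq> U" by blast
    qed
    then obtain \<D> where \<D>: "countable \<D>" "disjoint \<D>" "\<Union>\<D> = U"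
      "\<And>D. D \<in> \<D> \<Longrightarrow> \<exists>k x. D = padic_cell k x \<and> True"
      using cell_open_partition[of U "\<lambda>_ _. True"] by auto
    interpret S: sigma_algebra UNIV "sigma_sets UNIV ?G" by (rule sigma_algebra_sigma_sets) simp
    have "\<D> \<subseteq> sigma_sets UNIV ?G" using \<D>(4) by (auto intro!: sigma_sets.Basic)
    then show ?thesis using S.countable_Union[OF \<D>(1)] \<D>(3) by simp
  qed
  then have "sigma_sets UNIV {U. open U} \<subseteq> sigma_sets UNIV ?G"
    by (intro sigma_sets_mono) auto
  then show "sets (borel :: ('p padic ^ 'n) measure) \<subseteq> sigma_sets UNIV ?G"
    by (simp add: borel_def)
qed

text \<open>Two cells are nested or disjoint; the empty set is added for the second case.\<close>

lemma Int_stable_padic_cells: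
  "Int_stable (insert {} (\<Union>k. range (padic_cell k :: 'p::prime_card padic ^ 'n \<Rightarrow> _)))"
proof (rule Int_stableI)
  interpret nested_cells borel "padic_cell :: nat \<Rightarrow> 'p padic ^ 'n \<Rightarrow> _"
    by (rule nested_cells_padic) simp
  let ?G = "insert {} (\<Union>k. range (padic_cell k :: 'p padic ^ 'n \<Rightarrow> _))"
  have aux: "padic_cell k x \<inter> padic_cell l y \<in> ?G" if "k \<le> l" for k l and x y :: "'p padic ^ 'n"
  proof (cases "padic_cell k x \<inter> padic_cell l y = {}")
    case False
    then obtain u where u: "u \<in> padic_cell k x" "u \<in> padic_cell l y" by blast
    have "padic_cell l y \<subseteq> padic_cell k x"
      using cell_antimono[OF that, of u] cell_eq[OF u(1)] cell_eq[OF u(2)] by simp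
    then have "padic_cell k x \<inter> padic_cell l y = padic_cell l y" by blast
    then show ?thesis by auto
  qed simp
  fix A B assume AB: "A \<in> ?G" "B \<in> ?G"
  show "A \<inter> B \<in> ?G"
  proof (cases "A = {} \<or> B = {}")
    case False
    then obtain k l x y where "A = padic_cell k x" "B = padic_cell l y" using AB by auto
    then show ?thesis using aux[of k l x y] aux[of l k y x] by (cases "k \<le> l") (auto simp: Int_commute)
  qed auto
qed

lemma padic_measure_eqI:
  fixes M N :: "('p::prime_card padic ^ 'n) measure"
  assumes "sets M = sets borel" "sets N = sets borel"
    and eq: "\<And>k x. emeasure M (padic_cell k x) = emeasure N (padic_cell k x)"
    and fin: "\<And>x. emeasure M (padic_cell 0 x) \<noteq> \<infinity>"
  shows "M = N"
proof (rule measure_eqI_generator_eq_countable[OF Int_stable_padic_cells])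
  interpret nested_cells borel "padic_cell :: nat \<Rightarrow> 'p padic ^ 'n \<Rightarrow> _"
    by (rule nested_cells_padic) simp
  show "sets M = sigma_sets UNIV (insert {} (\<Union>k. range (padic_cell k)))"
    "sets N = sigma_sets UNIV (insert {} (\<Union>k. range (padic_cell k)))"
    by (simp_all only: assms sets_borel_padic)
  show "countable (range (padic_cell 0 :: 'p padic ^ 'n \<Rightarrow> _))" by (rule countable_cells)
  show "\<Union> (range (padic_cell 0 :: 'p padic ^ 'n \<Rightarrow> _)) = UNIV" using cell_self by blast
qed (use eq fin in auto)

section \<open>Splitting a ball into translates of a smaller one\<close>

lemma translation_measurable: "(\<lambda>x. a + x) \<in> measurable borel (borel :: ('p::prime_card padic ^ 'n) measure)"
proof (rule borel_measurable_continuous_onI)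
  have "dist (a + x) (a + y) = dist x y" for x y :: "'p padic ^ 'n"
    by (simp add: dist_vec_def dist_vabs)
  then show "continuous_on UNIV (\<lambda>x :: 'p padic ^ 'n. a + x)"
    unfolding continuous_on_iff by auto
qed

lemma emeasure_translate:
  assumes "sets M = sets borel"
  shows "emeasure (distr M borel (\<lambda>x. a + x)) (sup_ball (x :: 'p::prime_card padic ^ 'n) r) = emeasure M (sup_ball (x - a) r)"
proof -
  have "(\<lambda>x. a + x) \<in> measurable M borel"
    using translation_measurable assms measurable_cong_sets by blast
  then have "emeasure (distr M borel (\<lambda>x. a + x)) (sup_ball x r) = emeasure M ((\<lambda>x. a + x) -` sup_ball x r \<inter> space M)"
    by (rule emeasure_distr) (auto intro: borel_closed closed_sup_ball)
  also have "space M = UNIV" using sets_eq_imp_space_eq[OF assms] by simp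
  also have "(\<lambda>x. a + x) -` sup_ball x r \<inter> UNIV = sup_ball (x - a) r"
    by (auto simp: mem_sup_ball algebra_simps)
  finally show ?thesis .
qed

text \<open>After scaling by \<open>c\<close>, points are sorted by the residues of their
  coordinates modulo \<open>p ^ g\<close>. The parts are disjoint because distinct residues,
  multiplied by \<open>c\<close>, differ by at least \<open>p\<close> times the radius of a
  part.\<close>

lemma sup_ball_padic_split:
  fixes c :: "'p::prime_card padic" and M :: "('p padic ^ 'n) measure"
  assumes M: "sets M = sets borel" and c: "c \<noteq> 0"
  shows "emeasure M (sup_ball x (vabs c)) =
    (\<Sum>z\<in>{z :: int ^ 'n. \<forall>i. z $ i \<in> {0..<int CARD('p) ^ g}}.
      emeasure M (sup_ball (x + c *s int_vec z) (vabs c / real CARD('p) ^ g)))"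
proof -
  define R where "R = {z :: int ^ 'n. \<forall>i. z $ i \<in> {0..<int CARD('p) ^ g}}"
  have finR: "finite R" unfolding R_def by (rule finite_vec_Collect) simp
  have p: "real CARD('p) > 1" using prime_card_gt_1[where 'p = 'p] by simp
  have c0: "vabs c > 0" using c by (simp add: less_le)
  define B where "B z = sup_ball (x + c *s int_vec z) (vabs c / real CARD('p) ^ g)" for z
  have eq: "sup_ball x (vabs c) = (\<Union>z\<in>R. B z)"
  proof
    show "sup_ball x (vabs c) \<subseteq> (\<Union>z\<in>R. B z)"
    proof
      fix u assume "u \<in> sup_ball x (vabs c)"
      then have "vabs (u $ i - x $ i) \<le> vabs c" for i by (simp add: mem_sup_ball sup_norm_le_iff)
      then have "\<exists>m. m \<in> {0..<int CARD('p) ^ g} \<and> vabs (u $ i - (x $ i + c * of_int m)) \<le> vabs c / real CARD('p) ^ g" for i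
        using padic_residue_scaled[OF _ c] by metis
      then obtain m where m: "\<And>i. m i \<in> {0..<int CARD('p) ^ g}"
        "\<And>i. vabs (u $ i - (x $ i + c * of_int (m i))) \<le> vabs c / real CARD('p) ^ g" by metis
      then have "(\<chi> i. m i) \<in> R" "u \<in> B (\<chi> i. m i)"
        by (auto simp: R_def B_def mem_sup_ball sup_norm_le_iff int_vec_def)
      then show "u \<in> (\<Union>z\<in>R. B z)" by blast
    qed
    have "vabs c / real CARD('p) ^ g \<le> vabs c" using p c0 by (simp add: divide_le_eq)
    show "(\<Union>z\<in>R. B z) \<subseteq> sup_ball x (vabs c)"
    proof
      fix u assume "u \<in> (\<Union>z\<in>R. B z)"
      then obtain z where "sup_norm (u - (x + c *s int_vec z)) \<le> vabs c / real CARD('p) ^ g"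
        by (auto simp: B_def mem_sup_ball)
      then have z: "sup_norm (u - (x + c *s int_vec z)) \<le> vabs c"
        using \<open>vabs c / real CARD('p) ^ g \<le> vabs c\<close> by linarith
      have "sup_norm (int_vec z :: 'p padic ^ 'n) \<le> 1"
        by (simp add: sup_norm_le_iff int_vec_def vabs_of_int_padic_le_1)
      then have "sup_norm (c *s int_vec z) \<le> vabs c"
        unfolding sup_norm_scale using mult_left_mono[of _ 1 "vabs c"] by simp
      then have "max (sup_norm (u - (x + c *s int_vec z))) (sup_norm (c *s int_vec z)) \<le> vabs c" using z by simp
      moreover have "u - x = (u - (x + c *s int_vec z)) + c *s int_vec z" by simp
      ultimately show "u \<in> sup_ball x (vabs c)"
        unfolding mem_sup_ball using sup_norm_ultrametric order_trans by metis
    qed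
  qed
  have disj: "disjoint_family_on B R"
    unfolding disjoint_family_on_def
  proof (intro ballI impI, rule ccontr)
    fix z w assume zw: "z \<in> R" "w \<in> R" "z \<noteq> w" "B z \<inter> B w \<noteq> {}"
    then obtain u where u: "u \<in> B z" "u \<in> B w" by blast
    obtain i where i: "z $ i \<noteq> w $ i" using zw by (auto simp: vec_eq_iff)
    have "vabs (u $ i - (x $ i + c * of_int (z $ i))) \<le> vabs c / real CARD('p) ^ g"
      "vabs (u $ i - (x $ i + c * of_int (w $ i))) \<le> vabs c / real CARD('p) ^ g"
      using u by (auto simp: B_def mem_sup_ball sup_norm_le_iff int_vec_def)
    then have "vabs (c * of_int (z $ i) - c * of_int (w $ i)) \<le> vabs c / real CARD('p) ^ g"
      using order_trans[OF vabs_ultrametric_diff[of "u $ i - (x $ i + c * of_int (w $ i))" "u $ i - (x $ i + c * of_int (z $ i))"]]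
      by simp
    moreover have "vabs c * (real CARD('p) / real CARD('p) ^ g) \<le> vabs (c * of_int (z $ i) - c * of_int (w $ i))"
      using zw i by (intro vabs_residue_diff) (auto simp: R_def)
    moreover have "vabs c / real CARD('p) ^ g < vabs c * (real CARD('p) / real CARD('p) ^ g)"
      using p c0 by (simp add: divide_strict_right_mono)
    ultimately show False by linarith
  qed
  have "B ` R \<subseteq> sets M" unfolding M B_def by (auto intro: borel_closed closed_sup_ball)
  then show ?thesis
    unfolding eq R_def[symmetric] using finR disj by (simp add: sum_emeasure B_def[abs_def])
qed

lemma emeasure_padic_scaled:
  fixes c :: "'p::prime_card padic" and M :: "('p padic ^ 'n) measure"
  assumes M: "sets M = sets borel" and inv: "\<And>a. distr M borel (\<lambda>x. a + x) = M" and c: "c \<noteq> 0"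
  shows "emeasure M (sup_ball x (vabs c)) =
    of_nat ((CARD('p) ^ g) ^ CARD('n)) * emeasure M (sup_ball y (vabs c / real CARD('p) ^ g))"
proof -
  have shift: "emeasure M (sup_ball u r) = emeasure M (sup_ball v r)" for u v r
    using emeasure_translate[OF M, of "u - v" u r] inv by simp
  have "emeasure M (sup_ball x (vabs c)) = (\<Sum>z\<in>{z :: int ^ 'n. \<forall>i. z $ i \<in> {0..<int CARD('p) ^ g}}.
      emeasure M (sup_ball y (vabs c / real CARD('p) ^ g)))"
    unfolding sup_ball_padic_split[OF M c, of x g] by (intro sum.cong refl shift)
  also have "card {z :: int ^ 'n. \<forall>i. z $ i \<in> {0..<int CARD('p) ^ g}} = (CARD('p) ^ g) ^ CARD('n)"
    by (subst finite_vec_Collect(2)) (auto simp: nat_power_eq)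
  then have "(\<Sum>z\<in>{z :: int ^ 'n. \<forall>i. z $ i \<in> {0..<int CARD('p) ^ g}}.
      emeasure M (sup_ball y (vabs c / real CARD('p) ^ g)))
      = of_nat ((CARD('p) ^ g) ^ CARD('n)) * emeasure M (sup_ball y (vabs c / real CARD('p) ^ g))"
    by simp
  finally show ?thesis .
qed

section \<open>Construction of Haar measure from independent digits\<close>

definition digit_sum :: "nat \<Rightarrow> (nat \<Rightarrow> nat) \<Rightarrow> nat \<Rightarrow> int" where
  "digit_sum p w k = (\<Sum>i<k. int (w i) * int p ^ i)"

lemma digit_sum_range:
  assumes "\<forall>i<k. w i < p"
  shows "digit_sum p w k \<in> {0..<int p ^ k}"
  using assms
proof (induction k)
  case (Suc k)
  then have IH: "0 \<le> digit_sum p w k" "digit_sum p w k < int p ^ k" by auto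
  have "int (w k) * int p ^ k \<le> (int p - 1) * int p ^ k"
    using Suc.prems by (intro mult_right_mono) auto
  then show ?case using IH by (simp add: digit_sum_def algebra_simps)
qed (simp add: digit_sum_def)

text \<open>The leading digit is \<open>m div int p ^ k\<close> and the others are those of
  \<open>m mod int p ^ k\<close>. The equivalence turns a condition on the residue into conditions
  on single digits, so that cells become cylinder sets.\<close>

lemma digit_expansion:
  assumes "m \<in> {0..<int p ^ k}" "p > 0"
  shows "\<exists>a. (\<forall>i<k. a i < p) \<and> (\<forall>w. (\<forall>i<k. w i < p) \<longrightarrow> (digit_sum p w k = m \<longleftrightarrow> (\<forall>i<k. w i = a i)))"
  using assms(1)
proof (induction k arbitrary: m)
  case (Suc k)
  have pk: "int p ^ k > 0" using assms(2) by simp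
  have "m mod int p ^ k \<in> {0..<int p ^ k}" using pk by simp
  from Suc.IH[OF this] obtain a where a: "\<forall>i<k. a i < p"
    "\<And>w. \<forall>i<k. w i < p \<Longrightarrow> digit_sum p w k = m mod int p ^ k \<longleftrightarrow> (\<forall>i<k. w i = a i)" by blast
  define t where "t = nat (m div int p ^ k)"
  have t0: "0 \<le> m div int p ^ k" using Suc.prems pk by (simp add: pos_imp_zdiv_nonneg_iff)
  have "m div int p ^ k < int p"
  proof (rule ccontr)
    assume "\<not> ?thesis"
    then have "int p * int p ^ k \<le> m div int p ^ k * int p ^ k" using pk by (intro mult_right_mono) auto
    also have "\<dots> \<le> m" using pk by (simp add: minus_mod_eq_div_mult[symmetric])
    finally show False using Suc.prems by simp
  qed
  then have t: "int t = m div int p ^ k" "t < p" using t0 by (auto simp: t_def)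
  have key: "digit_sum p w (Suc k) = m \<longleftrightarrow> (\<forall>i<Suc k. w i = (a(k := t)) i)" if w: "\<forall>i<Suc k. w i < p" for w
  proof -
    have r: "digit_sum p w k \<in> {0..<int p ^ k}" using w by (intro digit_sum_range) auto
    have "digit_sum p w (Suc k) = digit_sum p w k + int (w k) * int p ^ k" by (simp add: digit_sum_def)
    moreover have "digit_sum p w k + int (w k) * int p ^ k = m \<longleftrightarrow>
        digit_sum p w k = m mod int p ^ k \<and> int (w k) = m div int p ^ k"
    proof
      assume "digit_sum p w k + int (w k) * int p ^ k = m"
      then show "digit_sum p w k = m mod int p ^ k \<and> int (w k) = m div int p ^ k"
        using r pk by (auto simp: div_pos_pos_trivial)
    next
      assume "digit_sum p w k = m mod int p ^ k \<and> int (w k) = m div int p ^ k"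
      then show "digit_sum p w k + int (w k) * int p ^ k = m" by (elim conjE) (simp only: mod_div_mult_eq)
    qed
    ultimately show ?thesis using a(2)[of w] w by (auto simp: t(1)[symmetric] less_Suc_eq)
  qed
  show ?case
    using a(1) t(2) key by (intro exI[of _ "a(k := t)"]) (auto simp: less_Suc_eq)
qed (auto simp: digit_sum_def)

definition padic_of_digits :: "(nat \<Rightarrow> nat) \<Rightarrow> 'p::prime_card padic" where
  "padic_of_digits w = lim (\<lambda>k. of_int (digit_sum CARD('p) w k))"

text \<open>All terms after the first \<open>k\<close> are divisible by \<open>p ^ k\<close>; this
  makes the partial sums a Cauchy sequence and carries the bound over to the limit.\<close>

lemma vabs_padic_of_digits:
  "vabs (padic_of_digits w - of_int (digit_sum CARD('p) w k) :: 'p::prime_card padic) \<le> 1 / real CARD('p) ^ k"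
proof -
  define S where "S k = (of_int (digit_sum CARD('p) w k) :: 'p padic)" for k
  have p: "real CARD('p) > 1" using prime_card_gt_1[where 'p = 'p] by simp
  have le: "dist (S l) (S k) \<le> 1 / real CARD('p) ^ k" if "k \<le> l" for k l
  proof -
    have "digit_sum CARD('p) w l - digit_sum CARD('p) w k = (\<Sum>i\<in>{k..<l}. int (w i) * int CARD('p) ^ i)"
      unfolding digit_sum_def using that by (simp add: lessThan_atLeast0 sum_diff_nat_ivl)
    also have "int CARD('p) ^ k dvd \<dots>"
      by (intro dvd_sum dvd_mult le_imp_power_dvd) auto
    finally have "vabs (of_int (digit_sum CARD('p) w l - digit_sum CARD('p) w k) :: 'p padic) \<le> 1 / real CARD('p) ^ k"
      by (simp only: vabs_of_int_le_iff)
    then show ?thesis by (simp add: S_def dist_vabs)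
  qed
  have "Cauchy S"
  proof (rule metric_CauchyI)
    fix e :: real assume "e > 0"
    then obtain k where "(1 / real CARD('p)) ^ k < e / 2"
      using real_arch_pow_inv[of "e / 2" "1 / real CARD('p)"] p by auto
    then have k: "1 / real CARD('p) ^ k < e / 2" by (simp add: power_divide)
    have "dist (S m) (S n) < e" if "m \<ge> k" "n \<ge> k" for m n
      using le[OF that(1)] le[OF that(2)] dist_triangle2[of "S m" "S n" "S k"] k by linarith
    then show "\<exists>M. \<forall>m\<ge>M. \<forall>n\<ge>M. dist (S m) (S n) < e" by blast
  qed
  then have "S \<longlonglongrightarrow> padic_of_digits w"
    unfolding padic_of_digits_def S_def[symmetric] using Cauchy_convergent convergent_LIMSEQ_iff by blast
  then have "(\<lambda>l. dist (S l) (S k)) \<longlonglongrightarrow> dist (padic_of_digits w) (S k)"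
    by (intro tendsto_dist tendsto_const)
  then have "dist (padic_of_digits w) (S k) \<le> 1 / real CARD('p) ^ k"
    by (rule LIMSEQ_le_const2) (use le in blast)
  then show ?thesis by (simp add: dist_vabs S_def)
qed

text \<open>
  On the integral points Haar measure is the distribution of vectors with independent uniform
  digits.
\<close>

lemma integral_haar:
  obtains \<nu> :: "('p::prime_card padic ^ 'n) measure" where "prob_space \<nu>" "sets \<nu> = sets borel"
    "\<And>k x. emeasure \<nu> (padic_cell k x) = (if x \<in> padic_cell 0 0 then ennreal (1 / real CARD('p) ^ (k * CARD('n))) else 0)"
proof -
  define p where "p = CARD('p)"
  have p1: "p > 1" unfolding p_def by (rule prime_card_gt_1)
  \<comment> \<open>The index \<open>(i, j)\<close> stands for the digit \<open>i\<close> of the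
    coordinate \<open>j\<close>.\<close>
  define D where "D = (\<lambda>_ :: nat \<times> 'n. uniform_count_measure {..<p})"
  have "prob_space (D ij)" for ij
    unfolding D_def using p1 by (intro prob_space_uniform_count_measure) auto
  then interpret product_prob_space D UNIV
    by (auto simp: product_prob_space_def product_prob_space_axioms_def product_sigma_finite_def
        intro: prob_space_imp_sigma_finite)
  define \<Omega> where "\<Omega> = PiM UNIV D"
  have space: "\<omega> \<in> space \<Omega> \<Longrightarrow> \<omega> ij < p" for \<omega> ij
    by (auto simp: \<Omega>_def space_PiM D_def space_uniform_count_measure)
  define F where "F \<omega> = ((\<chi> j. padic_of_digits (\<lambda>i. \<omega> (i, j))) :: 'p padic ^ 'n)" for \<omega> :: "nat \<times> 'n \<Rightarrow> nat"
  have F0: "F \<omega> \<in> padic_cell 0 0" for \<omega>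
  proof -
    have "vabs (padic_of_digits (\<lambda>i. \<omega> (i, j)) :: 'p padic) \<le> 1" for j
      using vabs_padic_of_digits[of "\<lambda>i. \<omega> (i, j)" 0, where 'p = 'p] by (simp add: digit_sum_def)
    then show ?thesis by (simp add: mem_padic_cell F_def)
  qed
  interpret C: nested_cells borel "padic_cell :: nat \<Rightarrow> 'p padic ^ 'n \<Rightarrow> _"
    by (rule nested_cells_padic) simp
  have pre: "F -` padic_cell k x \<inter> space \<Omega> \<in> sets \<Omega> \<and>
    emeasure \<Omega> (F -` padic_cell k x \<inter> space \<Omega>) = (if x \<in> padic_cell 0 0 then ennreal (1 / real p ^ (k * CARD('n))) else 0)"
    for k x
  proof (cases "x \<in> padic_cell 0 0")
    \<comment> \<open>The cell of a non-integral point misses the integral points, where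
      \<open>F\<close> takes its values.\<close>
    case False
    have "F \<omega> \<notin> padic_cell k x" for \<omega>
    proof
      assume "F \<omega> \<in> padic_cell k x"
      then have "F \<omega> \<in> padic_cell 0 x" using C.cell_antimono[of 0 k x] by blast
      then have "padic_cell 0 x = padic_cell 0 0" using padic_cell_eq F0 by metis
      then show False using False padic_cell_self by blast
    qed
    then have "F -` padic_cell k x \<inter> space \<Omega> = {}" by blast
    then show ?thesis using False by simp
  next
    case True
    have "\<exists>m. m \<in> {0..<int p ^ k} \<and> vabs (x $ j - of_int m) \<le> 1 / real p ^ k" for j
    proof -
      have "vabs (x $ j) \<le> 1" using True by (simp add: mem_padic_cell)
      then show ?thesis unfolding p_def using padic_residue by metis
    qed
    then obtain m where m: "\<And>j. m j \<in> {0..<int p ^ k}" "\<And>j. vabs (x $ j - of_int (m j)) \<le> 1 / real p ^ k" by metis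
    have "\<exists>a. (\<forall>i<k. a i < p) \<and> (\<forall>w. (\<forall>i<k. w i < p) \<longrightarrow> (digit_sum p w k = m j \<longleftrightarrow> (\<forall>i<k. w i = a i)))" for j
      using digit_expansion[OF m(1)] p1 by simp
    then obtain a where a: "\<And>j i. i < k \<Longrightarrow> a j i < p"
      "\<And>j w. \<forall>i<k. w i < p \<Longrightarrow> digit_sum p w k = m j \<longleftrightarrow> (\<forall>i<k. w i = a j i)" by metis
    \<comment> \<open>The preimage of a cell of level \<open>k\<close> prescribes the first
      \<open>k\<close> digits of every coordinate: \<open>k * CARD('n)\<close> independent
      conditions of probability \<open>1 / p\<close>.\<close>
    have iff: "F \<omega> \<in> padic_cell k x \<longleftrightarrow> (\<forall>j. \<forall>i<k. \<omega> (i, j) = a j i)" if \<omega>: "\<omega> \<in> space \<Omega>" for \<omega>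
    proof -
      have "vabs (F \<omega> $ j - x $ j) \<le> 1 / real p ^ k \<longleftrightarrow> (\<forall>i<k. \<omega> (i, j) = a j i)" for j
      proof -
        define w where "w i = \<omega> (i, j)" for i
        have w: "\<forall>i<k. w i < p" using space[OF \<omega>] by (simp add: w_def)
        have Fj: "F \<omega> $ j = padic_of_digits w" by (simp add: F_def w_def[abs_def])
        have d: "vabs (F \<omega> $ j - of_int (digit_sum p w k)) \<le> 1 / real p ^ k"
          unfolding Fj p_def by (rule vabs_padic_of_digits)
        have "vabs (F \<omega> $ j - x $ j) \<le> 1 / real p ^ k \<longleftrightarrow> digit_sum p w k = m j"
        proof
          assume *: "vabs (F \<omega> $ j - x $ j) \<le> 1 / real p ^ k"
          have "vabs (F \<omega> $ j - of_int (m j)) \<le> 1 / real p ^ k"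
            using order_trans[OF vabs_ultrametric[of "F \<omega> $ j - x $ j" "x $ j - of_int (m j)"]] * m(2)[of j] by simp
          then show "digit_sum p w k = m j"
            using d m(1)[of j] digit_sum_range[OF w] unfolding p_def by (intro padic_residue_unique[where 'p = 'p])
        next
          assume "digit_sum p w k = m j"
          then show "vabs (F \<omega> $ j - x $ j) \<le> 1 / real p ^ k"
            using order_trans[OF vabs_ultrametric_diff[of "F \<omega> $ j - of_int (m j)" "x $ j - of_int (m j)"]] d m(2)[of j] by simp
        qed
        then show ?thesis using a(2)[OF w] by (simp add: w_def)
      qed
      then show ?thesis by (simp add: mem_padic_cell p_def)
    qed
    define J where "J = {..<k} \<times> (UNIV :: 'n set)"
    have finJ: "finite J" by (simp add: J_def)
    have "F -` padic_cell k x \<inter> space \<Omega> = prod_emb UNIV D J (\<Pi>\<^sub>E ij\<in>J. {a (snd ij) (fst ij)})"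
      using iff by (auto simp: prod_emb_def \<Omega>_def space_PiM J_def restrict_def PiE_iff extensional_def)
    moreover have "prod_emb UNIV D J (\<Pi>\<^sub>E ij\<in>J. {a (snd ij) (fst ij)}) \<in> sets \<Omega>"
      unfolding \<Omega>_def using finJ a(1)
      by (intro sets_PiM_I) (auto simp: J_def D_def sets_uniform_count_measure)
    moreover have "emeasure \<Omega> (prod_emb UNIV D J (\<Pi>\<^sub>E ij\<in>J. {a (snd ij) (fst ij)})) = ennreal (1 / real p ^ (k * CARD('n)))"
    proof -
      have "emeasure \<Omega> (prod_emb UNIV D J (\<Pi>\<^sub>E ij\<in>J. {a (snd ij) (fst ij)}))
          = (\<Prod>ij\<in>J. emeasure (D ij) {a (snd ij) (fst ij)})"
        unfolding \<Omega>_def using finJ a(1)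
        by (intro emeasure_PiM_emb) (auto simp: J_def D_def sets_uniform_count_measure)
      also have "\<dots> = (\<Prod>ij\<in>J. ennreal (1 / real p))"
        using a(1) by (intro prod.cong) (auto simp: J_def D_def emeasure_uniform_count_measure)
      also have "\<dots> = ennreal (1 / real p) ^ (k * CARD('n))" by (simp add: J_def)
      also have "\<dots> = ennreal (1 / real p ^ (k * CARD('n)))" by (simp add: ennreal_power power_divide)
      finally show ?thesis .
    qed
    ultimately show ?thesis using True by simp
  qed
  have meas: "F \<in> measurable \<Omega> borel"
  proof (rule measurable_sigma_sets[OF sets_borel_padic])
    fix A assume "A \<in> insert {} (\<Union>k. range (padic_cell k :: 'p padic ^ 'n \<Rightarrow> _))"
    then show "F -` A \<inter> space \<Omega> \<in> sets \<Omega>" using pre by auto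
  qed auto
  show ?thesis
  proof (rule that[of "distr \<Omega> borel F"])
    have "prob_space \<Omega>" unfolding \<Omega>_def by (rule P.prob_space_axioms)
    then show "prob_space (distr \<Omega> borel F)" using meas by (rule prob_space.prob_space_distr)
    show "emeasure (distr \<Omega> borel F) (padic_cell k x)
      = (if x \<in> padic_cell 0 0 then ennreal (1 / real CARD('p) ^ (k * CARD('n))) else 0)" for k x
      using pre[of k x] C.sets_cell[of k x] meas by (simp add: emeasure_distr p_def)
  qed simp
qed

text \<open>The whole space is a countable disjoint union of translates of the integral points. With
  one representative in each coset, the image of counting measure times \<open>\<nu>\<close> under
  addition puts a copy of \<open>\<nu>\<close> on every coset.\<close>

lemma haar_exists:
  obtains M :: "('p::prime_card padic ^ 'n) measure" where "sets M = sets borel"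
    "\<And>k x. emeasure M (padic_cell k x) = ennreal (1 / real CARD('p) ^ (k * CARD('n)))"
proof -
  obtain \<nu> :: "('p padic ^ 'n) measure" where \<nu>: "prob_space \<nu>" "sets \<nu> = sets borel"
    "\<And>k x. emeasure \<nu> (padic_cell k x) = (if x \<in> padic_cell 0 0 then ennreal (1 / real CARD('p) ^ (k * CARD('n))) else 0)"
    by (rule integral_haar) blast
  interpret prob_space \<nu> by fact
  interpret C: nested_cells borel "padic_cell :: nat \<Rightarrow> 'p padic ^ 'n \<Rightarrow> _"
    by (rule nested_cells_padic) simp
  define rep where "rep x = (SOME y. y \<in> padic_cell 0 x)" for x :: "'p padic ^ 'n"
  define R where "R = range rep"
  have rep: "rep x \<in> padic_cell 0 x" for x
    unfolding rep_def by (rule someI[of _ x]) simp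
  have R_unique: "c \<in> R \<Longrightarrow> c \<in> padic_cell 0 x \<longleftrightarrow> c = rep x" for c x
  proof -
    assume "c \<in> R"
    then obtain y where y: "c = rep y" by (auto simp: R_def)
    show "c \<in> padic_cell 0 x \<longleftrightarrow> c = rep x"
    proof
      assume "c \<in> padic_cell 0 x"
      then have "padic_cell 0 y = padic_cell 0 x"
        using padic_cell_eq[of c 0 x] padic_cell_eq[OF rep[of y]] y by simp
      then show "c = rep x" by (simp add: y rep_def)
    qed (use rep in auto)
  qed
  have "R = (\<lambda>Q. SOME y. y \<in> Q) ` range (padic_cell 0)"
    by (auto simp: R_def rep_def)
  then have countR: "countable R" using C.countable_cells by simp
  define f where "f = (\<lambda>(c, y). c + y :: 'p padic ^ 'n)"
  have f: "f \<in> measurable (count_space R \<Otimes>\<^sub>M \<nu>) borel"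
  proof (rule measurable_pair_measure_countable1[OF countR])
    show "(\<lambda>y. f (c, y)) \<in> measurable \<nu> borel" for c
      unfolding f_def using translation_measurable[of c] \<nu>(2) measurable_cong_sets by (auto cong: measurable_cong_sets)
  qed
  have space_\<nu>: "space \<nu> = UNIV" using sets_eq_imp_space_eq[OF \<nu>(2)] by simp
  show ?thesis
  proof (rule that[of "distr (count_space R \<Otimes>\<^sub>M \<nu>) borel f"])
    fix k and x :: "'p padic ^ 'n"
    define u where "u = ennreal (1 / real CARD('p) ^ (k * CARD('n)))"
    define A where "A = f -` padic_cell k x \<inter> space (count_space R \<Otimes>\<^sub>M \<nu>)"
    have A: "A \<in> sets (count_space R \<Otimes>\<^sub>M \<nu>)"
      unfolding A_def using f C.sets_cell by (rule measurable_sets)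
    \<comment> \<open>Of all translates only the one containing \<open>x\<close> meets the cell, and
      it contains the cell entirely.\<close>
    have sec: "emeasure \<nu> (Pair c -` A) = u * indicator {rep x} c" if c: "c \<in> R" for c
    proof -
      have "Pair c -` A = padic_cell k (x - c)"
        using c by (auto simp: A_def f_def space_pair_measure space_\<nu> padic_cell_translate)
      moreover have "x - c \<in> padic_cell 0 0 \<longleftrightarrow> c \<in> padic_cell 0 x"
        by (auto simp: mem_padic_cell vabs_diff_commute)
      ultimately show ?thesis using \<nu>(3)[of k "x - c"] R_unique[OF c, of x] by (simp add: u_def indicator_def)
    qed
    have "emeasure (distr (count_space R \<Otimes>\<^sub>M \<nu>) borel f) (padic_cell k x) = emeasure (count_space R \<Otimes>\<^sub>M \<nu>) A"
      unfolding A_def using f C.sets_cell by (rule emeasure_distr)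
    also have "\<dots> = (\<integral>\<^sup>+c. emeasure \<nu> (Pair c -` A) \<partial>count_space R)"
      using A by (rule emeasure_pair_measure_alt)
    also have "\<dots> = (\<integral>\<^sup>+c. u * indicator {rep x} c \<partial>count_space R)"
      using sec by (intro nn_integral_cong) simp
    also have "\<dots> = u * emeasure (count_space R) {rep x}"
      by (rule nn_integral_cmult_indicator) (simp add: R_def)
    also have "\<dots> = u" by (simp add: R_def)
    finally show "emeasure (distr (count_space R \<Otimes>\<^sub>M \<nu>) borel f) (padic_cell k x)
      = ennreal (1 / real CARD('p) ^ (k * CARD('n)))" by (simp add: u_def)
  qed simp
qed

text \<open>Justifies the definite description. Uniqueness: the unit ball splits into equally large
  cells, so normalization and invariance determine the measure of every cell. Existence: the measure
  of \<open>haar_exists\<close> gives cells of one level the same mass wherever they lie, hence is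
  invariant.\<close>

lemma padic_haar_properties:
  "sets (padic_haar :: ('p::prime_card padic ^ 'n) measure) = sets borel"
  "distr padic_haar borel (\<lambda>x. a + x) = (padic_haar :: ('p padic ^ 'n) measure)"
  "emeasure padic_haar (padic_cell k (x :: 'p padic ^ 'n)) = ennreal (1 / real CARD('p) ^ (k * CARD('n)))"
proof -
  define Q where "Q M \<longleftrightarrow> sets M = sets borel \<and> (\<forall>a. distr M borel (\<lambda>x. a + x) = M) \<and>
     emeasure M {x. \<forall>i. vabs (x $ i) \<le> 1} = 1" for M :: "('p padic ^ 'n) measure"
  have p: "real CARD('p) > 1" using prime_card_gt_1[where 'p = 'p] by simp
  have Z: "{x :: 'p padic ^ 'n. \<forall>i. vabs (x $ i) \<le> 1} = padic_cell 0 0"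
    by (auto simp: mem_padic_cell)
  have cells: "emeasure M (padic_cell k x) = ennreal (1 / real CARD('p) ^ (k * CARD('n)))" if M: "Q M" for M k x
  proof -
    have "emeasure M (sup_ball 0 (vabs (1 :: 'p padic))) =
        of_nat ((CARD('p) ^ k) ^ CARD('n)) * emeasure M (sup_ball x (vabs (1 :: 'p padic) / real CARD('p) ^ k))"
      using M by (intro emeasure_padic_scaled) (auto simp: Q_def)
    then have "1 = of_nat (CARD('p) ^ (k * CARD('n))) * emeasure M (padic_cell k x)"
      using M Z by (simp add: Q_def padic_cell_def power_mult)
    moreover have "ennreal (1 / real CARD('p) ^ (k * CARD('n))) * of_nat (CARD('p) ^ (k * CARD('n))) = 1"
    proof -
      have "ennreal (1 / real CARD('p) ^ (k * CARD('n))) * ennreal (real (CARD('p) ^ (k * CARD('n))))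
          = ennreal (1 / real CARD('p) ^ (k * CARD('n)) * real (CARD('p) ^ (k * CARD('n))))"
        by (rule ennreal_mult[symmetric]) auto
      also have "\<dots> = 1" using p by simp
      finally show ?thesis by (simp add: ennreal_of_nat_eq_real_of_nat)
    qed
    ultimately show ?thesis by (metis mult.assoc mult.left_neutral mult.right_neutral)
  qed
  obtain M :: "('p padic ^ 'n) measure" where M: "sets M = sets borel"
    "\<And>k x. emeasure M (padic_cell k x) = ennreal (1 / real CARD('p) ^ (k * CARD('n)))"
    by (rule haar_exists) blast
  have "distr M borel (\<lambda>x. a + x) = M" for a
  proof (rule padic_measure_eqI)
    show "emeasure (distr M borel (\<lambda>x. a + x)) (padic_cell k x) = emeasure M (padic_cell k x)" for k x
      unfolding padic_cell_def emeasure_translate[OF M(1)] by (simp only: padic_cell_def[symmetric] M(2))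
    then show "emeasure (distr M borel (\<lambda>x. a + x)) (padic_cell 0 x) \<noteq> \<infinity>" for x by (simp add: M(2))
  qed (simp_all add: M(1))
  then have QM: "Q M" unfolding Q_def Z using M by simp
  have unique: "N = M" if "Q N" for N
  proof (rule padic_measure_eqI)
    show "emeasure N (padic_cell k x) = emeasure M (padic_cell k x)" for k x
      by (simp only: cells[OF that] cells[OF QM])
    show "emeasure N (padic_cell 0 x) \<noteq> \<infinity>" for x by (simp add: cells[OF that])
  qed (use that QM in \<open>auto simp: Q_def\<close>)
  have "padic_haar = (THE M. Q M)" by (simp only: padic_haar_def Q_def)
  also have "\<dots> = M" using QM unique by (rule the_equality)
  finally have eq: "padic_haar = M" .
  show "sets (padic_haar :: ('p padic ^ 'n) measure) = sets borel"
    "distr padic_haar borel (\<lambda>x. a + x) = (padic_haar :: ('p padic ^ 'n) measure)"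
    unfolding eq using QM by (auto simp: Q_def)
  show "emeasure padic_haar (padic_cell k (x :: 'p padic ^ 'n)) = ennreal (1 / real CARD('p) ^ (k * CARD('n)))"
    unfolding eq by (rule M(2))
qed

section \<open>The p-adic case\<close>

text \<open>For \<open>l \<le> 0\<close> the ball is a cell; for \<open>l > 0\<close> it splits into
  translates of the unit ball.\<close>

lemma emeasure_padic_haar_powi:
  "emeasure padic_haar (sup_ball (x :: 'p::prime_card padic ^ 'n) (real CARD('p) powi l))
    = ennreal ((real CARD('p) powi l) ^ CARD('n))"
proof (cases "l \<le> 0")
  case True
  then have "real CARD('p) powi l = 1 / real CARD('p) ^ nat (- l)"
    by (cases "l = 0") (auto simp: power_int_def inverse_eq_divide power_one_over)
  then show ?thesis
    using padic_haar_properties(3)[of "nat (- l)" x] by (simp add: padic_cell_def power_divide power_mult)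
next
  case False
  define g where "g = nat l"
  have pl: "real CARD('p) powi l = real CARD('p) ^ g" using False by (simp add: g_def power_int_def)
  obtain c :: "'p padic" where c: "vabs c = real CARD('p) powi l" using ex_vabs_powi by blast
  have p: "real CARD('p) > 0" using prime_card_gt_1[where 'p = 'p] by simp
  have "c \<noteq> 0" using c pl p by auto
  then have "emeasure padic_haar (sup_ball x (vabs c)) =
      of_nat ((CARD('p) ^ g) ^ CARD('n)) * emeasure padic_haar (sup_ball (0 :: 'p padic ^ 'n) (vabs c / real CARD('p) ^ g))"
    by (intro emeasure_padic_scaled padic_haar_properties(1,2))
  also have "vabs c / real CARD('p) ^ g = 1 / real CARD('p) ^ 0" using c pl p by simp
  also have "emeasure padic_haar (sup_ball (0 :: 'p padic ^ 'n) (1 / real CARD('p) ^ 0)) = 1"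
    using padic_haar_properties(3)[of 0 "0 :: 'p padic ^ 'n"] by (simp add: padic_cell_def)
  finally show ?thesis by (simp add: c pl flip: ennreal_of_nat_eq_real_of_nat of_nat_power)
qed

text \<open>Rounding the radius to a neighbouring power of \<open>p\<close> costs a factor
  \<open>p\<close> in each coordinate, in either direction.\<close>

lemma padic_haar_ball_bounds:
  fixes x :: "'p::prime_card padic ^ 'n"
  shows "emeasure padic_haar (sup_ball x r) < \<infinity>"
    and "r > 0 \<Longrightarrow> (1 / real CARD('p)) ^ CARD('n) * r ^ CARD('n) \<le> measure padic_haar (sup_ball x r)"
    and "r > 0 \<Longrightarrow> measure padic_haar (sup_ball x r) \<le> real CARD('p) ^ CARD('n) * r ^ CARD('n)"
proof -
  define p where "p = real CARD('p)"
  have p: "p > 1" using prime_card_gt_1[where 'p = 'p] by (simp add: p_def)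
  have sets: "sup_ball x r \<in> sets padic_haar" for r
    unfolding padic_haar_properties(1) by (intro borel_closed closed_sup_ball)
  have val: "emeasure padic_haar (sup_ball x (p powi l)) = ennreal ((p powi l) ^ CARD('n))" for l
    unfolding p_def by (rule emeasure_padic_haar_powi)
  have fm: "sup_ball x (p powi l) \<in> fmeasurable padic_haar" for l
    using sets val by (simp add: fmeasurable_def)
  have mval: "measure padic_haar (sup_ball x (p powi l)) = (p powi l) ^ CARD('n)" for l
    using val p by (simp add: measure_def)
  have mono: "sup_ball x r \<subseteq> sup_ball x s" if "r \<le> s" for r s using that by (auto simp: mem_sup_ball)
  have fm': "sup_ball x r \<in> fmeasurable padic_haar" for r
  proof -
    have "max r 1 > 0" by simp
    obtain k where "p powi k \<le> max r 1" "max r 1 < p powi (k + 1)"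
      using powi_bracket[OF p \<open>max r 1 > 0\<close>] .
    then show ?thesis using fmeasurableI2[OF fm[of "k + 1"] mono sets] by simp
  qed
  then show "emeasure padic_haar (sup_ball x r) < \<infinity>" by (simp add: fmeasurable_def)
  assume r: "r > 0"
  obtain k where k: "p powi k \<le> r" "r < p powi (k + 1)" using powi_bracket[OF p r] .
  have pk: "p powi (k + 1) = p powi k * p" "p powi k > 0" using p by (simp_all add: power_int_add)
  have "(1 / p) ^ CARD('n) * r ^ CARD('n) = (r / p) ^ CARD('n)" by (simp add: power_divide)
  also have "\<dots> \<le> (p powi k) ^ CARD('n)"
    using k pk p r by (intro power_mono) (auto simp: divide_le_eq)
  also have "\<dots> \<le> measure padic_haar (sup_ball x r)"
    unfolding mval[symmetric] using k sets fm' by (intro measure_mono_fmeasurable mono)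
  finally show "(1 / real CARD('p)) ^ CARD('n) * r ^ CARD('n) \<le> measure padic_haar (sup_ball x r)"
    by (simp add: p_def)
  have "measure padic_haar (sup_ball x r) \<le> (p powi (k + 1)) ^ CARD('n)"
    unfolding mval[symmetric] using k sets fm by (intro measure_mono_fmeasurable mono) auto
  also have "\<dots> \<le> (p * r) ^ CARD('n)"
    using k pk p by (intro power_mono) (auto simp: mult.commute)
  finally show "measure padic_haar (sup_ball x r) \<le> real CARD('p) ^ CARD('n) * r ^ CARD('n)"
    by (simp add: p_def power_mult_distrib)
qed

text \<open>Normalization at \<open>p\<close> alone: \<open>int_vec z\<close> gets norm 1, so that
  the counting estimate can relate real height and \<open>p\<close>-adic closeness. Common factors
  prime to \<open>p\<close> are allowed.\<close>

definition indivisible :: "nat \<Rightarrow> (int ^ 'n) set" where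
  "indivisible p = {z. \<exists>i. \<not> int p dvd z $ i}"

lemma sup_norm_indivisible:
  assumes "z \<in> indivisible CARD('p)"
  shows "sup_norm (int_vec z :: 'p::prime_card padic ^ 'n) = 1"
proof (rule antisym)
  show "sup_norm (int_vec z :: 'p padic ^ 'n) \<le> 1"
    by (simp add: sup_norm_le_iff int_vec_def vabs_of_int_padic_le_1)
  obtain i where "\<not> int CARD('p) dvd z $ i" using assms by (auto simp: indivisible_def)
  then have "1 \<le> vabs (of_int (z $ i) :: 'p padic)"
    using vabs_of_int_ge[of 0 "z $ i", where 'p = 'p] by simp
  also have "\<dots> \<le> sup_norm (int_vec z :: 'p padic ^ 'n)"
    using sup_norm_ge[of "int_vec z :: 'p padic ^ 'n" i] by (simp add: int_vec_def)
  finally show "1 \<le> sup_norm (int_vec z :: 'p padic ^ 'n)" .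
qed

text \<open>Take the largest \<open>e\<close> such that \<open>p ^ e\<close> divides all
  coordinates; it exists since one coordinate is nonzero.\<close>

lemma indivisible_part:
  assumes "w \<noteq> (0 :: int ^ 'n)" "p > 1"
  obtains e z where "z \<in> indivisible p" "\<And>i. w $ i = int p ^ e * z $ i"
proof -
  obtain i where i: "w $ i \<noteq> 0" using assms by (auto simp: vec_eq_iff)
  define E where "E = {e. \<forall>i. int p ^ e dvd w $ i}"
  have "E \<subseteq> {..nat \<bar>w $ i\<bar>}"
  proof
    fix e assume "e \<in> E"
    then have "int p ^ e \<le> \<bar>w $ i\<bar>" using i zdvd_imp_le[of "int p ^ e" "\<bar>w $ i\<bar>"] by (auto simp: E_def)
    moreover have "int e < int p ^ e"
      using power_gt_expt[of p e] assms by (simp flip: of_nat_power)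
    ultimately have "int e \<le> \<bar>w $ i\<bar>" by linarith
    then show "e \<in> {..nat \<bar>w $ i\<bar>}" by (simp add: le_nat_iff)
  qed
  then have finE: "finite E" by (rule finite_subset) simp
  have "0 \<in> E" by (simp add: E_def)
  define e where "e = Max E"
  have "e \<in> E" unfolding e_def using finE \<open>0 \<in> E\<close> by (intro Max_in) auto
  then have "\<forall>i. \<exists>t. w $ i = int p ^ e * t" by (auto simp: E_def elim!: dvdE)
  then obtain t where t: "\<And>i. w $ i = int p ^ e * t i" by metis
  have "(\<chi> i. t i) \<in> indivisible p"
  proof (rule ccontr)
    assume "(\<chi> i. t i) \<notin> indivisible p"
    then have "int p ^ Suc e dvd w $ i" for i
      using t[of i] by (auto simp: indivisible_def mult.commute intro: mult_dvd_mono)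
    then have "Suc e \<in> E" by (simp add: E_def)
    then have "Suc e \<le> e" unfolding e_def using finE by (intro Max_ge)
    then show False by simp
  qed
  then show ?thesis using that[of "\<chi> i. t i" e] t by simp
qed

text \<open>Pigeonhole: more than \<open>p ^ (j * d * Suc d)\<close> integer vectors with
  coordinates from 0 to \<open>p ^ (j * d)\<close> compete for that many tuples of residues modulo
  \<open>p ^ q\<close>. The difference of two vectors with equal residues is small in the real sense
  and close to the line of \<open>x\<close> in the \<open>p\<close>-adic sense.\<close>

lemma Dirichlet_padic:
  fixes x :: "'p::prime_card padic ^ 'n"
  assumes x: "x \<noteq> 0" and d: "CARD('n) = Suc d"
  shows "\<exists>z\<in>indivisible CARD('p). int_height z \<le> real 2 * real CARD('p) ^ (j * d) \<and>
    near (real 2 / (real CARD('p) ^ j * int_height z)) x (int_vec z)"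
proof -
  define p where "p = CARD('p)"
  have p1: "p > 1" unfolding p_def by (rule prime_card_gt_1)
  obtain i where i: "sup_norm x = vabs (x $ i)" by (rule sup_norm_attained)
  have "vabs (x $ i) > 0" using x unfolding i[symmetric] by simp
  then have xi: "vabs (x $ i) > 0" "x $ i \<noteq> 0" by auto
  define \<theta> where "\<theta> l = x $ l / x $ i" for l
  have \<theta>: "vabs (\<theta> l) \<le> 1" for l
    using sup_norm_ge[of x l] xi by (simp add: i \<theta>_def vabs_divide divide_le_eq)
  have \<theta>i: "\<theta> i = 1" using xi by (simp add: \<theta>_def)
  \<comment> \<open>Chosen so that \<open>p ^ (q * d)\<close>, the number of residue tuples, equals
    \<open>(p ^ (j * d)) ^ Suc d\<close>.\<close>
  define q where "q = j * Suc d"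
  define M where "M = int p ^ (j * d)"
  have M: "M > 0" using p1 by (simp add: M_def)
  define res where "res t = (SOME m. m \<in> {0..<int p ^ q} \<and> vabs (t - of_int m) \<le> 1 / real p ^ q)" for t :: "'p padic"
  have res: "res t \<in> {0..<int p ^ q} \<and> vabs (t - of_int (res t)) \<le> 1 / real p ^ q" if "vabs t \<le> 1" for t
    unfolding res_def p_def by (rule someI_ex) (use padic_residue[OF that, of q] in blast)
  \<comment> \<open>As \<open>\<theta> i = 1\<close>, the entry at \<open>i\<close> would always be
    the residue of 0; it is fixed as 0, which leaves \<open>d\<close> residues.\<close>
  define G where "G z = (\<chi> l. if l = i then 0 else res (of_int (z $ l) - \<theta> l * of_int (z $ i)))" for z :: "int ^ 'n"
  have arg: "vabs (of_int a - \<theta> l * of_int c) \<le> 1" for a c l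
  proof -
    have "vabs (\<theta> l * of_int c) \<le> 1 * 1"
      unfolding vabs_mult by (intro mult_mono \<theta> vabs_of_int_padic_le_1) auto
    then show ?thesis
      using order_trans[OF vabs_ultrametric_diff[of "of_int a" "\<theta> l * of_int c"], of 1]
        vabs_of_int_padic_le_1[of a, where 'p = 'p] by simp
  qed
  define A where "A = {z :: int ^ 'n. \<forall>l. z $ l \<in> {0..M}}"
  define B where "B = {z :: int ^ 'n. \<forall>l. z $ l \<in> (if l = i then {0} else {0..<int p ^ q})}"
  have finB: "finite B" unfolding B_def by (rule finite_vec_Collect) auto
  have GB: "G ` A \<subseteq> B"
    using res[OF arg] by (auto simp: G_def B_def)
  have "card B = (\<Prod>l\<in>UNIV. card (if l = i then {0} else {0..<int p ^ q}))"
    unfolding B_def by (rule finite_vec_Collect(2)) auto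
  also have "\<dots> = (\<Prod>l\<in>UNIV - {i}. card (if l = i then {0} else {0..<int p ^ q}))"
    by (simp add: prod.remove[of UNIV i])
  also have "\<dots> = (\<Prod>l\<in>UNIV - {i}. p ^ q)" by (intro prod.cong) (auto simp: nat_power_eq)
  also have "\<dots> = p ^ (q * d)" using d by (simp add: card_Diff_singleton power_mult)
  finally have cardB: "card B = p ^ (q * d)" .
  have "card A = (\<Prod>l\<in>(UNIV :: 'n set). card {0..M})"
    unfolding A_def by (rule finite_vec_Collect(2)) auto
  also have "\<dots> = nat (M + 1) ^ Suc d" using d by simp
  also have "nat (M + 1) = p ^ (j * d) + 1" by (simp add: M_def nat_power_eq nat_add_distrib)
  \<comment> \<open>Both endpoints 0 and \<open>M\<close> are allowed, and this one extra value per
    coordinate makes the pigeonhole inequality strict.\<close>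
  also have "(p ^ (j * d) + 1) ^ Suc d > (p ^ (j * d)) ^ Suc d" by (intro power_strict_mono) auto
  also have "(p ^ (j * d)) ^ Suc d = card B" unfolding cardB q_def by (simp only: power_mult[symmetric] mult_ac)
  finally have "card (G ` A) < card A" using card_mono[OF finB GB] by simp
  then have "\<not> inj_on G A" by (rule pigeonhole)
  then obtain z z' where zz: "z \<in> A" "z' \<in> A" "z \<noteq> z'" "G z = G z'" by (auto simp: inj_on_def)
  define w where "w = z - z'"
  have w0: "w \<noteq> 0" using zz by (simp add: w_def)
  have w_le: "\<bar>w $ l\<bar> \<le> M" for l
  proof -
    have "z $ l \<in> {0..M}" "z' $ l \<in> {0..M}" using zz by (auto simp: A_def)
    then show ?thesis by (auto simp: w_def abs_le_iff)
  qed
  have w_close: "vabs (of_int (w $ l) - \<theta> l * of_int (w $ i)) \<le> 1 / real p ^ q" for l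
  proof (cases "l = i")
    case True
    then show ?thesis by (simp add: \<theta>i)
  next
    case False
    define a where "a = of_int (z $ l) - \<theta> l * of_int (z $ i)"
    define a' where "a' = of_int (z' $ l) - \<theta> l * of_int (z' $ i)"
    have "G z $ l = G z' $ l" using zz by simp
    then have "res a = res a'" using False by (simp add: G_def a_def a'_def)
    moreover have "vabs a \<le> 1" "vabs a' \<le> 1" unfolding a_def a'_def by (rule arg)+
    ultimately have "vabs (a - of_int (res a)) \<le> 1 / real p ^ q" "vabs (a' - of_int (res a)) \<le> 1 / real p ^ q"
      using res[of a] res[of a'] by simp_all
    then have "vabs (a - a') \<le> 1 / real p ^ q"
      using order_trans[OF vabs_ultrametric_diff[of "a - of_int (res a)" "a' - of_int (res a)"]] by simp
    then show ?thesis by (simp add: a_def a'_def w_def algebra_simps)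
  qed
  \<comment> \<open>Removing \<open>p ^ e\<close> lowers the bound for the height by the factor
    \<open>p ^ e\<close> and weakens the closeness by the same factor. A bound with the height in
    the denominator is therefore preserved.\<close>
  obtain e v where v: "v \<in> indivisible p" "\<And>l. w $ l = int p ^ e * v $ l"
    using indivisible_part[OF w0 p1] by blast
  have ht: "int_height v \<le> real p ^ (j * d) / real p ^ e"
    unfolding int_height_le_iff
  proof
    fix l
    have "real_of_int \<bar>w $ l\<bar> \<le> real_of_int M" using w_le[of l] by (simp only: of_int_le_iff)
    then have "real p ^ e * real_of_int \<bar>v $ l\<bar> \<le> real p ^ (j * d)"
      by (simp add: v(2) M_def abs_mult)
    then show "real_of_int \<bar>v $ l\<bar> \<le> real p ^ (j * d) / real p ^ e"
      using p1 by (simp add: pos_le_divide_eq mult.commute)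
  qed
  also have "\<dots> \<le> real p ^ (j * d) / 1" using p1 by (intro divide_left_mono) auto
  finally have ht': "int_height v \<le> real p ^ (j * d)" by simp
  have v0: "v \<noteq> 0" using v(1) by (auto simp: indivisible_def)
  have hpos: "int_height v > 0" using int_height_ge_1[OF v0] by linarith
  have norm1: "sup_norm (int_vec v :: 'p padic ^ 'n) = 1" using v(1) sup_norm_indivisible by (simp add: p_def)
  have v_close: "vabs (of_int (v $ l) - \<theta> l * of_int (v $ i)) \<le> real p ^ e / real p ^ q" for l
  proof -
    have pe: "vabs (of_int (int p ^ e) :: 'p padic) \<ge> 1 / real p ^ e"
    proof -
      have "\<not> int p ^ Suc e dvd int p ^ e" using p1 by (simp add: power_dvd_imp_le dvd_power_iff_le)
      then show ?thesis unfolding p_def by (rule vabs_of_int_ge)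
    qed
    have "of_int (w $ l) - \<theta> l * of_int (w $ i) = of_int (int p ^ e) * (of_int (v $ l) - \<theta> l * of_int (v $ i))"
      by (simp add: v(2) algebra_simps)
    then have "vabs (of_int (int p ^ e) :: 'p padic) * vabs (of_int (v $ l) - \<theta> l * of_int (v $ i)) \<le> 1 / real p ^ q"
      using w_close[of l] by (simp only: vabs_mult)
    then have "1 / real p ^ e * vabs (of_int (v $ l) - \<theta> l * of_int (v $ i)) \<le> 1 / real p ^ q"
      using mult_right_mono[OF pe, of "vabs (of_int (v $ l) - \<theta> l * of_int (v $ i))"] by simp
    then show ?thesis using p1 by (simp add: field_simps)
  qed
  have "int_vec v - (of_int (v $ i) / x $ i) *s x = (\<chi> l. of_int (v $ l) - \<theta> l * of_int (v $ i))"
    by (simp add: vec_eq_iff int_vec_def \<theta>_def)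
  then have "sup_norm (int_vec v - (of_int (v $ i) / x $ i) *s x) \<le> real p ^ e / real p ^ q"
    using v_close by (simp add: sup_norm_le_iff)
  also have "\<dots> \<le> 1 / (real p ^ j * int_height v)"
  proof -
    have "real p ^ e * (real p ^ j * int_height v) \<le> real p ^ e * (real p ^ j * (real p ^ (j * d) / real p ^ e))"
      using ht by (intro mult_left_mono) auto
    also have "\<dots> = real p ^ q" using p1 by (simp add: q_def power_add)
    finally show ?thesis using p1 hpos by (simp add: field_simps)
  qed
  finally have "sup_norm (int_vec v - (of_int (v $ i) / x $ i) *s x)
      \<le> 1 / (real p ^ j * int_height v) * sup_norm (int_vec v :: 'p padic ^ 'n)"
    by (simp add: norm1)
  from close_to_line_imp_near[OF this] have "near (2 / (real p ^ j * int_height v)) x (int_vec v)"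
    by (simp add: near_commute)
  moreover have "int_height v \<le> 2 * real p ^ (j * d)"
    using ht' zero_le_power[of "real p" "j * d"] by linarith
  ultimately show ?thesis using v(1) by (auto simp: p_def)
qed

text \<open>Cells are themselves balls, so any point of a cell can serve as the centre in
  \<open>cell_ball\<close>. The powers of \<open>CARD('p)\<close> among the constants come from
  rounding radii to powers of the prime.\<close>

lemma projective_khinchin_padic:
  assumes d: "CARD('n::finite) = Suc d" "d > 0"
  shows "projective_khinchin padic_haar (padic_cell :: nat \<Rightarrow> 'p::prime_card padic ^ 'n \<Rightarrow> _) d CARD('p) 2
    (indivisible CARD('p)) ((1 / real CARD('p)) ^ Suc d) (real CARD('p) ^ Suc d) (1 / real CARD('p))
    (real CARD('p) ^ 2) (3 * 2 ^ d)"
proof (intro projective_khinchin.intro nested_cells_padic padic_haar_properties(1) projective_khinchin_axioms.intro)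
  have p: "CARD('p) > 1" by (rule prime_card_gt_1)
  then show "2 \<le> CARD('p)" by simp
  show "0 < (1 / real CARD('p)) ^ Suc d" "0 < real CARD('p) ^ Suc d" "0 < 1 / real CARD('p)" "0 < real CARD('p) ^ 2"
    using p by auto
  fix x :: "'p padic ^ 'n" and r :: real
  show "emeasure padic_haar (sup_ball x r) < \<infinity>" by (rule padic_haar_ball_bounds)
  show "(1 / real CARD('p)) ^ Suc d * r ^ Suc d \<le> measure padic_haar (sup_ball x r)" if "0 < r"
    using padic_haar_ball_bounds(2)[OF that, of x] by (simp only: d(1))
  show "measure padic_haar (sup_ball x r) \<le> real CARD('p) ^ Suc d * r ^ Suc d" if "0 < r"
    using padic_haar_ball_bounds(3)[OF that, of x] by (simp only: d(1))
next
  fix k and x :: "'p padic ^ 'n"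
  have "1 / real CARD('p) ^ k / 2 \<le> 1 / real CARD('p) ^ k" by (simp add: field_simps)
  then have "sup_ball x (1 / real CARD('p) ^ k / 2) \<subseteq> padic_cell k x"
    unfolding padic_cell_def by (intro sup_ball_subset) simp
  then have "\<exists>z. sup_ball z (1 / real CARD('p) ^ k / 2) \<subseteq> padic_cell k x \<and> padic_cell k x \<subseteq> sup_ball z (1 / real CARD('p) ^ k)"
    by (auto simp: padic_cell_def)
  then show "\<exists>z. sup_ball z (1 / real (CARD('p) ^ k) / 2) \<subseteq> padic_cell k x \<and> padic_cell k x \<subseteq> sup_ball z (1 / real (CARD('p) ^ k))"
    by simp
next
  fix z :: "int ^ 'n"
  assume "z \<in> indivisible CARD('p)"
  then show "z \<noteq> 0" by (auto simp: indivisible_def)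
next
  fix x :: "'p padic ^ 'n" and h r :: real
  assume x: "x \<noteq> 0" "h \<ge> 1" "0 < r" "r \<le> 1"
  show "real (card {z \<in> indivisible CARD('p). int_height z \<le> h \<and> near r x (int_vec z)}) \<le> 3 * 2 ^ d * h * (1 + h * r) ^ d"
  proof (rule count_integer_points_near_line[OF x(1-3) d(1)])
    show "sup_norm (int_vec z :: 'p padic ^ 'n) \<le> 1" if "z \<in> indivisible CARD('p)" for z
      using sup_norm_indivisible[OF that] by simp
    show "real (card {m. real_of_int \<bar>m\<bar> \<le> h \<and> vabs (of_int m - a) \<le> r * 1}) \<le> 2 * h * r + 1" for a :: "'p padic"
      using card_int_near_padic[OF x(2,3), of a] by simp
  qed
qed (use d separated_padic covering_padic Dirichlet_padic[OF _ d(1)] in simp_all)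

theorem theorem3:
  fixes \<psi> :: "real \<Rightarrow> real"
  assumes "CARD('n::{finite,linorder}) \<ge> 2"
    and "\<And>x. x \<ge> 0 \<Longrightarrow> \<psi> x \<ge> 0"
    and "antimono_on {0..} \<psi>"
    and "filterlim (\<lambda>N. \<Sum>q=1..N. real q ^ (CARD('n) - 1) * \<psi> (real q) ^ (CARD('n) - 1)) at_top sequentially"
  shows "proj_measure lborel (approximable \<psi> :: (real, 'n) proj set) = 1
    \<and> proj_measure padic_haar (approximable \<psi> :: ('p::prime_card padic, 'n) proj set) = 1"
proof -
  define d where "d = CARD('n) - 1"
  have d: "CARD('n) = Suc d" "d > 0" using assms(1) by (simp_all add: d_def)
  define f where "f = (\<lambda>q. real q ^ d * \<psi> (real q) ^ d)"
  have div: "\<not> summable f"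
  proof
    assume "summable f"
    moreover have "f q \<ge> 0" for q using assms(2) by (simp add: f_def)
    ultimately have le: "(\<Sum>q=1..N. f q) \<le> suminf f" for N by (intro sum_le_suminf) auto
    have "\<forall>\<^sub>F N in sequentially. suminf f < (\<Sum>q=1..N. f q)"
      using assms(4) unfolding filterlim_at_top_dense f_def d_def by blast
    then obtain N where "suminf f < (\<Sum>q=1..N. f q)" by (auto simp: eventually_sequentially)
    then show False using le[of N] by simp
  qed
  have "proj_measure lborel (approximable \<psi> :: (real, 'n) proj set) = 1"
    using assms(2) div unfolding f_def
    by (intro proj_measure_approximable[OF projective_khinchin_real[OF d] _ assms(3)])
  moreover have "proj_measure padic_haar (approximable \<psi> :: ('p padic, 'n) proj set) = 1"
    using assms(2) div unfolding f_def
    by (intro proj_measure_approximable[OF projective_khinchin_padic[OF d] _ assms(3)])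
  ultimately show ?thesis ..
qed

end
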